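(* The equality of polynomial time (in fact, quadratic time) functions is complete for $\Pi^0_1$ equivalence relations. That is, the relation $\{(i,j): t_i=t_j\}$, where $t_i$ is the $i$th polynomial time function, is a $\Pi^0_1$ equivalence relation on $\mathbb{N}$, and for every $\Pi^0_1$ equivalence relation $E$ on $\mathbb{N}$ one can, computably in $x\in\mathbb{N}$, obtain (an index for) a quadratic time function $g_x$ such that for all $x,y\in\mathbb{N}$: $$(x,y)\in E\iff g_x=g_y.$$
   Context: Functions are from strings to strings over a finite alphabet. $(t_i)_{i\in\mathbb{N}}$ is a standard effective enumeration of all polynomial time computable functions, e.g. by Turing machines with polynomial clocks. A quadratic time function is one computed by a Turing machine in time $O(n^2)$, where $n$ is the length of the input; indices of quadratic time functions are likewise indices of clocked machines. A $\Pi^0_1$ equivalence relation is an equivalence relation on $\mathbb{N}$ whose complement in $\mathbb{N}^2$ is recursively enumerable. Completeness for $\Pi^0_1$ equivalence relations means being $\Pi^0_1$ and having every $\Pi^0_1$ equivalence relation $E$ computably component-wise reducible to it, i.e. there is a computable $h:\mathbb{N}\to\mathbb{N}$ such that $x,y$ are $E$-related iff $h(x),h(y)$ are related. *)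

theory Defs
  imports Complex_Main "HOL-Library.FuncSet" "HOL-Library.Nat_Bijection" "HOL-Library.Landau_Symbols"
begin

section \<open>Computability on the natural numbers\<close>

text \<open>Partial recursive functions. A tuple of arguments is a list; terms applied to lists of an
  unsuitable length are undefined.\<close>

datatype recf =
    Zero
  | Succ
  | Proj nat
  | Comp recf "recf list"
  | PrimRec recf recf
  | Mu recf

inductive eval :: "recf \<Rightarrow> nat list \<Rightarrow> nat \<Rightarrow> bool" where
  "eval Zero xs 0"
| "eval Succ [x] (Suc x)"
| "i < length xs \<Longrightarrow> eval (Proj i) xs (xs ! i)"
| "list_all2 (\<lambda>g y. eval g xs y) gs ys \<Longrightarrow> eval f ys z \<Longrightarrow> eval (Comp f gs) xs z"
| "eval f xs z \<Longrightarrow> eval (PrimRec f g) (0 # xs) z"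
| "eval (PrimRec f g) (n # xs) y \<Longrightarrow> eval g (n # y # xs) z \<Longrightarrow> eval (PrimRec f g) (Suc n # xs) z"
| "eval f (n # xs) 0 \<Longrightarrow> \<forall>m<n. \<exists>y. eval f (m # xs) (Suc y) \<Longrightarrow> eval (Mu f) xs n"

definition computable :: "(nat \<Rightarrow> nat) \<Rightarrow> bool" where
  "computable h \<longleftrightarrow> (\<exists>f. \<forall>x y. eval f [x] y \<longleftrightarrow> y = h x)"

definition rec_enum :: "(nat \<times> nat) set \<Rightarrow> bool" where
  "rec_enum R \<longleftrightarrow> (\<exists>f. \<forall>x y. (x, y) \<in> R \<longleftrightarrow> (\<exists>z. eval f [x, y] z))"

definition Pi01_equiv :: "(nat \<times> nat) set \<Rightarrow> bool" where
  "Pi01_equiv E \<longleftrightarrow> equiv UNIV E \<and> rec_enum (- E)"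

definition reducible :: "(nat \<times> nat) set \<Rightarrow> (nat \<times> nat) set \<Rightarrow> bool" where
  "reducible E R \<longleftrightarrow> (\<exists>h. computable h \<and> (\<forall>x y. (x, y) \<in> E \<longleftrightarrow> (h x, h y) \<in> R))"

definition Pi01_complete :: "(nat \<times> nat) set \<Rightarrow> bool" where
  "Pi01_complete R \<longleftrightarrow> Pi01_equiv R \<and> (\<forall>E. Pi01_equiv E \<longrightarrow> reducible E R)"


section \<open>Turing machines\<close>

text \<open>The alphabet of size \<open>k\<close> is \<open>{1..k}\<close>, and strings are elements of \<open>lists {1..k}\<close>. The tape
  symbol 0 is the blank; machines may use any further natural numbers as tape symbols, of which
  only finitely many occur in a program.

  Machines are deterministic and have any positive number of tapes, each infinite in both
  directions. A tape \<open>(ls, rs)\<close> has contents \<open>rev ls @ rs\<close>, surrounded by blanks, and the head is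
  on the first cell of \<open>rs\<close> (a blank one if \<open>rs = []\<close>).\<close>

type_synonym tape = "nat list \<times> nat list"

datatype move = MoveLeft | MoveRight | Stay

fun scanned :: "nat list \<Rightarrow> nat" where
  "scanned [] = 0"
| "scanned (a # as) = a"

fun read :: "tape \<Rightarrow> nat" where
  "read (ls, rs) = scanned rs"

fun put :: "nat \<Rightarrow> tape \<Rightarrow> tape" where
  "put a (ls, rs) = (ls, a # tl rs)"

fun shift :: "move \<Rightarrow> tape \<Rightarrow> tape" where
  "shift MoveLeft (ls, rs) = (tl ls, scanned ls # rs)"
| "shift MoveRight (ls, rs) = (scanned rs # ls, tl rs)"
| "shift Stay t = t"

text \<open>An instruction \<open>(q, as, r)\<close> leads from state \<open>q\<close> to state \<open>r\<close>; the list \<open>as\<close> has one entry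
  (symbol read, symbol written, head movement) for every tape. Of several applicable instructions
  the first one is executed. A machine \<open>(m, P)\<close> has \<open>m + 1\<close> tapes and program \<open>P\<close>.\<close>

type_synonym instr = "nat \<times> (nat \<times> nat \<times> move) list \<times> nat"
type_synonym machine = "nat \<times> instr list"
type_synonym config = "nat \<times> tape list"

fun applicable :: "config \<Rightarrow> instr \<Rightarrow> bool" where
  "applicable (s, ts) (q, as, r) \<longleftrightarrow> q = s \<and> map fst as = map read ts"

fun exec :: "instr \<Rightarrow> config \<Rightarrow> config" where
  "exec (q, as, r) (s, ts) = (r, map2 (\<lambda>(a, b, d) t. shift d (put b t)) as ts)"

definition halted :: "machine \<Rightarrow> config \<Rightarrow> bool" where
  "halted M c \<longleftrightarrow> (\<forall>i \<in> set (snd M). \<not> applicable c i)"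

definition step :: "machine \<Rightarrow> config \<Rightarrow> config" where
  "step M c = (case find (applicable c) (snd M) of None \<Rightarrow> c | Some i \<Rightarrow> exec i c)"

definition start :: "machine \<Rightarrow> nat list \<Rightarrow> config" where
  "start M w = (0, ([], w) # replicate (fst M) ([], []))"

definition run :: "machine \<Rightarrow> nat \<Rightarrow> nat list \<Rightarrow> config" where
  "run M n w = (step M ^^ n) (start M w)"

text \<open>The output is the longest string over the alphabet on the first tape that starts at the
  head position.\<close>

definition result :: "nat \<Rightarrow> config \<Rightarrow> nat list" where
  "result k c = takeWhile (\<lambda>a. a \<in> {1..k}) (snd (hd (snd c)))"


section \<open>Time bounds and clocked machines\<close>

text \<open>Functions on strings are extensional, so that equality of them is equality on
  \<open>lists {1..k}\<close>. As \<open>step\<close> leaves halted configurations unchanged, a machine that is halted after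
  \<open>T\<close> steps is one that halts within \<open>T\<close> steps.\<close>

definition computes_in_time :: "nat \<Rightarrow> machine \<Rightarrow> (nat \<Rightarrow> nat) \<Rightarrow> (nat list \<Rightarrow> nat list) \<Rightarrow> bool" where
  "computes_in_time k M T f \<longleftrightarrow>
     f \<in> lists {1..k} \<rightarrow>\<^sub>E lists {1..k} \<and>
     (\<forall>w \<in> lists {1..k}. halted M (run M (T (length w)) w) \<and>
                         result k (run M (T (length w)) w) = f w)"

definition time_degree :: "nat \<Rightarrow> nat \<Rightarrow> (nat list \<Rightarrow> nat list) \<Rightarrow> bool" where
  "time_degree k d f \<longleftrightarrow>
     (\<exists>M T. (\<lambda>n. real (T n)) \<in> O(\<lambda>n. real n ^ d) \<and> computes_in_time k M T f)"

definition polynomial_time :: "nat \<Rightarrow> (nat list \<Rightarrow> nat list) \<Rightarrow> bool" where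
  "polynomial_time k f \<longleftrightarrow> (\<exists>d. time_degree k d f)"

definition quadratic_time :: "nat \<Rightarrow> (nat list \<Rightarrow> nat list) \<Rightarrow> bool" where
  "quadratic_time k f \<longleftrightarrow> time_degree k 2 f"

text \<open>A clock \<open>T\<close> stops the machine after \<open>T (length w)\<close> steps on input \<open>w\<close>, whether or not it has
  halted by then.\<close>

definition clocked :: "nat \<Rightarrow> machine \<Rightarrow> (nat \<Rightarrow> nat) \<Rightarrow> nat list \<Rightarrow> nat list" where
  "clocked k M T = (\<lambda>w \<in> lists {1..k}. result k (run M (T (length w)) w))"

definition decode_move :: "nat \<Rightarrow> move" where
  "decode_move n = (if n = 0 then MoveLeft else if n = 1 then MoveRight else Stay)"

definition decode_act :: "nat \<Rightarrow> nat \<times> nat \<times> move" where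
  "decode_act n = (let (a, p) = prod_decode n; (b, d) = prod_decode p in (a, b, decode_move d))"

definition decode_instr :: "nat \<Rightarrow> instr" where
  "decode_instr n =
     (let (q, p) = prod_decode n; (as, r) = prod_decode p
      in (q, map decode_act (list_decode as), r))"

definition decode_machine :: "nat \<Rightarrow> machine" where
  "decode_machine e = (let (m, p) = prod_decode e in (m, map decode_instr (list_decode p)))"

text \<open>The \<open>i\<close>-th polynomial time function, and the \<open>i\<close>-th quadratic time function.\<close>

definition ptime :: "nat \<Rightarrow> nat \<Rightarrow> nat list \<Rightarrow> nat list" where
  "ptime k i =
     (let (e, p) = prod_decode i; (c, d) = prod_decode p
      in clocked k (decode_machine e) (\<lambda>n. c * n ^ d + c))"

definition qtime :: "nat \<Rightarrow> nat \<Rightarrow> nat list \<Rightarrow> nat list" where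
  "qtime k i = (let (e, c) = prod_decode i in clocked k (decode_machine e) (\<lambda>n. c * n ^ 2 + c))"


section \<open>Every polynomial (quadratic) time function has an index\<close>

lemma decode_move_surj: "\<exists>n. decode_move n = d"
proof (cases d)
  case MoveLeft then show ?thesis by (intro exI[of _ 0]) (simp add: decode_move_def)
next
  case MoveRight then show ?thesis by (intro exI[of _ 1]) (simp add: decode_move_def)
next
  case Stay then show ?thesis by (intro exI[of _ 2]) (simp add: decode_move_def)
qed

lemma map_decode_surj:
  assumes "\<And>x. \<exists>n. dec n = x"
  shows "\<exists>n. map dec (list_decode n) = xs"
proof -
  have "\<exists>ns. map dec ns = xs"
  proof (induction xs)
    case (Cons x xs)
    then obtain ns n where "map dec ns = xs" "dec n = x" using assms by blast
    then have "map dec (n # ns) = x # xs" by simp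
    then show ?case by (rule exI)
  qed simp
  then show ?thesis by (metis list_encode_inverse)
qed

lemma decode_act_surj: "\<exists>n. decode_act n = x"
proof -
  obtain a b d where x: "x = (a, b, d)" by (cases x)
  obtain m where "decode_move m = d" using decode_move_surj by blast
  then have "decode_act (prod_encode (a, prod_encode (b, m))) = x"
    by (simp add: decode_act_def x)
  then show ?thesis by blast
qed

lemma decode_instr_surj: "\<exists>n. decode_instr n = x"
proof -
  obtain q as r where x: "x = (q, as, r)" by (cases x)
  obtain m where "map decode_act (list_decode m) = as"
    using map_decode_surj[OF decode_act_surj] by blast
  then have "decode_instr (prod_encode (q, prod_encode (m, r))) = x"
    by (simp add: decode_instr_def x)
  then show ?thesis by blast
qed

lemma decode_machine_surj: "\<exists>e. decode_machine e = M"
proof -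
  obtain m P where M: "M = (m, P)" by (cases M)
  obtain p where "map decode_instr (list_decode p) = P"
    using map_decode_surj[OF decode_instr_surj] by blast
  then have "decode_machine (prod_encode (m, p)) = M"
    by (simp add: decode_machine_def M)
  then show ?thesis by blast
qed

lemma step_halted: "halted M c \<Longrightarrow> step M c = c"
proof -
  assume "halted M c"
  then have "find (applicable c) (snd M) = None"
    by (auto simp: halted_def find_None_iff)
  then show ?thesis by (simp add: step_def)
qed

lemma run_halted:
  assumes "halted M (run M m w)" "m \<le> n"
  shows "run M n w = run M m w"
  using assms(2)
proof (induction n rule: dec_induct)
  case (step n)
  then show ?case using step_halted[OF assms(1)] by (simp add: run_def)
qed simp

lemma clocked_eq:
  assumes "computes_in_time k M T f" "\<And>n. T n \<le> T' n"
  shows "clocked k M T' = f"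
proof
  fix w
  show "clocked k M T' w = f w"
  proof (cases "w \<in> lists {1..k}")
    case True
    then have "halted M (run M (T (length w)) w)" "result k (run M (T (length w)) w) = f w"
      using assms(1) unfolding computes_in_time_def by blast+
    then show ?thesis
      using True run_halted[OF _ assms(2)] by (simp add: clocked_def)
  next
    case False
    then show ?thesis
      using assms(1) by (auto simp: clocked_def computes_in_time_def PiE_def extensional_def)
  qed
qed

lemma bigo_clock:
  fixes T :: "nat \<Rightarrow> nat"
  assumes "(\<lambda>n. real (T n)) \<in> O(\<lambda>n. real n ^ d)"
  shows "\<exists>c. \<forall>n. T n \<le> c * n ^ d + c"
proof -
  obtain b where "\<forall>\<^sub>F n in sequentially. norm (real (T n)) \<le> b * norm (real n ^ d)"
    using assms by (auto elim: landau_o.bigE)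
  then obtain N where N: "\<And>n. n \<ge> N \<Longrightarrow> real (T n) \<le> b * real n ^ d"
    by (auto simp: eventually_sequentially)
  define c where "c = nat \<lceil>b\<rceil> + (\<Sum>n<N. T n)"
  have "T n \<le> c * n ^ d + c" for n
  proof (cases "n < N")
    case True
    then have "T n \<le> (\<Sum>n<N. T n)" by (intro member_le_sum) auto
    then show ?thesis by (simp add: c_def)
  next
    case False
    then have "real (T n) \<le> b * real n ^ d" using N by simp
    also have "\<dots> \<le> real c * real n ^ d"
    proof (rule mult_right_mono)
      have "b \<le> real (nat \<lceil>b\<rceil>)" by (rule real_nat_ceiling_ge)
      also have "\<dots> \<le> real c" unfolding c_def by (rule of_nat_mono) simp
      finally show "b \<le> real c" .
    qed simp
    finally have "real (T n) \<le> real (c * n ^ d)" by simp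
    then show ?thesis by linarith
  qed
  then show ?thesis by blast
qed

lemma time_degree_clocked:
  assumes "time_degree k d f"
  shows "\<exists>e c. f = clocked k (decode_machine e) (\<lambda>n. c * n ^ d + c)"
  using assms clocked_eq bigo_clock decode_machine_surj unfolding time_degree_def by metis

theorem polynomial_time_index: "polynomial_time k f \<Longrightarrow> \<exists>i. f = ptime k i"
proof -
  assume "polynomial_time k f"
  then obtain e c d where "f = clocked k (decode_machine e) (\<lambda>n. c * n ^ d + c)"
    using time_degree_clocked unfolding polynomial_time_def by blast
  then have "f = ptime k (prod_encode (e, prod_encode (c, d)))" by (simp add: ptime_def)
  then show ?thesis by blast
qed

theorem quadratic_time_index: "quadratic_time k f \<Longrightarrow> \<exists>i. f = qtime k i"
proof -
  assume "quadratic_time k f"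
  then obtain e c where "f = clocked k (decode_machine e) (\<lambda>n. c * n ^ 2 + c)"
    using time_degree_clocked unfolding quadratic_time_def by blast
  then have "f = qtime k (prod_encode (e, c))" by (simp add: qtime_def)
  then show ?thesis by blast
qed

end

theory Submission imports Defs begin

text \<open>Let \<open>E\<close> be a co-enumerable equivalence relation. A pair \<open>a\<close>, \<open>b\<close> of inequivalent numbers can be
  separated by a decidable set that is a union of \<open>E\<close>-classes: put \<open>a\<close> in, \<open>b\<close> out, and decide
  about \<open>0, 1, ...\<close> in turn, waiting each time until the new number is seen to be inequivalent to
  everything that is in, or to everything that is out. So there is a computable
  \<open>col\<close> such that \<open>x\<close> and \<open>y\<close> are equivalent iff \<open>col x e = col y e\<close> for all \<open>e\<close>.

  A fixed program, run for as many steps as the input of the Turing machine is long, computes for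
  \<open>e = 0, 1, ...\<close> the values \<open>col 0 e, ..., col e e\<close> and then passes an event. The machine for
  \<open>x\<close> outputs \<open>col x e\<close> if its clock stops the program exactly at the \<open>e\<close>-th event. The
  timing of the program does not depend on \<open>x\<close>, so this function depends on \<open>col x\<close> only. For
  \<open>e \<ge> x\<close> the machine picks up \<open>col x e\<close> when the program computes it; the finitely many values
  for \<open>e < x\<close> are built into the machine, at a cost that is constant for fixed \<open>x\<close>.\<close>

section \<open>Computable functions of numbers\<close>

text \<open>Since \<open>E\<close> is only co-enumerable, a machine can never confirm an
  equivalence; its output must be built from decidable data that equivalent numbers share, hence the
  separating sets. The second obstacle is time: no bound is known for the evaluation of
  \<open>col x e\<close>, so the machine has to wait for an input that is long enough, and the
  length at which an answer appears must not betray \<open>x\<close>. This is why every round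
  computes the colors of all numbers up to \<open>e\<close>, and why the prologue, whose length does
  depend on \<open>x\<close>, leaves the input head where it is: symbol \<open>m\<close> of the
  input always pays for step \<open>m\<close> of the same program. A round must be finite and cannot
  serve all \<open>x\<close> at once; this is the origin of the missing values for
  \<open>e < x\<close>. Registers are kept in unary as head positions, so that each instruction
  costs one machine step. The total time is \<open>n + 2 * x + 2\<close> on inputs of length
  \<open>n\<close>, and \<open>2 * x + 2\<close> serves as the clock constant, which is computable
  in \<open>x\<close>.\<close>

lemma eval_det: "eval f xs y \<Longrightarrow> eval f xs z \<Longrightarrow> y = z"
proof (induction arbitrary: z rule: eval.induct)
  case (4 xs gs ys f y)
  from 4(4) obtain zs where zs: "list_all2 (\<lambda>g y. eval g xs y) gs zs" "eval f zs z"
    by (cases rule: eval.cases) auto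
  have "ys = zs"
  proof (rule nth_equalityI)
    show len: "length ys = length zs"
      using list_all2_lengthD[OF 4(1)] list_all2_lengthD[OF zs(1)] by simp
    fix i assume "i < length ys"
    then show "ys ! i = zs ! i"
      using list_all2_nthD2[OF 4(1)] list_all2_nthD2[OF zs(1)] len by metis
  qed
  then show ?case using 4 zs(2) by metis
next
  case (6 f g n xs y w)
  from 6(5) show ?case
    by (cases rule: eval.cases) (use 6 in auto)
next
  case (7 f n xs)
  from 7(4) obtain m where m: "z = m" "eval f (m # xs) 0" "\<forall>i<m. \<exists>y. eval f (i # xs) (Suc y)"
    by (cases rule: eval.cases) auto
  have "\<not> m < n" using 7(3) m(2) by blast
  moreover have "\<not> n < m" using 7(2) m(3) by blast
  ultimately show ?case using m(1) by simp
next
  case 1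
  then show ?case by (cases rule: eval.cases) auto
next
  case 2
  then show ?case by (cases rule: eval.cases) auto
next
  case 3
  from 3(2) show ?case by (cases rule: eval.cases) auto
next
  case 5
  from 5(3) show ?case by (cases rule: eval.cases) (use 5 in auto)
qed

definition computable2 :: "(nat \<Rightarrow> nat \<Rightarrow> nat) \<Rightarrow> bool" where
  "computable2 h \<longleftrightarrow> (\<exists>f. \<forall>x y. eval f [x, y] (h x y))"

definition computable3 :: "(nat \<Rightarrow> nat \<Rightarrow> nat \<Rightarrow> nat) \<Rightarrow> bool" where
  "computable3 h \<longleftrightarrow> (\<exists>f. \<forall>x y z. eval f [x, y, z] (h x y z))"

text \<open>Values are unique by \<open>eval_det\<close>, so exhibiting the right value at every
  argument already yields the equivalence in the definition.\<close>

lemma computable_iff: "computable h \<longleftrightarrow> (\<exists>f. \<forall>x. eval f [x] (h x))"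
  unfolding computable_def using eval_det by metis

lemma eval_Comp1: "eval g xs a \<Longrightarrow> eval f [a] z \<Longrightarrow> eval (Comp f [g]) xs z"
  by (rule eval.intros(4)[where ys = "[a]"]) auto

lemma eval_Comp2: "eval g xs a \<Longrightarrow> eval h xs b \<Longrightarrow> eval f [a, b] z \<Longrightarrow> eval (Comp f [g, h]) xs z"
  by (rule eval.intros(4)[where ys = "[a, b]"]) auto

lemma eval_Proj: "i < length xs \<Longrightarrow> y = xs ! i \<Longrightarrow> eval (Proj i) xs y"
  using eval.intros(3) by simp

lemma computable_id: "computable (\<lambda>x. x)"
  unfolding computable_iff by (intro exI[of _ "Proj 0"] allI eval_Proj) auto

lemma computable_Suc: "computable Suc"
  unfolding computable_iff by (intro exI[of _ Succ] allI eval.intros)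

lemma computable_compose: "computable f \<Longrightarrow> computable g \<Longrightarrow> computable (\<lambda>x. f (g x))"
  unfolding computable_iff using eval_Comp1 by meson

lemma computable_const: "computable (\<lambda>_. c)"
proof (induction c)
  case 0
  show ?case unfolding computable_iff using eval.intros(1) by blast
next
  case (Suc c)
  from computable_compose[OF computable_Suc Suc] show ?case .
qed

lemma computable_compose2:
  "computable2 h \<Longrightarrow> computable f \<Longrightarrow> computable g \<Longrightarrow> computable (\<lambda>x. h (f x) (g x))"
  unfolding computable_iff computable2_def using eval_Comp2 by meson

lemma computable2_compose2:
  assumes "computable2 h" "computable2 f" "computable2 g"
  shows "computable2 (\<lambda>x y. h (f x y) (g x y))"
  using assms unfolding computable2_def using eval_Comp2 by meson

lemma computable3_compose2:
  assumes "computable2 h" "computable3 f" "computable3 g"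
  shows "computable3 (\<lambda>x y z. h (f x y z) (g x y z))"
  using assms unfolding computable2_def computable3_def using eval_Comp2 by meson

lemma computable2_compose1: "computable h \<Longrightarrow> computable2 f \<Longrightarrow> computable2 (\<lambda>x y. h (f x y))"
  unfolding computable_iff computable2_def using eval_Comp1 by meson

lemma computable3_compose1: "computable h \<Longrightarrow> computable3 f \<Longrightarrow> computable3 (\<lambda>x y z. h (f x y z))"
  unfolding computable_iff computable3_def using eval_Comp1 by meson

lemma computable2_proj: "computable2 (\<lambda>x y. x)" "computable2 (\<lambda>x y. y)"
  unfolding computable2_def
  subgoal by (rule exI[of _ "Proj 0"], intro allI eval_Proj; simp)
  subgoal by (rule exI[of _ "Proj 1"], intro allI eval_Proj; simp)
  done

lemma computable3_proj:
  "computable3 (\<lambda>x y z. x)" "computable3 (\<lambda>x y z. y)" "computable3 (\<lambda>x y z. z)"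
  unfolding computable3_def
  subgoal by (rule exI[of _ "Proj 0"], intro allI eval_Proj; simp)
  subgoal by (rule exI[of _ "Proj 1"], intro allI eval_Proj; simp)
  subgoal by (rule exI[of _ "Proj 2"], intro allI eval_Proj; simp)
  done

lemma computable2_rec:
  assumes "computable f" "computable3 g"
  shows "computable2 (\<lambda>n x. rec_nat (f x) (\<lambda>m y. g m y x) n)"
proof -
  obtain F G where F: "\<And>x. eval F [x] (f x)" and G: "\<And>m y x. eval G [m, y, x] (g m y x)"
    using assms unfolding computable_iff computable3_def by blast
  have "eval (PrimRec F G) [n, x] (rec_nat (f x) (\<lambda>m y. g m y x) n)" for n x
    by (induction n) (auto intro: eval.intros F G)
  then show ?thesis unfolding computable2_def by blast
qed

lemma computable2_add: "computable2 (+)"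
proof -
  have "rec_nat y (\<lambda>m z. Suc z) x = x + y" for x y :: nat by (induction x) auto
  then show ?thesis
    using computable2_rec[OF computable_id computable3_compose1[OF computable_Suc computable3_proj(2)]]
    by simp
qed

lemma computable2_swap: "computable2 h \<Longrightarrow> computable2 (\<lambda>x y. h y x)"
  by (rule computable2_compose2[OF _ computable2_proj(2,1)])

lemma computable2_mult: "computable2 (*)"
proof -
  have "rec_nat 0 (\<lambda>m z. z + y) x = x * y" for x y :: nat by (induction x) auto
  then show ?thesis
    using computable2_rec[OF computable_const
      computable3_compose2[OF computable2_add computable3_proj(2,3)], of 0] by simp
qed

lemma computable_pred: "computable (\<lambda>x. x - 1)"
proof -
  have "rec_nat 0 (\<lambda>m z. m) x = x - 1" for x :: nat by (cases x) auto
  moreover have "computable (\<lambda>x. rec_nat 0 (\<lambda>m z. m) x)"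
    by (rule computable_compose2[OF computable2_rec[OF computable_const computable3_proj(1)]
          computable_id computable_id])
  ultimately show ?thesis by simp
qed

lemma computable2_diff: "computable2 (-)"
proof -
  have "rec_nat y (\<lambda>m z. z - 1) x = y - x" for x y :: nat by (induction x) auto
  then have "computable2 (\<lambda>x y. y - x)"
    using computable2_rec[OF computable_id computable3_compose1[OF computable_pred computable3_proj(2)]]
    by simp
  then show ?thesis by (rule computable2_swap)
qed

lemma computable_triangle: "computable triangle"
proof -
  have "rec_nat 0 (\<lambda>m z. z + Suc m) x = triangle x" for x by (induction x) auto
  moreover have "computable (\<lambda>x. rec_nat 0 (\<lambda>m z. z + Suc m) x)"
    by (rule computable_compose2[OF computable2_rec[OF computable_const
          computable3_compose2[OF computable2_add computable3_proj(2)
            computable3_compose1[OF computable_Suc computable3_proj(1)]]]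
          computable_id computable_id])
  ultimately show ?thesis by simp
qed

lemma computable2_prod_encode: "computable2 (\<lambda>x y. prod_encode (x, y))"
  unfolding prod_encode_def prod.case
  by (intro computable2_compose2[OF computable2_add] computable2_compose1[OF computable_triangle]
      computable2_proj)

lemma computable_Least:
  assumes "computable2 h" "\<And>x. \<exists>n. h n x = 0"
  shows "computable (\<lambda>x. LEAST n. h n x = 0)"
proof -
  obtain f where f: "\<And>n x. eval f [n, x] (h n x)" using assms(1) unfolding computable2_def by blast
  have "eval (Mu f) [x] (LEAST n. h n x = 0)" for x
  proof (rule eval.intros(7))
    have "h (LEAST n. h n x = 0) x = 0" using assms(2) by (rule LeastI_ex)
    then show "eval f [LEAST n. h n x = 0, x] 0" using f by metis
    show "\<forall>m<LEAST n. h n x = 0. \<exists>y. eval f [m, x] (Suc y)"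
      using f not_less_Least by (metis not0_implies_Suc)
  qed
  then show ?thesis unfolding computable_iff by blast
qed

lemma triangle_mono: "m \<le> n \<Longrightarrow> triangle m \<le> triangle n"
  by (induction n rule: dec_induct) auto

text \<open>Inverts Cantor pairing: \<open>prod_encode (a, b)\<close> is
  \<open>triangle (a + b) + a\<close>, so \<open>a + b\<close> is the first \<open>k\<close> with
  \<open>n < triangle (Suc k)\<close>. Truncated subtraction turns this inequality into an equation
  with 0, the form that minimization accepts.\<close>

lemma Least_triangle: "(LEAST k. Suc n - triangle (Suc k) = 0) = fst (prod_decode n) + snd (prod_decode n)"
proof -
  obtain a b where ab: "prod_decode n = (a, b)" by fastforce
  then have n: "n = triangle (a + b) + a"
    using prod_decode_inverse[of n] by (simp add: prod_encode_def)
  have "(LEAST k. Suc n - triangle (Suc k) = 0) = a + b"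
  proof (rule Least_equality)
    show "Suc n - triangle (Suc (a + b)) = 0" by (simp add: n)
    fix k assume "Suc n - triangle (Suc k) = 0"
    then have "n < triangle (Suc k)" by simp
    then have "\<not> Suc k \<le> a + b" using triangle_mono[of "Suc k" "a + b"] n by linarith
    then show "a + b \<le> k" by simp
  qed
  then show ?thesis by (simp add: ab)
qed

lemma computable_decode_sum: "computable (\<lambda>n. fst (prod_decode n) + snd (prod_decode n))"
proof -
  have "computable (\<lambda>n. LEAST k. Suc n - triangle (Suc k) = 0)"
  proof (rule computable_Least)
    show "computable2 (\<lambda>k n. Suc n - triangle (Suc k))"
      by (intro computable2_compose2[OF computable2_diff] computable2_compose1[OF computable_Suc]
          computable2_compose1[OF computable_triangle] computable2_proj)
    show "\<exists>k. Suc n - triangle (Suc k) = 0" for n by (rule exI[of _ n]) (induction n; simp)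
  qed
  then show ?thesis unfolding Least_triangle .
qed

lemma computable_fst_decode: "computable (\<lambda>n. fst (prod_decode n))"
proof -
  have "n - triangle (fst (prod_decode n) + snd (prod_decode n)) = fst (prod_decode n)" for n
    using prod_decode_inverse[of n] by (cases "prod_decode n") (simp add: prod_encode_def)
  then show ?thesis
    using computable_compose2[OF computable2_diff computable_id
      computable_compose[OF computable_triangle computable_decode_sum]] by simp
qed

lemma computable_snd_decode: "computable (\<lambda>n. snd (prod_decode n))"
  using computable_compose2[OF computable2_diff computable_decode_sum computable_fst_decode] by simp

text \<open>Packing parameter, counter and previous value into one number keeps all functions unary,
  as is convenient for functions on codes.\<close>

lemma computable_rec:
  assumes "computable n" "computable f" "computable g"
  shows "computable (\<lambda>x. rec_nat (f x) (\<lambda>m y. g (prod_encode (x, prod_encode (m, y)))) (n x))"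
proof -
  have "computable3 (\<lambda>m y x. g (prod_encode (x, prod_encode (m, y))))"
    by (intro computable3_compose1[OF assms(3)] computable3_compose2[OF computable2_prod_encode]
        computable3_proj)
  from computable_compose2[OF computable2_rec[OF assms(2) this] assms(1) computable_id]
  show ?thesis .
qed

text \<open>A case distinction is a recursion whose step ignores both the counter and the previous
  value.\<close>

lemma computable_if0:
  assumes "computable c" "computable f" "computable g"
  shows "computable (\<lambda>x. if c x = 0 then f x else g x)"
proof -
  have "(\<lambda>x. rec_nat (f x) (\<lambda>m y. g (fst (prod_decode (prod_encode (x, prod_encode (m, y)))))) (c x))
      = (\<lambda>x. if c x = 0 then f x else g x)"
    by (intro ext, case_tac "c x") auto
  with computable_rec[OF assms(1,2) computable_compose[OF assms(3) computable_fst_decode]]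
  show ?thesis by (rule subst[rotated])
qed

lemma computable_Least':
  assumes "computable h" "\<And>x. \<exists>n. h (prod_encode (x, n)) = 0"
  shows "computable (\<lambda>x. LEAST n. h (prod_encode (x, n)) = 0)"
  using assms
  by (intro computable_Least computable2_compose1[OF assms(1)] 
      computable2_compose2[OF computable2_prod_encode] computable2_proj) auto

section \<open>Computable functions on encoded data types\<close>

text \<open>Injectivity makes equality of data decidable on codes. The instances follow the codings
  that \<open>decode_machine\<close> inverts, so that \<open>enc\<close> of a machine is a number
  that decodes to it.\<close>

class enc =
  fixes enc :: "'a \<Rightarrow> nat"
  assumes enc_eq_iff: "enc x = enc y \<longleftrightarrow> x = y"

instantiation nat :: enc
begin
definition enc_nat :: "nat \<Rightarrow> nat" where [simp]: "enc_nat n = n"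
instance by standard simp
end

instantiation bool :: enc
begin
definition enc_bool :: "bool \<Rightarrow> nat" where [simp]: "enc_bool b = (if b then 1 else 0)"
instance by standard simp
end

instantiation prod :: (enc, enc) enc
begin
definition enc_prod :: "'a \<times> 'b \<Rightarrow> nat" where
  "enc_prod p = prod_encode (enc (fst p), enc (snd p))"
instance by standard (simp add: enc_prod_def enc_eq_iff prod_eq_iff)
end

instantiation list :: (enc) enc
begin
definition enc_list :: "'a list \<Rightarrow> nat" where "enc_list xs = list_encode (map enc xs)"
instance
  by standard (simp add: enc_list_def list_encode_eq inj_map_eq_map inj_def enc_eq_iff)
end

instantiation option :: (enc) enc
begin
definition enc_option :: "'a option \<Rightarrow> nat" where
  "enc_option z = (case z of None \<Rightarrow> 0 | Some x \<Rightarrow> Suc (enc x))"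
instance by standard (simp add: enc_option_def enc_eq_iff split: option.splits)
end

instantiation move :: enc
begin
definition enc_move :: "move \<Rightarrow> nat" where
  "enc_move d = (case d of MoveLeft \<Rightarrow> 0 | MoveRight \<Rightarrow> 1 | Stay \<Rightarrow> 2)"
instance by standard (simp add: enc_move_def split: move.splits)
end

lemma enc_simps:
  "enc (x, y) = prod_encode (enc x, enc y)"
  "enc None = 0" "enc (Some x) = Suc (enc x)"
  "enc [] = 0" "enc (x # xs) = Suc (prod_encode (enc x, enc xs))"
  by (simp_all add: enc_prod_def enc_option_def enc_list_def)

text \<open>\<open>F\<close> is prescribed on codes only and may do anything total
  elsewhere.\<close>

definition cmp :: "('a::enc \<Rightarrow> 'b::enc) \<Rightarrow> bool" where
  "cmp f \<longleftrightarrow> (\<exists>F. computable F \<and> (\<forall>x. F (enc x) = enc (f x)))"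

named_theorems cmp_intros

lemma cmpI: "computable F \<Longrightarrow> (\<And>x. F (enc x) = enc (f x)) \<Longrightarrow> cmp f"
  unfolding cmp_def by blast

lemma cmpE:
  assumes "cmp f" obtains F where "computable F" "\<And>x. F (enc x) = enc (f x)"
  using assms unfolding cmp_def by blast

lemma cmp_op1:
  assumes "computable h" "\<And>a. h (enc a) = enc (op a)" "cmp f"
  shows "cmp (\<lambda>x. op (f x))"
proof -
  obtain F where F: "computable F" "\<And>x. F (enc x) = enc (f x)"
    using assms(3) unfolding cmp_def by blast
  show ?thesis
    by (rule cmpI[OF computable_compose[OF assms(1) F(1)]]) (simp add: F assms(2))
qed

lemma cmp_op2:
  assumes "computable2 h" "\<And>a b. h (enc a) (enc b) = enc (op a b)" "cmp f" "cmp g"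
  shows "cmp (\<lambda>x. op (f x) (g x))"
proof -
  obtain F where F: "computable F" "\<And>x. F (enc x) = enc (f x)" using assms(3) unfolding cmp_def by blast
  obtain G where G: "computable G" "\<And>x. G (enc x) = enc (g x)" using assms(4) unfolding cmp_def by blast
  show ?thesis
    by (rule cmpI[OF computable_compose2[OF assms(1) F(1) G(1)]]) (simp add: F G assms(2))
qed

lemma cmp_compose: "cmp f \<Longrightarrow> cmp g \<Longrightarrow> cmp (\<lambda>x. f (g x))"
  by (metis cmp_op1 cmpE)

lemma computable_enc: "cmp (h :: nat \<Rightarrow> 'a::enc) \<Longrightarrow> computable (\<lambda>x. enc (h x))"
  by (elim cmpE) (simp add: computable_iff)

lemma cmp_const [cmp_intros]: "cmp (\<lambda>_. c)"
  by (rule cmpI[OF computable_const]) simp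

lemma cmp_id [cmp_intros]: "cmp (\<lambda>x. x)"
  by (rule cmpI[OF computable_id]) simp

lemma cmp_enc [cmp_intros]: "cmp f \<Longrightarrow> cmp (\<lambda>x. enc (f x))"
  by (rule cmp_op1[OF computable_id]) simp

lemma cmp_Pair [cmp_intros]: "cmp f \<Longrightarrow> cmp g \<Longrightarrow> cmp (\<lambda>x. (f x, g x))"
  by (rule cmp_op2[OF computable2_prod_encode]) (simp_all add: enc_simps)

lemma cmp_fst [cmp_intros]: "cmp f \<Longrightarrow> cmp (\<lambda>x. fst (f x))"
  by (rule cmp_op1[OF computable_fst_decode]) (simp_all add: enc_prod_def)

lemma cmp_snd [cmp_intros]: "cmp f \<Longrightarrow> cmp (\<lambda>x. snd (f x))"
  by (rule cmp_op1[OF computable_snd_decode]) (simp_all add: enc_prod_def)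

lemma cmp_add [cmp_intros]: "cmp f \<Longrightarrow> cmp g \<Longrightarrow> cmp (\<lambda>x. f x + g x :: nat)"
  by (rule cmp_op2[OF computable2_add]) simp_all

lemma cmp_mult [cmp_intros]: "cmp f \<Longrightarrow> cmp g \<Longrightarrow> cmp (\<lambda>x. f x * g x :: nat)"
  by (rule cmp_op2[OF computable2_mult]) simp_all

lemma cmp_diff [cmp_intros]: "cmp f \<Longrightarrow> cmp g \<Longrightarrow> cmp (\<lambda>x. f x - g x :: nat)"
  by (rule cmp_op2[OF computable2_diff]) simp_all

lemma cmp_Suc [cmp_intros]: "cmp f \<Longrightarrow> cmp (\<lambda>x. Suc (f x))"
  by (rule cmp_op1[OF computable_Suc]) simp

lemma cmp_if [cmp_intros]:
  assumes "cmp c" "cmp f" "cmp g" shows "cmp (\<lambda>x. if c x then f x else g x)"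
proof -
  obtain C F G where "computable C" "computable F" "computable G" 
    and *: "\<And>x. C (enc x) = enc (c x)" "\<And>x. F (enc x) = enc (f x)" "\<And>x. G (enc x) = enc (g x)"
    using assms by (elim cmpE) blast
  then show ?thesis by (intro cmpI[OF computable_if0[of C G F]]) auto
qed

lemma cmp_not [cmp_intros]: "cmp c \<Longrightarrow> cmp (\<lambda>x. \<not> c x)"
  using cmp_if[OF _ cmp_const cmp_const, of c False True] by (simp add: if_bool_eq_conj)

lemma cmp_conj [cmp_intros]: "cmp c \<Longrightarrow> cmp d \<Longrightarrow> cmp (\<lambda>x. c x \<and> d x)"
  using cmp_if[OF _ _ cmp_const, of c d False] by (simp add: if_bool_eq_conj conj_commute cong: conj_cong)

lemma cmp_disj [cmp_intros]: "cmp c \<Longrightarrow> cmp d \<Longrightarrow> cmp (\<lambda>x. c x \<or> d x)"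
  using cmp_not[OF cmp_conj[OF cmp_not cmp_not], of c d] by simp

lemma cmp_eq [cmp_intros]:
  fixes f g :: "'a::enc \<Rightarrow> 'b::enc"
  shows "cmp f \<Longrightarrow> cmp g \<Longrightarrow> cmp (\<lambda>x. f x = g x)"
proof (rule cmp_op2[where op = "(=)"])
  show "computable2 (\<lambda>m n. 1 - ((m - n) + (n - m)))"
    by (intro computable2_compose2[OF computable2_add] computable2_compose2[OF computable2_diff]
        computable2_compose1[OF computable_const computable2_proj(1)] computable2_proj)
  show "1 - (enc a - enc b + (enc b - enc a)) = enc (a = b)" for a b :: 'b
    using enc_eq_iff[of a b] by auto
qed

lemma cmp_le [cmp_intros]: "cmp f \<Longrightarrow> cmp g \<Longrightarrow> cmp (\<lambda>x. (f x :: nat) \<le> g x)"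
  using cmp_eq[OF cmp_diff cmp_const, of f g 0] by simp

lemma cmp_less [cmp_intros]: "cmp f \<Longrightarrow> cmp g \<Longrightarrow> cmp (\<lambda>x. (f x :: nat) < g x)"
  using cmp_not[OF cmp_le, of g f] by (simp add: not_le)

lemma cmp_Some [cmp_intros]: "cmp f \<Longrightarrow> cmp (\<lambda>x. Some (f x))"
  by (elim cmpE, rule cmpI, rule computable_compose[OF computable_Suc]) (auto simp: enc_simps)

lemma cmp_case_option [cmp_intros]:
  assumes "cmp z" "cmp f" "cmp (\<lambda>p. g (fst p) (snd p))"
  shows "cmp (\<lambda>x. case z x of None \<Rightarrow> f x | Some y \<Rightarrow> g x y)"
proof -
  obtain Z F G where c: "computable Z" "computable F" "computable G" 
    and *: "\<And>x. Z (enc x) = enc (z x)" "\<And>x. F (enc x) = enc (f x)" 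
      "\<And>p. G (enc p) = enc (g (fst p) (snd p))"
    using assms by (elim cmpE) blast
  show ?thesis
  proof (rule cmpI)
    show "computable (\<lambda>n. if Z n = 0 then F n else G (prod_encode (n, Z n - 1)))"
      by (intro computable_if0 c computable_compose[OF c(3)] computable_compose[OF computable_pred]
          computable_compose2[OF computable2_prod_encode] computable_id)
    show "(if Z (enc x) = 0 then F (enc x) else G (prod_encode (enc x, Z (enc x) - 1)))
        = enc (case z x of None \<Rightarrow> f x | Some y \<Rightarrow> g x y)" for x
      using *(3)[of "(x, the (z x))"] by (auto simp: *(1,2) enc_simps split: option.split)
  qed
qed

lemma cmp_Cons [cmp_intros]: "cmp f \<Longrightarrow> cmp g \<Longrightarrow> cmp (\<lambda>x. f x # g x)"
  by (rule cmp_op2[OF computable2_compose1[OF computable_Suc computable2_prod_encode]])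
     (simp_all add: enc_simps)

lemma cmp_case_list [cmp_intros]:
  assumes "cmp z" "cmp f" "cmp (\<lambda>p. g (fst p) (fst (snd p)) (snd (snd p)))"
  shows "cmp (\<lambda>x. case z x of [] \<Rightarrow> f x | y # ys \<Rightarrow> g x y ys)"
proof -
  define uncons :: "'b list \<Rightarrow> ('b \<times> 'b list) option"
    where "uncons = (\<lambda>xs. case xs of [] \<Rightarrow> None | x # xs \<Rightarrow> Some (x, xs))"
  \<comment> \<open>\<open>x # xs\<close> has the same code as \<open>Some (x, xs)\<close>, and
    \<open>[]\<close> the same as \<open>None\<close>, so \<open>uncons\<close> is the identity on
    codes.\<close>
  have "cmp uncons"
    by (rule cmpI[OF computable_id]) (auto simp: uncons_def enc_simps split: list.split)
  then have "cmp (\<lambda>x. case uncons (z x) of None \<Rightarrow> f x | Some y \<Rightarrow> g x (fst y) (snd y))"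
    by (intro cmp_intros assms cmp_compose[of uncons z])
  also have "(\<lambda>x. case uncons (z x) of None \<Rightarrow> f x | Some y \<Rightarrow> g x (fst y) (snd y))
    = (\<lambda>x. case z x of [] \<Rightarrow> f x | y # ys \<Rightarrow> g x y ys)"
    by (auto simp: uncons_def fun_eq_iff split: list.split)
  finally show ?thesis .
qed

lemma cmp_rec_nat [cmp_intros]:
  assumes "cmp n" "cmp f" "cmp (\<lambda>p. g (fst p) (fst (snd p)) (snd (snd p)))"
  shows "cmp (\<lambda>x. rec_nat (f x) (g x) (n x))"
proof -
  obtain N F G where c: "computable N" "computable F" "computable G" 
    and *: "\<And>x. N (enc x) = enc (n x)" "\<And>x. F (enc x) = enc (f x)" 
      "\<And>p. G (enc p) = enc (g (fst p) (fst (snd p)) (snd (snd p)))"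
    using assms by (elim cmpE) blast
  have "rec_nat (F (enc x)) (\<lambda>m y. G (prod_encode (enc x, prod_encode (m, y)))) k
      = enc (rec_nat (f x) (g x) k)" for x k
  proof (induction k)
    case (Suc k)
    then show ?case using *(3)[of "(x, k, rec_nat (f x) (g x) k)"] by (simp add: enc_simps)
  qed (simp add: *)
  then show ?thesis by (intro cmpI[OF computable_rec[OF c]]) (simp add: *(1))
qed

lemma cmp_funpow [cmp_intros]:
  fixes g :: "'a::enc \<Rightarrow> 'b::enc \<Rightarrow> 'b"
  assumes "cmp n" "cmp f" "cmp (\<lambda>p. g (fst p) (snd p))"
  shows "cmp (\<lambda>x. (g x ^^ n x) (f x))"
proof -
  have "(g x ^^ k) (f x) = rec_nat (f x) (\<lambda>_. g x) k" for x k by (induction k) auto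
  moreover have "cmp (\<lambda>x. rec_nat (f x) (\<lambda>_. g x) (n x))"
    by (intro cmp_rec_nat assms cmp_compose[OF assms(3), of "\<lambda>p. (fst p, snd (snd p))", simplified] cmp_intros)
  ultimately show ?thesis by simp
qed

text \<open>The fold becomes an iteration on pairs of accumulator and remaining list. The code of a
  list bounds its length and serves as the number of iterations; surplus ones idle on the empty
  list. Most list functions below are written as folds.\<close>

lemma cmp_foldl [cmp_intros]:
  fixes g :: "'a::enc \<Rightarrow> 'b::enc \<Rightarrow> 'c::enc \<Rightarrow> 'b"
  assumes "cmp l" "cmp f" "cmp (\<lambda>p. g (fst p) (fst (snd p)) (snd (snd p)))"
  shows "cmp (\<lambda>x. foldl (g x) (f x) (l x))"
proof -
  define h where "h x s = (case snd s of [] \<Rightarrow> s | y # ys \<Rightarrow> (g x (fst s) y, ys))" for x and s :: "'b \<times> 'c list"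
  have h0: "(h x ^^ k) (b, []) = (b, [])" for x k b by (induction k) (auto simp: h_def)
  have hl: "length xs \<le> k \<Longrightarrow> (h x ^^ k) (b, xs) = (foldl (g x) b xs, [])" for x k b xs
  proof (induction k arbitrary: b xs)
    case (Suc k)
    then show ?case by (cases xs) (auto simp: funpow_Suc_right h_def h0 simp del: funpow.simps)
  qed (auto simp: h_def)
  have len: "length xs \<le> enc xs" for xs :: "'c list"
  proof (induction xs)
    case (Cons x xs)
    then show ?case using le_prod_encode_2[of "enc xs" "enc x"] by (simp add: enc_simps)
  qed simp
  have "cmp (\<lambda>p. g (fst (fst p)) (fst (snd (fst p))) (fst (snd p)))"
    using cmp_compose[OF assms(3), of "\<lambda>p. (fst (fst p), fst (snd (fst p)), fst (snd p))"]
    by (simp add: cmp_intros)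
  then have "cmp (\<lambda>x. fst ((h x ^^ enc (l x)) (f x, l x)))"
    unfolding h_def by (intro cmp_intros assms)
  then show ?thesis by (simp add: hl[OF len])
qed

lemma cmp_rev [cmp_intros]: "cmp l \<Longrightarrow> cmp (\<lambda>x. rev (l x))"
proof -
  assume l: "cmp l"
  have "foldl (\<lambda>a b. b # a) ys xs = rev xs @ ys" for xs ys :: "'b list" 
    by (induction xs arbitrary: ys) auto
  moreover have "cmp (\<lambda>x. foldl (\<lambda>a b. b # a) [] (l x))" by (intro cmp_intros l)
  ultimately show ?thesis by simp
qed

lemma cmp_map [cmp_intros]:
  assumes "cmp l" "cmp (\<lambda>p. g (fst p) (snd p))"
  shows "cmp (\<lambda>x. map (g x) (l x))"
proof -
  have "foldl (\<lambda>a b. h b # a) ys xs = rev (map h xs) @ ys" for xs ys and h :: "'b \<Rightarrow> 'c"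
    by (induction xs arbitrary: ys) auto
  moreover have "cmp (\<lambda>x. rev (foldl (\<lambda>a b. g x b # a) [] (l x)))" 
    by (intro cmp_intros assms cmp_compose[OF assms(2), of "\<lambda>p. (fst p, snd (snd p))", simplified])
  ultimately show ?thesis by simp
qed

lemma cmp_append [cmp_intros]: "cmp k \<Longrightarrow> cmp l \<Longrightarrow> cmp (\<lambda>x. k x @ l x)"
proof -
  assume kl: "cmp k" "cmp l"
  have "foldl (\<lambda>a b. b # a) ys (rev xs) = xs @ ys" for xs ys :: "'b list" 
    by (induction xs arbitrary: ys rule: rev_induct) auto
  moreover have "cmp (\<lambda>x. foldl (\<lambda>a b. b # a) (l x) (rev (k x)))" by (intro cmp_intros kl)
  ultimately show ?thesis by simp
qed

lemma cmp_concat [cmp_intros]: "cmp l \<Longrightarrow> cmp (\<lambda>x. concat (l x))"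
proof -
  assume l: "cmp l"
  have "foldl (@) ys xs = ys @ concat xs" for xs and ys :: "'b list" 
    by (induction xs arbitrary: ys) auto
  moreover have "cmp (\<lambda>x. foldl (@) [] (l x))" by (intro cmp_intros l)
  ultimately show ?thesis by simp
qed

lemma cmp_upt [cmp_intros]: "cmp n \<Longrightarrow> cmp (\<lambda>x. [0..<n x])"
proof -
  assume n: "cmp n"
  have "rec_nat [] (\<lambda>k xs. xs @ [k]) m = [0..<m]" for m by (induction m) auto
  moreover have "cmp (\<lambda>x. rec_nat [] (\<lambda>k xs. xs @ [k]) (n x))" by (intro cmp_intros n)
  ultimately show ?thesis by simp
qed

lemma cmp_list_all [cmp_intros]:
  assumes "cmp l" "cmp (\<lambda>p. P (fst p) (snd p))"
  shows "cmp (\<lambda>x. list_all (P x) (l x))"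
proof -
  have "foldl (\<lambda>a b. a \<and> h b) c xs = (c \<and> list_all h xs)" for c xs and h :: "'b \<Rightarrow> bool"
    by (induction xs arbitrary: c) auto
  moreover have "cmp (\<lambda>x. foldl (\<lambda>a b. a \<and> P x b) True (l x))" 
    by (intro cmp_intros assms cmp_compose[OF assms(2), of "\<lambda>p. (fst p, snd (snd p))", simplified])
  ultimately show ?thesis by simp
qed

lemma cmp_find [cmp_intros]:
  assumes "cmp l" "cmp (\<lambda>p. P (fst p) (snd p))"
  shows "cmp (\<lambda>x. find (P x) (l x))"
proof -
  have "foldl (\<lambda>a b. case a of None \<Rightarrow> if h b then Some b else None | Some y \<Rightarrow> Some y) c xs
      = (case c of None \<Rightarrow> find h xs | Some y \<Rightarrow> Some y)" for c xs and h :: "'b \<Rightarrow> bool"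
    by (induction xs arbitrary: c) (auto split: option.split)
  moreover have "cmp (\<lambda>x. foldl (\<lambda>a b. case a of None \<Rightarrow> if P x b then Some b else None | Some y \<Rightarrow> Some y) None (l x))" 
    by (intro cmp_intros assms cmp_compose[OF assms(2), of "\<lambda>p. (fst p, snd (snd p))", simplified])
  ultimately show ?thesis by simp
qed

lemma cmp_tl [cmp_intros]: "cmp l \<Longrightarrow> cmp (\<lambda>x. tl (l x))"
proof -
  assume l: "cmp l"
  have "cmp (\<lambda>x. case l x of [] \<Rightarrow> [] | y # ys \<Rightarrow> ys)" by (intro cmp_intros l)
  moreover have "(\<lambda>x. case l x of [] \<Rightarrow> [] | y # ys \<Rightarrow> ys) = (\<lambda>x. tl (l x))"
    by (auto simp: fun_eq_iff split: list.split)
  ultimately show ?thesis by simp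
qed

lemma cmp_length [cmp_intros]: "cmp l \<Longrightarrow> cmp (\<lambda>x. length (l x))"
proof -
  assume l: "cmp l"
  have "foldl (\<lambda>a b. Suc a) n xs = n + length xs" for n and xs :: "'b list"
    by (induction xs arbitrary: n) auto
  moreover have "cmp (\<lambda>x. foldl (\<lambda>a b. Suc a) 0 (l x))" by (intro cmp_intros l)
  ultimately show ?thesis by simp
qed

lemma cmp_takeWhile [cmp_intros]:
  assumes "cmp l" "cmp (\<lambda>p. P (fst p) (snd p))"
  shows "cmp (\<lambda>x. takeWhile (P x) (l x))"
proof -
  have "foldl (\<lambda>a b. if h b then b # a else []) [] (rev xs) = takeWhile h xs" 
    for xs and h :: "'b \<Rightarrow> bool"
    by (induction xs) auto
  moreover have "cmp (\<lambda>x. foldl (\<lambda>a b. if P x b then b # a else []) [] (rev (l x)))"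
    by (intro cmp_intros assms cmp_compose[OF assms(2), of "\<lambda>p. (fst p, snd (snd p))", simplified])
  ultimately show ?thesis by simp
qed

lemma cmp_zip [cmp_intros]:
  fixes k :: "'a::enc \<Rightarrow> 'b::enc list" and l :: "'a \<Rightarrow> 'c::enc list"
  shows "cmp k \<Longrightarrow> cmp l \<Longrightarrow> cmp (\<lambda>x. zip (k x) (l x))"
proof -
  assume kl: "cmp k" "cmp l"
  \<comment> \<open>The second list travels in the state and loses one element per step; once it is
    empty the state stays as it is.\<close>
  define h where "h s x = (case fst s of [] \<Rightarrow> s | y # ys \<Rightarrow> (ys, (x, y) # snd s))"
    for s :: "'c list \<times> ('b \<times> 'c) list" and x
  have 0: "foldl h ([], zs) xs = ([], zs)" for zs xs by (induction xs) (auto simp: h_def)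
  have "rev (snd (foldl h (ys, zs) xs)) = rev zs @ zip xs ys" for ys zs xs
    by (induction xs arbitrary: ys zs) (auto split: list.split simp: h_def 0)
  from this[of _ "[]"] have "zip xs ys = rev (snd (foldl h (ys, []) xs))" for ys xs by simp
  moreover have "cmp (\<lambda>x. rev (snd (foldl h (l x, []) (k x))))"
    unfolding h_def by (intro cmp_intros kl)
  ultimately show ?thesis by simp
qed

lemma cmp_prod_decode [cmp_intros]: "cmp f \<Longrightarrow> cmp (\<lambda>x. prod_decode (f x))"
  by (elim cmpE, rule cmpI) (auto simp: enc_prod_def)

lemma cmp_list_decode [cmp_intros]: "cmp f \<Longrightarrow> cmp (\<lambda>x. list_decode (f x))"
  by (elim cmpE, rule cmpI) (auto simp: enc_list_def map_idI)

text \<open>Stated for natural numbers because they are their own codes: the search then succeeds on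
  every number it can be started with, whereas a number that codes nothing could make it
  diverge.\<close>

lemma cmp_Least [cmp_intros]:
  fixes P :: "nat \<Rightarrow> nat \<Rightarrow> bool"
  assumes "cmp (\<lambda>p. P (fst p) (snd p))" "\<And>x. \<exists>n. P x n"
  shows "cmp (\<lambda>x. LEAST n. P x n)"
proof -
  have "cmp (\<lambda>p. \<not> P (fst p) (snd p))" by (intro cmp_intros assms)
  then obtain F where F: "computable F" "\<And>p. F (enc p) = enc (\<not> P (fst p) (snd p))"
    unfolding cmp_def by blast
  have eq: "F (prod_encode (x, n)) = 0 \<longleftrightarrow> P x n" for x n
    using F(2)[of "(x, n)"] by (simp add: enc_simps)
  have "computable (\<lambda>x. LEAST n. F (prod_encode (x, n)) = 0)"
    by (rule computable_Least'[OF F(1)]) (simp add: eq assms)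
  then show ?thesis by (intro cmpI) (auto simp: eq)
qed

text \<open>A search by \<open>Mu\<close> terminates exactly when a witness exists, so the
  projection of a decidable relation is the domain of a recursive function.\<close>

lemma rec_enum_cmp:
  assumes "cmp (P :: (nat \<times> nat) \<times> nat \<Rightarrow> bool)"
  shows "rec_enum {(x, y). \<exists>n. P ((x, y), n)}"
proof -
  obtain F where F: "computable F" "\<And>p. F (enc p) = enc (\<not> P p)" 
    using cmp_not[OF assms] unfolding cmp_def by blast
  have "computable3 (\<lambda>n x y. F (prod_encode (prod_encode (x, y), n)))"
    by (intro computable3_compose1[OF F(1)] computable3_compose2[OF computable2_prod_encode] computable3_proj)
  then obtain f where f: "\<And>n x y. eval f [n, x, y] (F (prod_encode (prod_encode (x, y), n)))"
    unfolding computable3_def by blast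
  have F': "F (prod_encode (prod_encode (x, y), n)) = (if P ((x, y), n) then 0 else 1)" for x y n
    using F(2)[of "((x, y), n)"] by (simp add: enc_simps)
  have "(\<exists>n. P ((x, y), n)) \<longleftrightarrow> (\<exists>z. eval (Mu f) [x, y] z)" for x y
  proof
    assume "\<exists>n. P ((x, y), n)"
    then have "P ((x, y), LEAST n. P ((x, y), n))" by (rule LeastI_ex)
    then have "eval (Mu f) [x, y] (LEAST n. P ((x, y), n))"
      using f[of _ x y] not_less_Least[of _ "\<lambda>n. P ((x, y), n)"]
      by (intro eval.intros(7)) (metis F', metis F' One_nat_def)
    then show "\<exists>z. eval (Mu f) [x, y] z" by blast
  next
    assume "\<exists>z. eval (Mu f) [x, y] z"
    then obtain n where "eval f [n, x, y] 0" by (auto elim: eval.cases)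
    then have "F (prod_encode (prod_encode (x, y), n)) = 0" using f eval_det by blast
    then show "\<exists>n. P ((x, y), n)" unfolding F' by (metis zero_neq_one)
  qed
  then show ?thesis unfolding rec_enum_def by auto
qed

section \<open>Recursively enumerable relations are limits of decidable stages\<close>

text \<open>The bound \<open>t\<close> only limits the searches of \<open>Mu\<close>; all other recursion terminates anyway.\<close>

fun bounded_eval :: "recf \<Rightarrow> nat \<Rightarrow> nat list \<Rightarrow> nat option" where
  "bounded_eval Zero t xs = Some 0"
| "bounded_eval Succ t xs =
     (case xs of [] \<Rightarrow> None | x # ys \<Rightarrow> if ys = [] then Some (Suc x) else None)"
| "bounded_eval (Proj i) t xs = (case (tl ^^ i) xs of [] \<Rightarrow> None | y # ys \<Rightarrow> Some y)"
| "bounded_eval (Comp f gs) t xs =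
     (case those (map (\<lambda>g. bounded_eval g t xs) gs) of None \<Rightarrow> None | Some ys \<Rightarrow> bounded_eval f t ys)"
| "bounded_eval (PrimRec f g) t xs =
     (case xs of [] \<Rightarrow> None | n # ys \<Rightarrow>
        rec_nat (bounded_eval f t ys)
          (\<lambda>m z. case z of None \<Rightarrow> None | Some y \<Rightarrow> bounded_eval g t (m # y # ys)) n)"
| "bounded_eval (Mu f) t xs =
     (case find (\<lambda>n. bounded_eval f t (n # xs) = None \<or> bounded_eval f t (n # xs) = Some 0) [0..<t] of
        None \<Rightarrow> None
      | Some n \<Rightarrow> if bounded_eval f t (n # xs) = Some 0 then Some n else None)"

lemma funpow_tl: "(tl ^^ i) xs = drop i xs"
  by (induction i arbitrary: xs) (auto simp: drop_Suc tl_drop)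

lemma those_map_eq_Some: "those (map h gs) = Some ys \<longleftrightarrow> list_all2 (\<lambda>g y. h g = Some y) gs ys"
  by (induction gs arbitrary: ys) (auto split: option.splits simp: list_all2_Cons1)

lemma find_upt_eq_Some:
  "find P [0..<t] = Some n \<longleftrightarrow> n < t \<and> P n \<and> (\<forall>m<n. \<not> P m)"
  by (auto simp: find_Some_iff)

lemma bounded_eval_sound: "bounded_eval f t xs = Some y \<Longrightarrow> eval f xs y"
proof (induction f arbitrary: xs y)
  case (Proj i)
  then show ?case
    by (auto simp: funpow_tl split: list.splits)
       (metis drop_eq_Nil2 eval_Proj hd_drop_conv_nth linorder_not_le list.distinct(1) list.sel(1))
next
  case (Comp f gs)
  then obtain ys where ys: "list_all2 (\<lambda>g y. bounded_eval g t xs = Some y) gs ys" "bounded_eval f t ys = Some y"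
    by (auto simp: those_map_eq_Some split: option.splits)
  have "list_all2 (\<lambda>g y. eval g xs y) gs ys"
    using ys(1) Comp.IH(2) by (auto simp: list_all2_conv_all_nth)
  then show ?case using Comp.IH(1)[OF ys(2)] by (rule eval.intros)
next
  case (PrimRec f g)
  then obtain n ys where xs: "xs = n # ys" by (cases xs) auto
  have "rec_nat (bounded_eval f t ys)
      (\<lambda>m z. case z of None \<Rightarrow> None | Some y \<Rightarrow> bounded_eval g t (m # y # ys)) n = Some z
    \<Longrightarrow> eval (PrimRec f g) (n # ys) z" for z
    by (induction n arbitrary: z) (auto intro: eval.intros PrimRec.IH split: option.splits)
  then show ?case using PrimRec.prems by (simp add: xs)
next
  case (Mu f)
  then have y: "bounded_eval f t (y # xs) = Some 0"
    "\<forall>m<y. bounded_eval f t (m # xs) \<noteq> None \<and> bounded_eval f t (m # xs) \<noteq> Some 0"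
    by (auto simp: find_upt_eq_Some split: option.splits if_splits)
  show ?case
  proof (rule eval.intros(7))
    show "eval f (y # xs) 0" using y(1) by (rule Mu.IH)
    show "\<forall>m<y. \<exists>z. eval f (m # xs) (Suc z)"
      using y(2) Mu.IH by (metis not0_implies_Suc option.exhaust)
  qed
qed (auto intro: eval.intros split: list.splits if_splits)

text \<open>Formulated with \<open>eventually\<close>, so that the bounds required by finitely many
  subcomputations can be intersected.\<close>

lemma bounded_eval_complete: "eval f xs y \<Longrightarrow> \<forall>\<^sub>F t in sequentially. bounded_eval f t xs = Some y"
proof (induction rule: eval.induct)
  case (3 i xs)
  then show ?case by (simp add: funpow_tl Cons_nth_drop_Suc[symmetric])
next
  case (4 xs gs ys f z)
  have "\<forall>\<^sub>F t in sequentially. list_all2 (\<lambda>g y. bounded_eval g t xs = Some y) gs ys"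
    using 4(1)
  proof (induction rule: list_all2_induct)
    case (Cons g gs y ys)
    then show ?case by (auto elim: eventually_elim2)
  qed simp
  from this 4(2) show ?case
    by (rule eventually_elim2) (simp flip: those_map_eq_Some)
next
  case (6 f g n xs y z)
  from "6.IH" show ?case by eventually_elim simp
next
  case (7 f n xs)
  have "\<forall>\<^sub>F t in sequentially. \<forall>m\<in>{..<n}. \<exists>y. bounded_eval f t (m # xs) = Some (Suc y)"
  proof (intro eventually_ball_finite ballI)
    fix m assume "m \<in> {..<n}"
    then obtain y where "\<forall>\<^sub>F t in sequentially. bounded_eval f t (m # xs) = Some (Suc y)"
      using 7 by auto
    then show "\<forall>\<^sub>F t in sequentially. \<exists>y. bounded_eval f t (m # xs) = Some (Suc y)"
      by (rule eventually_mono) blast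
  qed simp
  then show ?case using 7(2) eventually_gt_at_top[of n]
  proof eventually_elim
    case (elim t)
    then have "find (\<lambda>n. bounded_eval f t (n # xs) = None \<or> bounded_eval f t (n # xs) = Some 0) [0..<t] = Some n"
      by (subst find_upt_eq_Some) force
    then show ?case using elim by simp
  qed
qed (auto elim: eventually_mono)

text \<open>The term \<open>f\<close> is fixed and the induction over it takes place in the logic;
  codes of terms and a universal function do not occur.\<close>

lemma cmp_bounded_eval: "cmp (\<lambda>p. bounded_eval f (fst p) (snd p))"
proof (induction f)
  case (Comp f gs)
  have "cmp (\<lambda>p. those (map (\<lambda>g. bounded_eval g (fst p) (snd p)) gs))"
    using Comp.IH(2)
  proof (induction gs)
    case (Cons g gs)
    have "cmp (\<lambda>p. case bounded_eval g (fst p) (snd p) of None \<Rightarrow> None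
        | Some y \<Rightarrow> (case those (map (\<lambda>g. bounded_eval g (fst p) (snd p)) gs) of None \<Rightarrow> None | Some ys \<Rightarrow> Some (y # ys)))"
      by (intro cmp_intros Cons cmp_compose[OF Cons.IH, of fst, simplified]) (use Cons in auto)
    moreover have "those (map (\<lambda>g. bounded_eval g (fst p) (snd p)) (g # gs)) = (case bounded_eval g (fst p) (snd p) of None \<Rightarrow> None
        | Some y \<Rightarrow> (case those (map (\<lambda>g. bounded_eval g (fst p) (snd p)) gs) of None \<Rightarrow> None | Some ys \<Rightarrow> Some (y # ys)))" for p
      by (simp split: option.split)
    ultimately show ?case by presburger
  qed (simp add: cmp_const)
  then show ?case unfolding bounded_eval.simps
    by (intro cmp_intros cmp_compose[OF Comp.IH(1), of "\<lambda>p. (fst (fst p), snd p)", simplified])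
next
  case (PrimRec f g)
  show ?case unfolding bounded_eval.simps
    by (intro cmp_intros 
        cmp_compose[OF PrimRec.IH(1), of "\<lambda>p. (fst (fst p), snd (snd p))", simplified]
        cmp_compose[OF PrimRec.IH(2), of "\<lambda>p. (fst (fst (fst (fst p))), fst (snd (fst p)) # snd p # snd (snd (fst (fst p))))", simplified])
next
  case (Mu f)
  have "cmp (\<lambda>p. bounded_eval f (fst (fst p)) (snd p # snd (fst p)))"
    by (intro cmp_intros cmp_compose[OF Mu.IH, of "\<lambda>p. (fst (fst p), snd p # snd (fst p))", simplified])
  then show ?case unfolding bounded_eval.simps by (intro cmp_intros)
qed (simp only: bounded_eval.simps; intro cmp_intros)+

lemma rec_enum_stages:
  assumes "rec_enum R"
  obtains S :: "nat \<Rightarrow> nat \<Rightarrow> nat \<Rightarrow> bool" where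
    "cmp (\<lambda>p. S (fst p) (fst (snd p)) (snd (snd p)))"
    "\<And>x y. (x, y) \<in> R \<longleftrightarrow> (\<exists>t. S t x y)" "\<And>t u x y. S t x y \<Longrightarrow> t \<le> u \<Longrightarrow> S u x y"
proof -
  obtain f where f: "\<And>x y. (x, y) \<in> R \<longleftrightarrow> (\<exists>z. eval f [x, y] z)"
    using assms unfolding rec_enum_def by blast
  \<comment> \<open>Ranging over all \<open>s < t\<close> makes the stages increasing by
    construction.\<close>
  define S where "S t x y \<longleftrightarrow> \<not> list_all (\<lambda>s. bounded_eval f s [x, y] = None) [0..<t]" for t x y
  show thesis
  proof (rule that[of S])
    have "cmp (\<lambda>p. bounded_eval f (snd p) [fst (snd (fst p)), snd (snd (fst p))])"
      using cmp_compose[OF cmp_bounded_eval, of "\<lambda>p. (snd p, [fst (snd (fst p)), snd (snd (fst p))])" f]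
      by (simp add: cmp_intros)
    then show "cmp (\<lambda>p. S (fst p) (fst (snd p)) (snd (snd p)))"
      unfolding S_def by (intro cmp_intros)
    show "(x, y) \<in> R \<longleftrightarrow> (\<exists>t. S t x y)" for x y
    proof
      assume "(x, y) \<in> R"
      then obtain z where "eval f [x, y] z" using f by blast
      then obtain t where "bounded_eval f t [x, y] = Some z"
        using bounded_eval_complete eventually_happens'[OF sequentially_bot] by blast
      then have "S (Suc t) x y" by (simp add: S_def)
      then show "\<exists>t. S t x y" by blast
    next
      assume "\<exists>t. S t x y"
      then obtain t z where "bounded_eval f t [x, y] = Some z" by (auto simp: S_def list_all_iff)
      then show "(x, y) \<in> R" using bounded_eval_sound f by blast
    qed
    show "S u x y" if "S t x y" "t \<le> u" for t u x y
      using that by (fastforce simp: S_def list_all_iff)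
  qed
qed

section \<open>Equality of clocked functions is co-enumerable\<close>

lemma cmp_power [cmp_intros]:
  fixes f :: "'a::enc \<Rightarrow> nat"
  assumes "cmp f" "cmp n" shows "cmp (\<lambda>x. f x ^ n x :: nat)"
proof -
  have "(\<lambda>x. f x ^ n x) = (\<lambda>x. ((\<lambda>m. f x * m) ^^ n x) 1)"
  proof
    fix x
    have "a ^ k = ((\<lambda>m. a * m) ^^ k) 1" for a k :: nat by (induction k) auto
    then show "f x ^ n x = ((\<lambda>m. f x * m) ^^ n x) 1" .
  qed
  moreover have "cmp (\<lambda>x. ((\<lambda>m. f x * m) ^^ n x) 1)"
    by (intro cmp_intros assms cmp_compose[OF assms(1)])
  ultimately show ?thesis by simp
qed

lemma cmp_decode_move: "cmp decode_move"
  unfolding decode_move_def by (intro cmp_intros)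

lemma cmp_decode_act: "cmp decode_act"
  unfolding decode_act_def Let_def case_prod_beta
  by (intro cmp_intros cmp_compose[OF cmp_decode_move])

lemma cmp_decode_instr: "cmp decode_instr"
  unfolding decode_instr_def Let_def case_prod_beta
  by (intro cmp_intros cmp_compose[OF cmp_decode_act])

lemma cmp_decode_machine [cmp_intros]: "cmp f \<Longrightarrow> cmp (\<lambda>x. decode_machine (f x))"
  unfolding decode_machine_def Let_def case_prod_beta
  by (intro cmp_intros cmp_compose[OF cmp_decode_instr])

lemma cmp_scanned [cmp_intros]: "cmp f \<Longrightarrow> cmp (\<lambda>x. scanned (f x))"
proof -
  assume f: "cmp f"
  have "scanned xs = (case xs of [] \<Rightarrow> 0 | a # as \<Rightarrow> a)" for xs by (cases xs) auto
  moreover have "cmp (\<lambda>x. case f x of [] \<Rightarrow> 0 | a # as \<Rightarrow> a)" by (intro cmp_intros f)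
  ultimately show ?thesis by presburger
qed

text \<open>This and the next equations replace pattern matching by projections, to which the rules
  \<open>cmp_intros\<close> apply.\<close>

lemma read_conv: "read t = scanned (snd t)"
  by (cases t) simp

lemma put_conv: "put a t = (fst t, a # tl (snd t))"
  by (cases t) simp

lemma shift_conv: "shift d t =
  (if d = MoveLeft then (tl (fst t), scanned (fst t) # snd t)
   else if d = MoveRight then (scanned (snd t) # fst t, tl (snd t)) else t)"
  by (cases t; cases d) auto

lemma applicable_conv:
  "applicable c i \<longleftrightarrow> fst i = fst c \<and> map fst (fst (snd i)) = map (\<lambda>t. scanned (snd t)) (snd c)"
  by (cases c; cases i) (auto simp: read_conv[abs_def])

lemma exec_conv:
  "exec i c = (snd (snd i), map (\<lambda>p. shift (snd (snd (fst p))) (put (fst (snd (fst p))) (snd p))) (zip (fst (snd i)) (snd c)))"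
  by (cases c; cases i) (auto simp: map2_map_map case_prod_beta)

lemma cmp_step: "cmp (\<lambda>p. step (fst p) (snd p))"
  unfolding step_def applicable_conv exec_conv shift_conv put_conv
  by (intro cmp_intros)

lemma cmp_result [cmp_intros]:
  assumes "cmp M" "cmp n" "cmp w" shows "cmp (\<lambda>x. result k (run (M x) (n x) (w x)))"
proof -
  have "cmp (\<lambda>p. step (M (fst p)) (snd p))"
    using cmp_compose[OF cmp_step, of "\<lambda>p. (M (fst p), snd p)"] 
    by (simp add: cmp_intros cmp_compose[OF assms(1)])
  \<comment> \<open>\<open>hd []\<close> is an unspecified but fixed tape, so it can enter as a
    constant.\<close>
  moreover have "hd (snd (run M n w)) = (case snd (run M n w) of [] \<Rightarrow> hd [] | t # ts \<Rightarrow> t)" for M n w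
    by (cases "snd (run M n w)") auto
  moreover have "replicate m t = rec_nat [] (\<lambda>_ ts. t # ts) m" for m and t :: tape
    by (induction m) auto
  ultimately show ?thesis
    unfolding result_def run_def start_def atLeastAtMost_iff
    by (simp only:) (intro cmp_intros assms)
qed

text \<open>Off the alphabet both functions are \<open>undefined\<close>, so a difference shows at
  some string over it. Strings are searched through their codes, and the test at each of them is
  decidable.\<close>

lemma clocked_neq_iff:
  "clocked k M T \<noteq> clocked k N U \<longleftrightarrow>
     (\<exists>n. list_all (\<lambda>a. 1 \<le> a \<and> a \<le> k) (list_decode n) \<and>
        result k (run M (T (length (list_decode n))) (list_decode n)) \<noteq>
        result k (run N (U (length (list_decode n))) (list_decode n)))"
proof -
  have "clocked k M T \<noteq> clocked k N U \<longleftrightarrow> (\<exists>w\<in>lists {1..k}.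
      result k (run M (T (length w)) w) \<noteq> result k (run N (U (length w)) w))"
    unfolding clocked_def by (auto simp: fun_eq_iff restrict_def)
  also have "\<dots> \<longleftrightarrow> (\<exists>n. list_decode n \<in> lists {1..k} \<and>
      result k (run M (T (length (list_decode n))) (list_decode n)) \<noteq>
      result k (run N (U (length (list_decode n))) (list_decode n)))"
    by (metis list_encode_inverse)
  finally show ?thesis by (simp add: list_all_iff lists_eq_set subset_iff Ball_def)
qed

lemma Pi01_equiv_clocked:
  assumes "cmp M" "cmp (\<lambda>p. T (fst p) (snd p))"
  shows "Pi01_equiv {(i, j). clocked k (M i) (T i) = clocked k (M j) (T j)}"
proof -
  let ?w = "\<lambda>p. list_decode (snd p)"
  let ?r = "\<lambda>i p. result k (run (M i) (T i (length (?w p))) (?w p))"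
  have T: "cmp (\<lambda>p. T (f p) (g p))" if "cmp f" "cmp g" for f g :: "(nat \<times> nat) \<times> nat \<Rightarrow> nat"
    using cmp_compose[OF assms(2), of "\<lambda>p. (f p, g p)"] that by (simp add: cmp_intros)
  have "cmp (\<lambda>p :: (nat \<times> nat) \<times> nat. list_all (\<lambda>a. 1 \<le> a \<and> a \<le> k) (?w p) \<and>
      ?r (fst (fst p)) p \<noteq> ?r (snd (fst p)) p)"
    by (intro cmp_intros T cmp_compose[OF assms(1)])
  from rec_enum_cmp[OF this]
  have "rec_enum {(i, j). clocked k (M i) (T i) \<noteq> clocked k (M j) (T j)}"
    unfolding clocked_neq_iff by simp
  moreover have "{(i, j). clocked k (M i) (T i) \<noteq> clocked k (M j) (T j)}
      = - {(i, j). clocked k (M i) (T i) = clocked k (M j) (T j)}" by auto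
  moreover have "equiv UNIV {(i, j). clocked k (M i) (T i) = clocked k (M j) (T j)}"
    by (rule equivI) (auto simp: refl_on_def sym_def trans_def)
  ultimately show ?thesis unfolding Pi01_equiv_def by simp
qed

lemma Pi01_equiv_ptime: "Pi01_equiv {(i, j). ptime k i = ptime k j}"
  using Pi01_equiv_clocked[of "\<lambda>i. decode_machine (fst (prod_decode i))"
      "\<lambda>i n. fst (prod_decode (snd (prod_decode i))) * n ^ snd (prod_decode (snd (prod_decode i)))
        + fst (prod_decode (snd (prod_decode i)))" k]
  by (simp add: ptime_def case_prod_beta cmp_intros)

lemma Pi01_equiv_qtime: "Pi01_equiv {(i, j). qtime k i = qtime k j}"
  using Pi01_equiv_clocked[of "\<lambda>i. decode_machine (fst (prod_decode i))"
      "\<lambda>i n. snd (prod_decode i) * n ^ 2 + snd (prod_decode i)" k]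
  by (simp add: qtime_def case_prod_beta cmp_intros)

section \<open>Separating the classes of a co-enumerable equivalence relation\<close>

text \<open>Starting from lists \<open>[a]\<close> and \<open>[b]\<close> with \<open>a\<close> and \<open>b\<close> inequivalent, the numbers are put into one of the two
  lists one after the other. A number cannot be equivalent to members of both lists, so some
  stage \<open>s\<close> shows that it is inequivalent to all members of one of them, and it joins the other.
  The bound \<open>t\<close> makes this search total; the outcome is independent of \<open>t\<close> once there is one.\<close>

definition color_step ::
  "(nat \<Rightarrow> nat \<Rightarrow> nat \<Rightarrow> bool) \<Rightarrow> nat \<Rightarrow> (nat list \<times> nat list) option \<Rightarrow> nat \<Rightarrow> (nat list \<times> nat list) option" where
  "color_step S t z x = (case z of None \<Rightarrow> None | Some p \<Rightarrow>
     (case find (\<lambda>s. list_all (S s x) (fst p) \<or> list_all (S s x) (snd p)) [0..<t] of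
        None \<Rightarrow> None
      | Some s \<Rightarrow> Some (if list_all (S s x) (snd p) then (x # fst p, snd p) else (fst p, x # snd p))))"

definition coloring ::
  "(nat \<Rightarrow> nat \<Rightarrow> nat \<Rightarrow> bool) \<Rightarrow> nat \<Rightarrow> nat \<Rightarrow> nat \<Rightarrow> nat \<Rightarrow> (nat list \<times> nat list) option" where
  "coloring S t a b n = foldl (color_step S t) (Some ([a], [b])) [0..<n]"

lemma coloring_0: "coloring S t a b 0 = Some ([a], [b])"
  by (simp add: coloring_def)

text \<open>Exposes that the stage \<open>s\<close> is the least one that decides, and thus does not
  depend on \<open>t\<close>; the bound only has to exceed it.\<close>

lemma coloring_Suc_eq_Some:
  "coloring S t a b (Suc n) = Some q \<longleftrightarrow>
    (\<exists>p s. coloring S t a b n = Some p \<and> s < t \<and>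
      (list_all (S s n) (fst p) \<or> list_all (S s n) (snd p)) \<and>
      (\<forall>r<s. \<not> list_all (S r n) (fst p) \<and> \<not> list_all (S r n) (snd p)) \<and>
      q = (if list_all (S s n) (snd p) then (n # fst p, snd p) else (fst p, n # snd p)))"
proof -
  have case_eq: "(case z of None \<Rightarrow> None | Some y \<Rightarrow> h y) = Some q \<longleftrightarrow> (\<exists>y. z = Some y \<and> h y = Some q)"
    for z :: "'x option" and h :: "'x \<Rightarrow> (nat list \<times> nat list) option"
    by (cases z) auto
  have "coloring S t a b (Suc n) = color_step S t (coloring S t a b n) n"
    by (simp add: coloring_def)
  then show ?thesis
    unfolding color_step_def by (simp only: case_eq find_upt_eq_Some option.inject de_Morgan_disj conj_assoc ex_simps eq_commute[of _ q])
qed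

lemma coloring_mono:
  "coloring S t a b n = Some p \<Longrightarrow> t \<le> u \<Longrightarrow> coloring S u a b n = Some p"
proof (induction n arbitrary: p)
  case (Suc n)
  from Suc.prems(1) obtain q s where qs: "coloring S t a b n = Some q" "s < t"
    "list_all (S s n) (fst q) \<or> list_all (S s n) (snd q)"
    "\<forall>r<s. \<not> list_all (S r n) (fst q) \<and> \<not> list_all (S r n) (snd q)"
    "p = (if list_all (S s n) (snd q) then (n # fst q, snd q) else (fst q, n # snd q))"
    unfolding coloring_Suc_eq_Some by (elim exE conjE)
  then have "coloring S u a b n = Some q" "s < u" using Suc.IH Suc.prems(2) by simp_all
  with qs(3-5) show ?case unfolding coloring_Suc_eq_Some by (intro exI conjI)
qed (simp add: coloring_0)

lemma coloring_extend:
  "coloring S t a b m = Some p \<Longrightarrow> coloring S t a b n = Some q \<Longrightarrow> m \<le> n \<Longrightarrow>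
    set (fst p) \<subseteq> set (fst q) \<and> set (snd p) \<subseteq> set (snd q)"
proof (induction n arbitrary: q)
  case (Suc n)
  show ?case
  proof (cases "m = Suc n")
    case False
    then have "m \<le> n" using Suc.prems(3) by simp
    moreover obtain q' s where "coloring S t a b n = Some q'"
      "q = (if list_all (S s n) (snd q') then (n # fst q', snd q') else (fst q', n # snd q'))"
      using Suc.prems(2) unfolding coloring_Suc_eq_Some by (elim exE conjE)
    ultimately show ?thesis using Suc.IH[OF Suc.prems(1)] by (auto split: if_splits)
  qed (use Suc in auto)
qed auto

text \<open>A number joins a list only after a stage has shown it inequivalent to all members of the
  other, which preserves the last conjunct. \<open>a\<close> and \<open>b\<close> have their turns
  too and, being equivalent to themselves, are put on their own sides again.\<close>

lemma coloring_invariant: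
  assumes E: "equiv UNIV E" and S: "\<And>x y t. S t x y \<Longrightarrow> (x, y) \<notin> E"
    and ab: "(a, b) \<notin> E" and col: "coloring S t a b n = Some p"
  shows "a \<in> set (fst p) \<and> b \<in> set (snd p) \<and> {..<n} \<subseteq> set (fst p) \<union> set (snd p) \<and>
    (\<forall>u\<in>set (fst p). \<forall>v\<in>set (snd p). (u, v) \<notin> E)"
  using col
proof (induction n arbitrary: p)
  case (Suc n)
  from Suc.prems obtain q s where q: "coloring S t a b n = Some q"
    "list_all (S s n) (fst q) \<or> list_all (S s n) (snd q)"
    "p = (if list_all (S s n) (snd q) then (n # fst q, snd q) else (fst q, n # snd q))"
    unfolding coloring_Suc_eq_Some by (elim exE conjE)
  \<comment> \<open>A stage speaks about pairs \<open>(n, u)\<close>; a newcomer \<open>n\<close> to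
    the second list needs the reversed pair.\<close>
  have "(v, u) \<notin> E" if "S s u v" for u v using S[OF that] E by (meson equiv_def symD)
  with q(2,3) S Suc.IH[OF q(1)] show ?case
    by (auto simp: list_all_iff lessThan_Suc)
qed (use ab in \<open>auto simp: coloring_0\<close>)

lemma list_all_stage:
  assumes "\<And>x y t u. S t x y \<Longrightarrow> t \<le> u \<Longrightarrow> S u x y" "\<forall>y\<in>set ys. \<exists>t. S t x y"
  shows "\<exists>t::nat. list_all (S t x) ys"
  using assms(2)
proof (induction ys)
  case (Cons y ys)
  then obtain t u where "list_all (S t x) ys" "S u x y" by auto
  then have "list_all (S (max t u) x) (y # ys)"
    using assms(1) by (auto simp: list_all_iff intro: max.cobounded1 max.cobounded2)
  then show ?case by blast
qed simp

text \<open>If \<open>n\<close> were equivalent to some \<open>u\<close> in the first list and some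
  \<open>v\<close> in the second, then \<open>u\<close> and \<open>v\<close> would be equivalent,
  against the invariant. So \<open>n\<close> is inequivalent to all of one list, and as stages
  increase, a single one shows this for all its members.\<close>

lemma coloring_exists:
  assumes E: "equiv UNIV E" and S: "\<And>x y. (x, y) \<notin> E \<longleftrightarrow> (\<exists>t. S t x y)"
    and mono: "\<And>x y t u. S t x y \<Longrightarrow> t \<le> u \<Longrightarrow> S u x y"
    and ab: "(a, b) \<notin> E"
  shows "\<exists>t p. coloring S t a b n = Some p"
proof (induction n)
  case (Suc n)
  then obtain t p where p: "coloring S t a b n = Some p" by blast
  have inv: "\<forall>u\<in>set (fst p). \<forall>v\<in>set (snd p). (u, v) \<notin> E"
    using coloring_invariant[OF E _ ab p] S by blast
  have "(\<forall>u\<in>set (fst p). (n, u) \<notin> E) \<or> (\<forall>v\<in>set (snd p). (n, v) \<notin> E)"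
    using inv E by (meson equiv_def symD transD)
  then have "\<exists>s. list_all (S s n) (fst p) \<or> list_all (S s n) (snd p)"
    using list_all_stage[of S "fst p" n] list_all_stage[of S "snd p" n] S mono by metis
  then obtain s where s: "list_all (S s n) (fst p) \<or> list_all (S s n) (snd p)"
    "\<forall>r<s. \<not> list_all (S r n) (fst p) \<and> \<not> list_all (S r n) (snd p)"
    using exists_least_iff[of "\<lambda>s. list_all (S s n) (fst p) \<or> list_all (S s n) (snd p)"] by blast
  \<comment> \<open>\<open>t\<close> preserves the earlier choices, and \<open>Suc s\<close> brings
    the deciding stage \<open>s\<close> into the search range.\<close>
  have "coloring S (max t (Suc s)) a b n = Some p" using p by (rule coloring_mono) simp
  then have "\<exists>q. coloring S (max t (Suc s)) a b (Suc n) = Some q"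
    unfolding coloring_Suc_eq_Some using s by (metis less_Suc_eq max.strict_coboundedI2)
  then show ?case by blast
qed (simp add: coloring_0)

lemma cmp_coloring [cmp_intros]:
  assumes S: "cmp (\<lambda>p. S (fst p) (fst (snd p)) (snd (snd p)))" and "cmp t" "cmp a" "cmp b" "cmp n"
  shows "cmp (\<lambda>x. coloring S (t x) (a x) (b x) (n x))"
proof -
  have S': "cmp (\<lambda>x. S (f x) (g x) (h x))" if "cmp f" "cmp g" "cmp h" for f g h :: "'x::enc \<Rightarrow> nat"
    using cmp_compose[OF S, of "\<lambda>x. (f x, g x, h x)"] that by (simp add: cmp_intros)
  show ?thesis unfolding coloring_def color_step_def
    by (intro cmp_intros assms S' cmp_compose[OF assms(2)])
qed

text \<open>An index \<open>n\<close> codes a pair of numbers together with a stage. If the stage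
  certifies that the two are inequivalent (\<open>ok\<close>), then \<open>c x n\<close> tells
  whether \<open>x\<close> joins the side of the first; otherwise the search might not end, and
  \<open>c x n\<close> is False. Every inequivalent pair is separated at an index that certifies
  it.\<close>

lemma Pi01_equiv_coloring:
  assumes "Pi01_equiv E"
  obtains c :: "nat \<Rightarrow> nat \<Rightarrow> bool" where "cmp (\<lambda>p. c (fst p) (snd p))"
    "\<And>x y. (x, y) \<in> E \<longleftrightarrow> (\<forall>n. c x n = c y n)"
proof -
  have E: "equiv UNIV E" and "rec_enum (- E)" using assms unfolding Pi01_equiv_def by auto
  obtain S :: "nat \<Rightarrow> nat \<Rightarrow> nat \<Rightarrow> bool"
    where S_cmp: "cmp (\<lambda>p. S (fst p) (fst (snd p)) (snd (snd p)))"
      and S_compl: "\<And>x y. (x, y) \<in> - E \<longleftrightarrow> (\<exists>t. S t x y)"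
      and mono: "\<And>t u x y. S t x y \<Longrightarrow> t \<le> u \<Longrightarrow> S u x y"
    using rec_enum_stages[OF \<open>rec_enum (- E)\<close>] by blast
  have S: "(x, y) \<notin> E \<longleftrightarrow> (\<exists>t. S t x y)" for x y
    using S_compl[of x y] by simp
  have S': "cmp (\<lambda>x. S (f x) (g x) (h x))" if "cmp f" "cmp g" "cmp h" for f g h :: "'x::enc \<Rightarrow> nat"
    using cmp_compose[OF S_cmp, of "\<lambda>x. (f x, g x, h x)"] that by (simp add: cmp_intros)
  define A B T where "A n = fst (prod_decode n)" and "B n = fst (prod_decode (snd (prod_decode n)))"
    and "T n = snd (prod_decode (snd (prod_decode n)))" for n
  define ok where "ok n \<longleftrightarrow> S (T n) (A n) (B n)" for n
  have ok: "(A n, B n) \<notin> E" if "ok n" for n using that S unfolding ok_def by blast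
  have col_ex: "\<exists>t p. coloring S t (A n) (B n) m = Some p" if "ok n" for n m
    by (rule coloring_exists[OF E S _ ok[OF that]]) (rule mono)
  have col_inv: "A n \<in> set (fst p) \<and> B n \<in> set (snd p) \<and> {..<m} \<subseteq> set (fst p) \<union> set (snd p) \<and>
      (\<forall>u\<in>set (fst p). \<forall>v\<in>set (snd p). (u, v) \<notin> E)"
    if "ok n" "coloring S t (A n) (B n) m = Some p" for n m t p
    using coloring_invariant[OF E _ ok[OF that(1)] that(2)] S by blast
  have refl: "(x, x) \<in> E" for x using E by (simp add: equiv_def refl_on_def)
  \<comment> \<open>Vacuously true at uncertified indices, so that a least bound exists for every
    \<open>q\<close>.\<close>
  define P where "P q t \<longleftrightarrow> \<not> ok (snd (prod_decode q)) \<or>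
    coloring S t (A (snd (prod_decode q))) (B (snd (prod_decode q))) (Suc (fst (prod_decode q))) \<noteq> None" for q t
  have P_ex: "\<exists>t. P q t" for q
    using col_ex unfolding P_def by blast
  define c where "c x n \<longleftrightarrow> ok n \<and> (case coloring S (LEAST t. P (prod_encode (x, n)) t) (A n) (B n) (Suc x) of
    None \<Rightarrow> False | Some p \<Rightarrow> \<not> list_all (\<lambda>y. y \<noteq> x) (fst p))" for x n
  \<comment> \<open>The bound used in \<open>c\<close> varies with \<open>x\<close>. At the larger
    of two bounds both results belong to one and the same coloring, so \<open>c\<close> can be read
    off any coloring that is long enough.\<close>
  have c_iff: "c x n \<longleftrightarrow> x \<in> set (fst q)" if n: "ok n" and q: "coloring S t (A n) (B n) m = Some q" and "x < m" for x n t m q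
  proof -
    define u where "u = (LEAST t. P (prod_encode (x, n)) t)"
    have "P (prod_encode (x, n)) u" unfolding u_def using P_ex by (rule LeastI_ex)
    then obtain p where p: "coloring S u (A n) (B n) (Suc x) = Some p" using n by (auto simp: P_def)
    have "set (fst p) \<subseteq> set (fst q) \<and> set (snd p) \<subseteq> set (snd q)"
      using coloring_extend[OF coloring_mono[OF p, of "max u t"] coloring_mono[OF q, of "max u t"]] \<open>x < m\<close> by simp
    moreover have "x \<in> set (fst p) \<union> set (snd p)" using col_inv[OF n p] by auto
    moreover have "x \<notin> set (snd q)" if "x \<in> set (fst q)"
      using col_inv[OF n q] that refl by blast
    moreover have "c x n \<longleftrightarrow> x \<in> set (fst p)"
      using n p by (auto simp: c_def u_def list_all_iff)
    ultimately show ?thesis by blast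
  qed
  show thesis
  proof (rule that[of c])
    have "cmp (\<lambda>p. P (fst p) (snd p))"
      unfolding P_def ok_def A_def B_def T_def by (intro cmp_intros S' S_cmp)
    then have "cmp (\<lambda>q. LEAST t. P q t)" using P_ex by (rule cmp_Least)
    moreover have "cmp (\<lambda>p :: nat \<times> nat. prod_encode (fst p, snd p))"
      using cmp_enc[OF cmp_id[where 'a = "nat \<times> nat"]] by (simp add: enc_prod_def)
    ultimately have "cmp (\<lambda>p :: nat \<times> nat. LEAST t. P (prod_encode (fst p, snd p)) t)"
      by (rule cmp_compose)
    then have L: "cmp (\<lambda>p. LEAST t. P (prod_encode (f p, g p)) t)"
      if "cmp f" "cmp g" for f g :: "nat \<times> nat \<Rightarrow> nat"
      using cmp_compose[of _ "\<lambda>p. (f p, g p)"] that by (fastforce intro: cmp_Pair)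
    show "cmp (\<lambda>p. c (fst p) (snd p))"
      unfolding c_def ok_def A_def B_def T_def by (intro cmp_intros L S' S_cmp)
    show "(x, y) \<in> E \<longleftrightarrow> (\<forall>n. c x n = c y n)" for x y
    proof
      assume xy: "(x, y) \<in> E"
      show "\<forall>n. c x n = c y n"
      proof
        fix n
        show "c x n = c y n"
        proof (cases "ok n")
          case True
          obtain t q where q: "coloring S t (A n) (B n) (Suc (max x y)) = Some q"
            using col_ex[OF True] by blast
          have inv: "{..<Suc (max x y)} \<subseteq> set (fst q) \<union> set (snd q)"
            "\<forall>u\<in>set (fst q). \<forall>v\<in>set (snd q). (u, v) \<notin> E"
            using col_inv[OF True q] by blast+
          have yx: "(y, x) \<in> E" using xy E by (meson equiv_def symD)
          have "x \<in> set (fst q) \<or> x \<in> set (snd q)" "y \<in> set (fst q) \<or> y \<in> set (snd q)"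
            using subsetD[OF inv(1), of x] subsetD[OF inv(1), of y] by auto
          then have "x \<in> set (fst q) \<longleftrightarrow> y \<in> set (fst q)" using inv(2) xy yx by blast
          then show ?thesis using c_iff[OF True q] by auto
        qed (simp add: c_def)
      qed
    next
      assume eq: "\<forall>n. c x n = c y n"
      show "(x, y) \<in> E"
      proof (rule ccontr)
        assume xy: "(x, y) \<notin> E"
        then obtain t where t: "S t x y" using S by blast
        define n where "n = prod_encode (x, prod_encode (y, t))"
        have n: "A n = x" "B n = y" "T n = t" by (simp_all add: n_def A_def B_def T_def)
        then have "ok n" using t by (simp add: ok_def)
        obtain t q where q: "coloring S t (A n) (B n) (Suc (max x y)) = Some q"
          using col_ex[OF \<open>ok n\<close>] by blast
        have inv: "x \<in> set (fst q)" "y \<in> set (snd q)" "\<forall>u\<in>set (fst q). \<forall>v\<in>set (snd q). (u, v) \<notin> E"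
          using col_inv[OF \<open>ok n\<close> q] n by auto
        have "y \<notin> set (fst q)" using inv refl by blast
        then show False 
          using c_iff[OF \<open>ok n\<close> q, of x] c_iff[OF \<open>ok n\<close> q, of y] inv(1) eq by (simp add: less_Suc_eq_le)
      qed
    qed
  qed
qed

section \<open>Counter programs\<close>

datatype com = CSkip | CInc nat | CSeq com com | CLoop nat com | CMark | CEvent

text \<open>\<open>CLoop r c\<close> decrements \<open>r\<close> and then executes \<open>c\<close>, as long as \<open>r\<close> is not zero. \<open>CMark\<close>
  announces that the contents of register 1 belong to the number in register 0.\<close>

datatype label = LTau | LMark nat nat | LEvent

text \<open>There is one label for each executed instruction of the flat code: a loop round costs
  one \<open>LTau\<close> for test and decrement and another for the jump back. The length of a
  trace is therefore the running time.\<close>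

inductive big_step :: "com \<Rightarrow> (nat \<Rightarrow> nat) \<Rightarrow> label list \<Rightarrow> (nat \<Rightarrow> nat) \<Rightarrow> bool" where
  "big_step CSkip s [] s"
| "big_step (CInc r) s [LTau] (s(r := Suc (s r)))"
| "big_step c s ls s1 \<Longrightarrow> big_step d s1 ls' s2 \<Longrightarrow> big_step (CSeq c d) s (ls @ ls') s2"
| "s r = 0 \<Longrightarrow> big_step (CLoop r c) s [LTau] s"
| "s r = Suc m \<Longrightarrow> big_step c (s(r := m)) ls s1 \<Longrightarrow> big_step (CLoop r c) s1 ls' s2 \<Longrightarrow>
     big_step (CLoop r c) s (LTau # ls @ LTau # ls') s2"
| "big_step CMark s [LMark (s 0) (s 1)] s"
| "big_step CEvent s [LEvent] s"

text \<open>Correctness of a program concerns only the order of marks and events; the number of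
  silent steps between them is left open.\<close>

definition runs :: "com \<Rightarrow> (nat \<Rightarrow> nat) \<Rightarrow> label list \<Rightarrow> (nat \<Rightarrow> nat) \<Rightarrow> bool" where
  "runs c s ls s' \<longleftrightarrow> (\<exists>tr. big_step c s tr s' \<and> filter (\<lambda>l. l \<noteq> LTau) tr = ls)"

lemma runs_basic:
  "runs CSkip s [] s"
  "runs (CInc r) s [] (s(r := Suc (s r)))"
  "runs CMark s [LMark (s 0) (s 1)] s"
  "runs CEvent s [LEvent] s"
  "s r = 0 \<Longrightarrow> runs (CLoop r c) s [] s"
  unfolding runs_def by (rule exI, rule conjI, rule big_step.intros; simp)+

lemma runs_Seq: "runs c s ls s1 \<Longrightarrow> runs d s1 ls' s2 \<Longrightarrow> runs (CSeq c d) s (ls @ ls') s2"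
  unfolding runs_def using big_step.intros(3) by fastforce

lemma runs_Loop:
  assumes "s r = Suc m" "runs c (s(r := m)) ls s1" "runs (CLoop r c) s1 ls' s2"
  shows "runs (CLoop r c) s (ls @ ls') s2"
proof -
  obtain t t' where "big_step c (s(r := m)) t s1" "filter (\<lambda>l. l \<noteq> LTau) t = ls"
    "big_step (CLoop r c) s1 t' s2" "filter (\<lambda>l. l \<noteq> LTau) t' = ls'"
    using assms(2,3) unfolding runs_def by blast
  then show ?thesis unfolding runs_def
    using big_step.intros(5)[of s r m c t s1 t' s2] assms(1) by (intro exI conjI) auto
qed

abbreviation quiet :: "com \<Rightarrow> (nat \<Rightarrow> nat) \<Rightarrow> (nat \<Rightarrow> nat) \<Rightarrow> bool" where
  "quiet c s s' \<equiv> runs c s [] s'"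

lemma quiet_Seq: "quiet c s s1 \<Longrightarrow> quiet d s1 s2 \<Longrightarrow> quiet (CSeq c d) s s2"
  using runs_Seq[of c s "[]" s1 d "[]" s2] by simp

lemma quiet_Loop:
  "s r = Suc m \<Longrightarrow> quiet c (s(r := m)) s1 \<Longrightarrow> quiet (CLoop r c) s1 s2 \<Longrightarrow> quiet (CLoop r c) s s2"
  using runs_Loop[of s r m c "[]" s1 "[]" s2] by simp

lemma quiet_Skip: "s' = s \<Longrightarrow> quiet CSkip s s'"
  using runs_basic(1) by simp

lemma quiet_Inc: "s' = s(r := Suc (s r)) \<Longrightarrow> quiet (CInc r) s s'"
  using runs_basic(2) by simp

lemma quiet_Loop0: "s r = 0 \<Longrightarrow> s' = s \<Longrightarrow> quiet (CLoop r c) s s'"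
  using runs_basic(5) by simp

section \<open>Register arithmetic: clearing, moving and copying\<close>

definition cclear :: "nat \<Rightarrow> com" where "cclear r = CLoop r CSkip"

definition cmove :: "nat \<Rightarrow> nat \<Rightarrow> com" where "cmove a d = CLoop a (CInc d)"

definition ccopy :: "nat \<Rightarrow> nat \<Rightarrow> nat \<Rightarrow> com" where
  "ccopy a d t = CSeq (CLoop a (CSeq (CInc t) (CInc d))) (cmove t a)"

lemma quiet_clear: "quiet (cclear r) s (s(r := 0))"
proof -
  have "s r = n \<Longrightarrow> quiet (cclear r) s (s(r := 0))" for n
  proof (induction n arbitrary: s)
    case 0
    then show ?case unfolding cclear_def by (intro quiet_Loop0) auto
  next
    case (Suc n)
    have "quiet (cclear r) (s(r := n)) ((s(r := n))(r := 0))" by (rule Suc.IH) simp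
    then have "quiet (cclear r) (s(r := n)) (s(r := 0))" by (simp only: fun_upd_upd)
    with Suc.prems quiet_Skip[OF refl, of "s(r := n)"] show ?case
      unfolding cclear_def by (rule quiet_Loop)
  qed
  then show ?thesis by blast
qed

lemma quiet_move: "a \<noteq> d \<Longrightarrow> quiet (cmove a d) s (s(a := 0, d := s d + s a))"
proof -
  assume ad: "a \<noteq> d"
  have "s a = n \<Longrightarrow> quiet (cmove a d) s (s(a := 0, d := s d + s a))" for n
  proof (induction n arbitrary: s)
    case 0
    then show ?case unfolding cmove_def by (intro quiet_Loop0) auto
  next
    case (Suc n)
    let ?s = "s(a := n, d := Suc (s d))"
    have "quiet (cmove a d) ?s (?s(a := 0, d := ?s d + ?s a))" by (rule Suc.IH) (use ad in simp)
    also have "?s(a := 0, d := ?s d + ?s a) = s(a := 0, d := s d + s a)"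
      using ad Suc.prems by (auto simp: fun_eq_iff)
    finally have IH: "quiet (cmove a d) ?s (s(a := 0, d := s d + s a))" .
    have "quiet (CInc d) (s(a := n)) ?s" by (rule quiet_Inc) (use ad in simp)
    from quiet_Loop[of s a n "CInc d", OF Suc.prems this IH[unfolded cmove_def]] show ?case
      unfolding cmove_def .
  qed
  then show ?thesis by blast
qed

lemma quiet_copy:
  assumes "a \<noteq> d" "a \<noteq> t" "d \<noteq> t" "s t = 0"
  shows "quiet (ccopy a d t) s (s(d := s d + s a))"
proof -
  have loop: "s a = n \<Longrightarrow> quiet (CLoop a (CSeq (CInc t) (CInc d))) s (s(a := 0, t := s t + s a, d := s d + s a))" for n s
  proof (induction n arbitrary: s)
    case 0
    then show ?case by (intro quiet_Loop0) auto
  next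
    case (Suc n)
    let ?s = "s(a := n, t := Suc (s t), d := Suc (s d))"
    have "quiet (CLoop a (CSeq (CInc t) (CInc d))) ?s (?s(a := 0, t := ?s t + ?s a, d := ?s d + ?s a))"
      by (rule Suc.IH) (use assms in simp)
    also have "?s(a := 0, t := ?s t + ?s a, d := ?s d + ?s a) = s(a := 0, t := s t + s a, d := s d + s a)"
      using assms Suc.prems by (auto simp: fun_eq_iff)
    finally have IH: "quiet (CLoop a (CSeq (CInc t) (CInc d))) ?s (s(a := 0, t := s t + s a, d := s d + s a))" .
    have "quiet (CInc t) (s(a := n)) (s(a := n, t := Suc (s t)))" by (rule quiet_Inc) (use assms in simp)
    moreover have "quiet (CInc d) (s(a := n, t := Suc (s t))) ?s" by (rule quiet_Inc) (use assms in simp)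
    ultimately have "quiet (CSeq (CInc t) (CInc d)) (s(a := n)) ?s" by (rule quiet_Seq)
    from quiet_Loop[of s a n, OF Suc.prems this IH] show ?case .
  qed
  let ?s = "s(a := 0, t := s t + s a, d := s d + s a)"
  have "quiet (cmove t a) ?s (?s(t := 0, a := ?s a + ?s t))"
    using quiet_move[of t a ?s] assms by simp
  also have "?s(t := 0, a := ?s a + ?s t) = s(d := s d + s a)"
    using assms by (auto simp: fun_eq_iff)
  finally have "quiet (cmove t a) ?s (s(d := s d + s a))" .
  with loop[OF refl, of s] show ?thesis unfolding ccopy_def by (rule quiet_Seq)
qed

fun cclears :: "nat \<Rightarrow> nat \<Rightarrow> com" where
  "cclears b 0 = CSkip"
| "cclears b (Suc n) = CSeq (cclear b) (cclears (Suc b) n)"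

lemma quiet_clears: "quiet (cclears b n) s (\<lambda>r. if b \<le> r \<and> r < b + n then 0 else s r)"
proof (induction n arbitrary: b s)
  case 0
  show ?case unfolding cclears.simps by (rule quiet_Skip) auto
next
  case (Suc n)
  have "(\<lambda>r. if Suc b \<le> r \<and> r < Suc b + n then 0 else (s(b := 0)) r) = (\<lambda>r. if b \<le> r \<and> r < b + Suc n then 0 else s r)"
    by (auto simp: fun_eq_iff)
  then show ?case using quiet_Seq[OF quiet_clear[of b s] Suc.IH[of "Suc b" "s(b := 0)"]] by simp
qed

section \<open>Compilation of recursive functions\<close>

fun cargs :: "(nat list \<Rightarrow> nat \<Rightarrow> nat \<Rightarrow> com) list \<Rightarrow> nat list \<Rightarrow> nat \<Rightarrow> nat \<Rightarrow> com" where
  "cargs [] as d b = CSkip"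
| "cargs (c # cs) as d b = CSeq (c as d b) (cargs cs as (Suc d) b)"

text \<open>The code for \<open>f\<close> reads its arguments from the registers \<open>as\<close>, adds the value to register
  \<open>d\<close> and uses the registers from \<open>b\<close> on, initially zero, as scratch space that it cleans up.\<close>

primrec crec :: "recf \<Rightarrow> nat list \<Rightarrow> nat \<Rightarrow> nat \<Rightarrow> com" where
  "crec Zero = (\<lambda>as d b. CSkip)"
| "crec Succ = (\<lambda>as d b. CSeq (ccopy (hd as) d b) (CInc d))"
| "crec (Proj i) = (\<lambda>as d b. ccopy (as ! i) d b)"
| "crec (Comp f gs) = (\<lambda>as d b.
     CSeq (cargs (map crec gs) as b (b + length gs))
      (CSeq (crec f [b..<b + length gs] d (b + length gs))
        (cclears b (length gs))))"
| "crec (PrimRec f g) = (\<lambda>as d b.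
     CSeq (ccopy (hd as) b (b + 3))
      (CSeq (crec f (tl as) (b + 2) (b + 4))
        (CSeq (CLoop b
            (CSeq (crec g ((b + 1) # (b + 2) # tl as) (b + 3) (b + 4))
              (CSeq (cclear (b + 2)) (CSeq (cmove (b + 3) (b + 2)) (CInc (b + 1))))))
          (CSeq (cclear (b + 1)) (cmove (b + 2) d)))))"
| "crec (Mu f) = (\<lambda>as d b.
     CSeq (CInc (b + 1))
      (CSeq (CLoop (b + 1)
          (CSeq (crec f (b # as) (b + 2) (b + 3))
            (CLoop (b + 2) (CSeq (cclear (b + 2)) (CSeq (CInc (b + 1)) (CInc b))))))
        (cmove b d)))"

definition realizes :: "(nat list \<Rightarrow> nat \<Rightarrow> nat \<Rightarrow> com) \<Rightarrow> nat list \<Rightarrow> nat \<Rightarrow> bool" where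
  "realizes c xs z \<longleftrightarrow> (\<forall>as d b s. map s as = xs \<and> (\<forall>a\<in>set as. a < b) \<and> d < b \<and> d \<notin> set as \<and> s d = 0 \<and>
     (\<forall>r\<ge>b. s r = 0) \<longrightarrow> quiet (c as d b) s (s(d := z)))"

lemma realizesD:
  "realizes c xs z \<Longrightarrow> map s as = xs \<Longrightarrow> (\<And>a. a \<in> set as \<Longrightarrow> a < b) \<Longrightarrow> d < b \<Longrightarrow> d \<notin> set as \<Longrightarrow> s d = 0 \<Longrightarrow>
     (\<And>r. r \<ge> b \<Longrightarrow> s r = 0) \<Longrightarrow> s' = s(d := z) \<Longrightarrow> quiet (c as d b) s s'"
  unfolding realizes_def by blast

lemma quiet_cargs:
  assumes "list_all2 (\<lambda>c y. realizes c xs y) cs ys" "map s as = xs" "\<And>a. a \<in> set as \<Longrightarrow> a < d"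
    "d + length cs \<le> b" "\<And>r. r \<ge> d \<Longrightarrow> s r = 0"
  shows "quiet (cargs cs as d b) s (\<lambda>r. if d \<le> r \<and> r < d + length cs then ys ! (r - d) else s r)"
  using assms
proof (induction cs ys arbitrary: d s rule: list_all2_induct)
  case Nil
  show ?case unfolding cargs.simps by (rule quiet_Skip) auto
next
  case (Cons c cs y ys)
  have *: "quiet (c as d b) s (s(d := y))"
    using Cons.prems by (intro realizesD[OF Cons.hyps(1)]) fastforce+
  have "d \<notin> set as" using Cons.prems(2) by blast
  then have "map (s(d := y)) as = xs" using Cons.prems(1) by simp
  then have "quiet (cargs cs as (Suc d) b) (s(d := y))
      (\<lambda>r. if Suc d \<le> r \<and> r < Suc d + length cs then ys ! (r - Suc d) else (s(d := y)) r)"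
    by (rule Cons.IH) (use Cons.prems(2-4) in \<open>auto simp: less_SucI\<close>)
  also have "(\<lambda>r. if Suc d \<le> r \<and> r < Suc d + length cs then ys ! (r - Suc d) else (s(d := y)) r)
      = (\<lambda>r. if d \<le> r \<and> r < d + length (c # cs) then (y # ys) ! (r - d) else s r)"
    by (auto simp: fun_eq_iff nth_Cons' Suc_diff_Suc)
  finally show ?case unfolding cargs.simps by (rule quiet_Seq[OF *])
qed

text \<open>Unrolls a derivation into its sequence of intermediate values, which provides the loop
  invariant of the compiled code.\<close>

lemma eval_PrimRecE:
  assumes "eval (PrimRec f g) xs z"
  obtains n ys y where "xs = n # ys" "eval f ys (y 0)" "\<And>i. i < n \<Longrightarrow> eval g (i # y i # ys) (y (Suc i))" "y n = z"
proof -
  have "\<exists>y. eval f ys (y 0) \<and> (\<forall>i<n. eval g (i # y i # ys) (y (Suc i))) \<and> y n = z"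
    if "eval (PrimRec f g) (n # ys) z" for n ys z
    using that
  proof (induction n arbitrary: z)
    case 0
    then have "eval f ys z" by (auto elim: eval.cases)
    then show ?case by (intro exI[of _ "\<lambda>_. z"]) simp
  next
    case (Suc n)
    from Suc.prems obtain w where w: "eval (PrimRec f g) (n # ys) w" "eval g (n # w # ys) z"
      by (cases rule: eval.cases) auto
    then obtain y where "eval f ys (y 0)" "\<forall>i<n. eval g (i # y i # ys) (y (Suc i))" "y n = w"
      using Suc.IH by blast
    then show ?case using w(2) by (intro exI[of _ "y(Suc n := z)"]) (auto simp: less_Suc_eq)
  qed
  moreover obtain n ys where "xs = n # ys"
    using assms by (cases rule: eval.cases) auto
  ultimately show thesis using that assms by metis
qed

text \<open>Covers defined values only, which is enough for a total function such as the
  coloring.\<close>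

lemma eval_realizes: "eval f xs z \<Longrightarrow> realizes (crec f) xs z"
proof (induction f arbitrary: xs z)
  case Zero
  then have "z = 0" by (cases rule: eval.cases)
  then show ?case using runs_basic(1) unfolding realizes_def by (auto simp: fun_upd_idem)
next
  case Succ
  then obtain x where x: "xs = [x]" "z = Suc x" by (cases rule: eval.cases) auto
  show ?case unfolding realizes_def
  proof (intro allI impI, elim conjE)
    fix as :: "nat list" and d b s
    assume *: "map s as = xs" "\<forall>a\<in>set as. a < b" "d < b" "d \<notin> set as" "s d = 0" "\<forall>r\<ge>b. s r = (0 :: nat)"
    then obtain a where a: "as = [a]" "s a = x" using x by auto
    have "quiet (ccopy a d b) s (s(d := x))" using quiet_copy[of a d b s] * a by auto
    from quiet_Seq[OF this runs_basic(2)[of d]] show "quiet (crec Succ as d b) s (s(d := z))"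
      using a x by simp
  qed
next
  case (Proj i)
  then have i: "i < length xs" "z = xs ! i" by (cases rule: eval.cases; simp)+
  show ?case unfolding realizes_def
  proof (intro allI impI, elim conjE)
    fix as :: "nat list" and d b s
    assume *: "map s as = xs" "\<forall>a\<in>set as. a < b" "d < b" "d \<notin> set as" "s d = 0" "\<forall>r\<ge>b. s r = (0 :: nat)"
    then have "as ! i \<in> set as" "s (as ! i) = z" using i by auto
    then show "quiet (crec (Proj i) as d b) s (s(d := z))"
      using quiet_copy[of "as ! i" d b s] * by auto
  qed
next
  case (Comp f gs)
  from Comp.prems obtain ys where ys: "list_all2 (\<lambda>g y. eval g xs y) gs ys" "eval f ys z"
    by (cases rule: eval.cases) auto
  have gs: "list_all2 (\<lambda>c y. realizes c xs y) (map crec gs) ys"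
    using ys(1) Comp.IH(2) by (auto simp: list_all2_conv_all_nth)
  have f: "realizes (crec f) ys z" using Comp.IH(1) ys(2) .
  have len: "length ys = length gs" using ys(1) by (simp add: list_all2_lengthD)
  show ?case unfolding realizes_def
  proof (intro allI impI, elim conjE)
    fix as :: "nat list" and d b s
    assume *: "map s as = xs" "\<forall>a\<in>set as. a < b" "d < b" "d \<notin> set as" "s d = 0" "\<forall>r\<ge>b. s r = (0 :: nat)"
    let ?n = "length gs"
    define s1 where "s1 r = (if b \<le> r \<and> r < b + ?n then ys ! (r - b) else s r)" for r
    have 1: "quiet (cargs (map crec gs) as b (b + ?n)) s s1"
      using quiet_cargs[OF gs *(1), of b "b + ?n"] * unfolding s1_def by simp
    have "map s1 [b..<b + ?n] = ys" by (rule nth_equalityI) (auto simp: len s1_def)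
    then have 2: "quiet (crec f [b..<b + ?n] d (b + ?n)) s1 (s1(d := z))"
      by (rule realizesD[OF f]) (use * in \<open>auto simp: s1_def\<close>)
    have "(\<lambda>r. if b \<le> r \<and> r < b + ?n then 0 else (s1(d := z)) r) = s(d := z)"
      using * by (auto simp: s1_def fun_eq_iff)
    then have 3: "quiet (cclears b ?n) (s1(d := z)) (s(d := z))"
      using quiet_clears[of b ?n "s1(d := z)"] by simp
    show "quiet (crec (Comp f gs) as d b) s (s(d := z))"
      using quiet_Seq[OF 1 quiet_Seq[OF 2 3]] by simp
  qed
next
  case (PrimRec f g)
  obtain n ys y where xs: "xs = n # ys" and y: "eval f ys (y 0)"
    "\<And>i. i < n \<Longrightarrow> eval g (i # y i # ys) (y (Suc i))" "y n = z"
    using eval_PrimRecE[OF PrimRec.prems] by metis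
  have f: "realizes (crec f) ys (y 0)" using PrimRec.IH(1) y(1) .
  have g: "realizes (crec g) (i # y i # ys) (y (Suc i))" if "i < n" for i using PrimRec.IH(2) y(2) that .
  show ?case unfolding realizes_def
  proof (intro allI impI, elim conjE)
    fix as :: "nat list" and d b s
    assume *: "map s as = xs" "\<forall>a\<in>set as. a < b" "d < b" "d \<notin> set as" "s d = 0" "\<forall>r\<ge>b. s r = (0 :: nat)"
    then obtain a as' where as: "as = a # as'" "s a = n" "map s as' = ys" using xs by auto
    \<comment> \<open>The state before round \<open>i\<close>: register \<open>b\<close> counts the
      rounds left, \<open>b + 1\<close> holds the index and \<open>b + 2\<close> the value
      \<open>y i\<close>. The next value is formed in \<open>b + 3\<close>.\<close>
    define t where "t i = s(b := n - i, b + 1 := i, b + 2 := y i)" for i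
    have "r \<notin> set as'" if "r \<ge> b" for r using *(2) as(1) that by fastforce
    then have as': "map (t i) as' = ys" "map ((t i)(b := j)) as' = ys" for i j
      using as(3) by (simp_all add: t_def)
    have 1: "quiet (ccopy a b (b + 3)) s (s(b := n))"
      using quiet_copy[of a b "b + 3" s] * as by auto
    have 2: "quiet (crec f as' (b + 2) (b + 4)) (s(b := n)) (t 0)"
    proof (rule realizesD[OF f])
      show "map (s(b := n)) as' = ys" using as *(2) by auto
      show "t 0 = (s(b := n))(b + 2 := y 0)" using * by (auto simp: t_def fun_eq_iff)
    qed (use * as in fastforce)+
    let ?c = "CSeq (crec g ((b + 1) # (b + 2) # as') (b + 3) (b + 4))
              (CSeq (cclear (b + 2)) (CSeq (cmove (b + 3) (b + 2)) (CInc (b + 1))))"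
    have body: "quiet ?c ((t i)(b := n - Suc i)) (t (Suc i))" if "i < n" for i
    proof -
      let ?u = "(t i)(b := n - Suc i)"
      have g': "quiet (crec g ((b + 1) # (b + 2) # as') (b + 3) (b + 4)) ?u (?u(b + 3 := y (Suc i)))"
      proof (rule realizesD[OF g[OF that]])
        show "map ?u ((b + 1) # (b + 2) # as') = i # y i # ys"
          using as' by (simp add: t_def)
      qed (use * as in \<open>fastforce simp: t_def\<close>)+
      let ?v = "?u(b + 3 := y (Suc i), b + 2 := 0)"
      have c': "quiet (cclear (b + 2)) (?u(b + 3 := y (Suc i))) ?v" by (rule quiet_clear)
      have m': "quiet (cmove (b + 3) (b + 2)) ?v (?v(b + 3 := 0, b + 2 := y (Suc i)))"
        using quiet_move[of "b + 3" "b + 2" ?v] by simp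
      have "?v(b + 3 := 0, b + 2 := y (Suc i), b + 1 := Suc i) = t (Suc i)"
        using * by (auto simp: t_def fun_eq_iff)
      moreover have "(?v(b + 3 := 0, b + 2 := y (Suc i))) (b + 1) = i" by (simp add: t_def)
      ultimately have i': "quiet (CInc (b + 1)) (?v(b + 3 := 0, b + 2 := y (Suc i))) (t (Suc i))"
        using runs_basic(2)[of "b + 1" "?v(b + 3 := 0, b + 2 := y (Suc i))"] by simp
      show ?thesis by (rule quiet_Seq[OF g' quiet_Seq[OF c' quiet_Seq[OF m' i']]])
    qed
    have "i \<le> n \<Longrightarrow> quiet (CLoop b ?c) (t i) (t n)" for i
    proof (induction i rule: inc_induct)
      case base
      show ?case by (rule runs_basic(5)) (simp add: t_def)
    next
      case (step i)
      have "t i b = Suc (n - Suc i)" using step(2) by (simp add: t_def)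
      then show ?case using body[OF step(2)] step(3) by (rule quiet_Loop)
    qed
    then have 3: "quiet (CLoop b ?c) (t 0) (t n)" by simp
    have 4: "quiet (cclear (b + 1)) (t n) ((t n)(b + 1 := 0))" by (rule quiet_clear)
    have "((t n)(b + 1 := 0))(b + 2 := 0, d := ((t n)(b + 1 := 0)) d + ((t n)(b + 1 := 0)) (b + 2)) = s(d := z)"
      using * y(3) by (auto simp: t_def fun_eq_iff)
    then have 5: "quiet (cmove (b + 2) d) ((t n)(b + 1 := 0)) (s(d := z))"
      using quiet_move[of "b + 2" d "(t n)(b + 1 := 0)"] * by simp
    show "quiet (crec (PrimRec f g) as d b) s (s(d := z))"
      using quiet_Seq[OF 1 quiet_Seq[OF 2 quiet_Seq[OF 3 quiet_Seq[OF 4 5]]]] as by simp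
  qed
next
  case (Mu f)
  from Mu.prems have z: "eval f (z # xs) 0" and "\<forall>m<z. \<exists>y. eval f (m # xs) (Suc y)"
    by (cases rule: eval.cases; simp)+
  then obtain y where y: "\<And>m. m < z \<Longrightarrow> eval f (m # xs) (Suc (y m))" by metis
  show ?case unfolding realizes_def
  proof (intro allI impI, elim conjE)
    fix as :: "nat list" and d b s
    assume *: "map s as = xs" "\<forall>a\<in>set as. a < b" "d < b" "d \<notin> set as" "s d = 0" "\<forall>r\<ge>b. s r = (0 :: nat)"
    \<comment> \<open>The candidate is in \<open>b\<close>, and \<open>b + 1\<close> is a flag that
      keeps the outer loop running. The outer test lowers the flag. The loop \<open>?l\<close> acts
      as a conditional, since it clears its own register: if the value was positive, it raises the
      flag and passes to the next candidate.\<close>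
    define t where "t i = s(b := i, b + 1 := 1)" for i :: nat
    let ?l = "CLoop (b + 2) (CSeq (cclear (b + 2)) (CSeq (CInc (b + 1)) (CInc b)))"
    let ?c = "CSeq (crec f (b # as) (b + 2) (b + 3)) ?l"
    have f: "quiet (crec f (b # as) (b + 2) (b + 3)) ((t i)(b + 1 := 0)) ((t i)(b + 1 := 0, b + 2 := v))"
      if "eval f (i # xs) v" for i v
    proof (rule realizesD[OF Mu.IH[OF that]])
      show "map ((t i)(b + 1 := 0)) (b # as) = i # xs" using * by (auto simp: t_def)
    qed (use * in \<open>fastforce simp: t_def\<close>)+
    have 1: "quiet (CInc (b + 1)) s (t 0)"
    proof -
      have "s(b + 1 := Suc (s (b + 1))) = t 0" using * by (auto simp: t_def fun_eq_iff)
      then show ?thesis using runs_basic(2)[of "b + 1" s] by simp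
    qed
    have body: "quiet ?c ((t i)(b + 1 := 0)) (t (Suc i))" if "i < z" for i
    proof -
      let ?u = "(t i)(b + 1 := 0, b + 2 := Suc (y i))"
      let ?v = "(t i)(b + 1 := 0, b + 2 := 0)"
      have c': "quiet (cclear (b + 2)) (?u(b + 2 := y i)) ?v"
        using quiet_clear[of "b + 2" "?u(b + 2 := y i)"] by simp
      have i': "quiet (CInc (b + 1)) ?v (?v(b + 1 := 1))"
        using runs_basic(2)[of "b + 1" ?v] by simp
      have "?v(b + 1 := 1, b := Suc i) = t (Suc i)" using * by (auto simp: t_def fun_eq_iff)
      then have j': "quiet (CInc b) (?v(b + 1 := 1)) (t (Suc i))"
        using runs_basic(2)[of b "?v(b + 1 := 1)"] by (simp add: t_def)
      have "quiet ?l ?u (t (Suc i))"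
        by (rule quiet_Loop[OF _ quiet_Seq[OF c' quiet_Seq[OF i' j']]])
           (use * in \<open>auto simp: t_def intro: runs_basic(5)\<close>)
      with f[OF y[OF that]] show ?thesis by (rule quiet_Seq)
    qed
    have last: "quiet ?c ((t z)(b + 1 := 0)) ((t z)(b + 1 := 0))"
    proof -
      have "(t z)(b + 1 := 0, b + 2 := 0) = (t z)(b + 1 := 0)" using * by (auto simp: t_def fun_eq_iff)
      with f[OF z] have "quiet (crec f (b # as) (b + 2) (b + 3)) ((t z)(b + 1 := 0)) ((t z)(b + 1 := 0))"
        by simp
      moreover have "quiet ?l ((t z)(b + 1 := 0)) ((t z)(b + 1 := 0))"
        by (rule runs_basic(5)) (use * in \<open>simp add: t_def\<close>)
      ultimately show ?thesis by (rule quiet_Seq)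
    qed
    have "i \<le> z \<Longrightarrow> quiet (CLoop (b + 1) ?c) (t i) ((t z)(b + 1 := 0))" for i
    proof (induction i rule: inc_induct)
      case base
      show ?case by (rule quiet_Loop[OF _ last runs_basic(5)]) (simp_all add: t_def)
    next
      case (step i)
      show ?case by (rule quiet_Loop[OF _ body[OF step(2)] step(3)]) (simp add: t_def)
    qed
    then have 2: "quiet (CLoop (b + 1) ?c) (t 0) ((t z)(b + 1 := 0))" by simp
    have "((t z)(b + 1 := 0))(b := 0, d := ((t z)(b + 1 := 0)) d + ((t z)(b + 1 := 0)) b) = s(d := z)"
      using * by (auto simp: t_def fun_eq_iff)
    then have 3: "quiet (cmove b d) ((t z)(b + 1 := 0)) (s(d := z))"
      using quiet_move[of b d "(t z)(b + 1 := 0)"] * by simp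
    show "quiet (crec (Mu f) as d b) s (s(d := z))"
      using quiet_Seq[OF 1 quiet_Seq[OF 2 3]] by simp
  qed
qed

section \<open>Flat code for a counter machine with marks and events\<close>

datatype minsky = IInc nat | IDec nat nat | IJmp nat | IMark | IEvent

fun code_size :: "com \<Rightarrow> nat" where
  "code_size (CSeq c d) = code_size c + code_size d"
| "code_size (CLoop r c) = code_size c + 2"
| "code_size CSkip = 0"
| "code_size _ = 1"

text \<open>Jump targets are absolute, hence the start address \<open>p\<close>; the exit of a loop
  lies behind the body and the two instructions \<open>IDec\<close> and \<open>IJmp\<close>.\<close>

fun code :: "com \<Rightarrow> nat \<Rightarrow> minsky list" where
  "code CSkip p = []"
| "code (CInc r) p = [IInc r]"
| "code (CSeq c d) p = code c p @ code d (p + code_size c)"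
| "code (CLoop r c) p = IDec r (p + code_size c + 2) # code c (p + 1) @ [IJmp p]"
| "code CMark p = [IMark]"
| "code CEvent p = [IEvent]"

lemma length_code [simp]: "length (code c p) = code_size c"
  by (induction c arbitrary: p) auto

type_synonym state = "nat \<times> (nat \<Rightarrow> nat)"

fun mlabel :: "minsky \<Rightarrow> (nat \<Rightarrow> nat) \<Rightarrow> label" where
  "mlabel IMark s = LMark (s 0) (s 1)"
| "mlabel IEvent s = LEvent"
| "mlabel _ s = LTau"

fun mnext :: "minsky \<Rightarrow> state \<Rightarrow> state" where
  "mnext (IInc r) (p, s) = (p + 1, s(r := Suc (s r)))"
| "mnext (IDec r q) (p, s) = (if s r = 0 then (q, s) else (p + 1, s(r := s r - 1)))"
| "mnext (IJmp q) (p, s) = (q, s)"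
| "mnext IMark (p, s) = (p + 1, s)"
| "mnext IEvent (p, s) = (p + 1, s)"

fun mrun :: "minsky list \<Rightarrow> state \<Rightarrow> label list \<Rightarrow> state \<Rightarrow> bool" where
  "mrun P c [] c' \<longleftrightarrow> c = c'"
| "mrun P c (l # ls) c' \<longleftrightarrow> fst c < length P \<and> mlabel (P ! fst c) (snd c) = l \<and> mrun P (mnext (P ! fst c) c) ls c'"

lemma mrun_append: "mrun P c (ls @ ls') c' \<longleftrightarrow> (\<exists>d. mrun P c ls d \<and> mrun P d ls' c')"
  by (induction ls arbitrary: c) auto

lemma mrun_appendI: "mrun P c ls d \<Longrightarrow> mrun P d ls' c' \<Longrightarrow> mrun P c (ls @ ls') c'"
  using mrun_append by blast

lemma big_step_mrun:
  "big_step c s ls s' \<Longrightarrow> P = pre @ code c (length pre) @ post \<Longrightarrow>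
    mrun P (length pre, s) ls (length pre + code_size c, s')"
proof (induction arbitrary: pre post rule: big_step.induct)
  case (3 c s ls s1 d ls' s2)
  have "mrun P (length pre, s) ls (length pre + code_size c, s1)"
    by (rule 3(3)[of pre "code d (length pre + code_size c) @ post"]) (simp add: 3)
  moreover have "mrun P (length (pre @ code c (length pre)), s1) ls' (length (pre @ code c (length pre)) + code_size d, s2)"
    by (rule 3(4)[of _ post]) (simp add: 3)
  ultimately show ?case by (auto intro!: mrun_appendI simp: add.assoc)
next
  case (5 s r m c ls s1 ls' s2)
  let ?pre = "pre @ [IDec r (length pre + code_size c + 2)]"
  have "mrun P (length ?pre, s(r := m)) ls (length ?pre + code_size c, s1)"
    by (rule "5.IH"(1)[of ?pre "IJmp (length pre) # post"]) (simp add: 5)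
  moreover have "mrun P (length pre + code_size c + 1, s1) (LTau # ls') (length pre + code_size (CLoop r c), s2)"
    using "5.IH"(2)[OF 5(6)] by (simp add: 5 nth_append)
  ultimately show ?case using 5
    by (auto intro!: mrun_appendI simp: nth_append)
qed (auto simp: nth_append)

text \<open>Register 2 holds \<open>e\<close>, register 0 the running \<open>x\<close>, register 1
  the value and register 3 the rounds left; scratch space begins at 4. The extra
  \<open>CInc 3\<close> makes \<open>e + 1\<close> rounds, for \<open>x = 0, ..., e\<close>.\<close>

definition sweep :: "recf \<Rightarrow> com" where
  "sweep f = CSeq (ccopy 2 3 4) (CSeq (CInc 3)
     (CSeq (CLoop 3 (CSeq (crec f [0, 2] 1 4) (CSeq CMark (CSeq (cclear 1) (CInc 0)))))
       (CSeq (cclear 0) (CSeq CEvent (CInc 2)))))"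

definition sweep_state :: "nat \<Rightarrow> nat \<Rightarrow> nat" where
  "sweep_state e r = (if r = 2 then e else 0)"

lemma runs_sweep:
  assumes "\<And>x e. eval f [x, e] (v x e)"
  shows "runs (sweep f) (sweep_state e) (map (\<lambda>x. LMark x (v x e)) [0..<Suc e] @ [LEvent]) (sweep_state (Suc e))"
proof -
  define t where "t i k = (sweep_state e)(0 := i, 3 := k)" for i k
  let ?c = "CSeq (crec f [0, 2] 1 4) (CSeq CMark (CSeq (cclear 1) (CInc 0)))"
  have body: "runs ?c ((t i k)(3 := j)) [LMark i (v i e)] (t (Suc i) j)" for i k j
  proof -
    have u: "(t i k)(3 := j) = t i j" by (simp add: t_def)
    have 1: "quiet (crec f [0, 2] 1 4) (t i j) ((t i j)(1 := v i e))"
      by (rule realizesD[OF eval_realizes[OF assms]]) (auto simp: t_def sweep_state_def)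
    have 2: "runs CMark ((t i j)(1 := v i e)) [LMark i (v i e)] ((t i j)(1 := v i e))"
      using runs_basic(3)[of "(t i j)(1 := v i e)"] by (simp add: t_def)
    have "(t i j)(1 := v i e, 1 := 0) = t i j" by (auto simp: t_def sweep_state_def fun_eq_iff)
    then have 3: "quiet (cclear 1) ((t i j)(1 := v i e)) (t i j)"
      using quiet_clear[of 1 "(t i j)(1 := v i e)"] by simp
    have 4: "quiet (CInc 0) (t i j) (t (Suc i) j)"
      by (rule quiet_Inc) (auto simp: t_def fun_eq_iff)
    show ?thesis unfolding u
      using runs_Seq[OF 1 runs_Seq[OF 2 quiet_Seq[OF 3 4]]] by simp
  qed
  have loop: "i \<le> Suc e \<Longrightarrow> runs (CLoop 3 ?c) (t i (Suc e - i)) (map (\<lambda>x. LMark x (v x e)) [i..<Suc e]) (t (Suc e) 0)" for i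
  proof (induction i rule: inc_induct)
    case base
    show ?case by (simp add: t_def runs_basic(5))
  next
    case (step i)
    have "t i (Suc e - i) 3 = Suc (e - i)" using step(2) by (simp add: t_def)
    from runs_Loop[OF this body] step(2,3) show ?case
      by (simp only: upt_conv_Cons[OF step(2)] list.map append_Cons append_Nil diff_Suc_Suc)
  qed
  have "(sweep_state e)(3 := e) = t 0 e" by (auto simp: t_def sweep_state_def fun_eq_iff)
  then have 1: "quiet (ccopy 2 3 4) (sweep_state e) (t 0 e)"
    using quiet_copy[of 2 3 4 "sweep_state e"] by (simp add: sweep_state_def)
  have 2: "quiet (CInc 3) (t 0 e) (t 0 (Suc e))"
    by (rule quiet_Inc) (auto simp: t_def fun_eq_iff)
  have 3: "runs (CLoop 3 ?c) (t 0 (Suc e)) (map (\<lambda>x. LMark x (v x e)) [0..<Suc e]) (t (Suc e) 0)"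
    using loop[of 0] by simp
  have "(t (Suc e) 0)(0 := 0) = sweep_state e" by (auto simp: t_def sweep_state_def fun_eq_iff)
  then have 4: "quiet (cclear 0) (t (Suc e) 0) (sweep_state e)"
    using quiet_clear[of 0 "t (Suc e) 0"] by simp
  have 5: "quiet (CInc 2) (sweep_state e) (sweep_state (Suc e))"
    by (rule quiet_Inc) (auto simp: sweep_state_def fun_eq_iff)
  show ?thesis unfolding sweep_def
    using runs_Seq[OF 1 runs_Seq[OF 2 runs_Seq[OF 3 runs_Seq[OF 4 runs_Seq[OF runs_basic(4) 5]]]]] by simp
qed

text \<open>A final \<open>IJmp 0\<close> closes the loop: having passed its event, the program
  starts over with the next \<open>e\<close> and never stops.\<close>

lemma sweep_program:
  assumes "\<And>x e. eval f [x, e] (v x e)"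
  obtains P tr where "\<And>e. mrun P (0, sweep_state e) (tr e) (0, sweep_state (Suc e))"
    "\<And>e. filter (\<lambda>l. l \<noteq> LTau) (tr e) = map (\<lambda>x. LMark x (v x e)) [0..<Suc e] @ [LEvent]"
proof -
  let ?P = "code (sweep f) 0 @ [IJmp 0]"
  have "\<exists>tr. mrun ?P (0, sweep_state e) tr (0, sweep_state (Suc e)) \<and>
      filter (\<lambda>l. l \<noteq> LTau) tr = map (\<lambda>x. LMark x (v x e)) [0..<Suc e] @ [LEvent]" for e
  proof -
    obtain tr where tr: "big_step (sweep f) (sweep_state e) tr (sweep_state (Suc e))"
      "filter (\<lambda>l. l \<noteq> LTau) tr = map (\<lambda>x. LMark x (v x e)) [0..<Suc e] @ [LEvent]"
      using runs_sweep[OF assms] unfolding runs_def by blast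
    have "mrun ?P (0, sweep_state e) tr (code_size (sweep f), sweep_state (Suc e))"
      using big_step_mrun[OF tr(1), of ?P "[]" "[IJmp 0]"] by simp
    then have "mrun ?P (0, sweep_state e) (tr @ [LTau]) (0, sweep_state (Suc e))"
      by (rule mrun_appendI) (simp add: nth_append)
    then show ?thesis using tr(2) by (intro exI[of _ "tr @ [LTau]"]) simp
  qed
  then show thesis using that by metis
qed

section \<open>The answer stream\<close>

definition mcfg :: "minsky list \<Rightarrow> state \<Rightarrow> nat \<Rightarrow> state" where
  "mcfg P c n = ((\<lambda>c. mnext (P ! fst c) c) ^^ n) c"

definition mlab :: "minsky list \<Rightarrow> state \<Rightarrow> nat \<Rightarrow> label" where
  "mlab P c n = mlabel (P ! fst (mcfg P c n)) (snd (mcfg P c n))"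

lemma mcfg_simps: "mcfg P c 0 = c" "mcfg P c (Suc n) = mcfg P (mnext (P ! fst c) c) n"
  "mcfg P c (Suc n) = mnext (P ! fst (mcfg P c n)) (mcfg P c n)" "mcfg P c (m + n) = mcfg P (mcfg P c m) n"
proof -
  show "mcfg P c (Suc n) = mcfg P (mnext (P ! fst c) c) n"
    unfolding mcfg_def funpow_Suc_right by simp
  show "mcfg P c (m + n) = mcfg P (mcfg P c m) n"
    unfolding mcfg_def add.commute[of m] funpow_add by simp
qed (simp_all add: mcfg_def)

lemma mlab_add: "mlab P c (m + n) = mlab P (mcfg P c m) n"
  by (simp add: mlab_def mcfg_simps(4))

lemma mrun_mcfg:
  "mrun P c ls c' \<Longrightarrow> mcfg P c (length ls) = c' \<and>
    (\<forall>i<length ls. fst (mcfg P c i) < length P \<and> mlab P c i = ls ! i)"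
proof (induction ls arbitrary: c)
  case (Cons l ls)
  then have prems: "fst c < length P" "mlabel (P ! fst c) (snd c) = l" "mrun P (mnext (P ! fst c) c) ls c'"
    by simp_all
  have "fst (mcfg P c i) < length P \<and> mlab P c i = (l # ls) ! i" if "i < length (l # ls)" for i
    using Cons.IH[OF prems(3)] prems(1,2) that by (cases i) (simp_all add: mlab_def mcfg_simps(1,2))
  then show ?case using Cons.IH[OF prems(3)] by (simp add: mcfg_simps(2))
qed (simp add: mcfg_simps)

text \<open>For a fixed \<open>x\<close>, entry \<open>i\<close> of the stream is the bit to be output at the \<open>i\<close>-th event from
  now on, as far as it is known.\<close>

fun update :: "nat \<Rightarrow> label \<Rightarrow> (nat \<Rightarrow> nat) \<Rightarrow> nat \<Rightarrow> nat" where
  "update x LTau R = R"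
| "update x (LMark y b) R = (if y = x then R(0 := (if b = 0 then 0 else 1)) else R)"
| "update x LEvent R = (\<lambda>i. R (Suc i))"

definition stream :: "minsky list \<Rightarrow> state \<Rightarrow> nat \<Rightarrow> (nat \<Rightarrow> nat) \<Rightarrow> nat \<Rightarrow> nat \<Rightarrow> nat" where
  "stream P c x R n = fold (\<lambda>i. update x (mlab P c i)) [0..<n] R"

lemma stream_simps: "stream P c x R 0 = R"
  "stream P c x R (Suc n) = update x (mlab P c n) (stream P c x R n)"
  by (simp_all add: stream_def)

lemma stream_add: "stream P c x R (m + n) = stream P (mcfg P c m) x (stream P c x R m) n"
  by (induction n) (simp_all add: stream_simps mlab_add)

lemma stream_eq_fold:
  assumes "mrun P c ls c'" "n \<le> length ls"
  shows "stream P c x R n = fold (update x) (take n ls) R"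
  using assms(2)
proof (induction n)
  case (Suc n)
  then show ?case using mrun_mcfg[OF assms(1)] by (simp add: stream_simps take_Suc_conv_app_nth)
qed (simp add: stream_simps)

lemma fold_update_filter:
  "fold (update x) ls R = fold (update x) (filter (\<lambda>l. l \<noteq> LTau) ls) R"
  by (induction ls arbitrary: R) auto

lemma fold_update_marks:
  "fold (update x) (map (\<lambda>y. LMark y (v y)) ys) R =
    (if x \<in> set ys then R(0 := (if v x = 0 then 0 else 1)) else R)"
  by (induction ys arbitrary: R) auto

text \<open>At the start of round \<open>e\<close>, entry \<open>i\<close> concerns round
  \<open>e + i\<close>. Rounds before \<open>x\<close> announce nothing about \<open>x\<close>, so
  their bits have to be present from the start; those of later rounds are 0 until the mark sets
  them.\<close>

definition known :: "(nat \<Rightarrow> nat \<Rightarrow> bool) \<Rightarrow> nat \<Rightarrow> nat \<Rightarrow> nat \<Rightarrow> nat" where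
  "known col x e i = (if e + i < x \<and> col x (e + i) then 1 else 0)"

text \<open>Invariant: round \<open>e\<close> starts with the stream \<open>known col x e\<close>.
  If \<open>x \<le> e\<close>, the mark of \<open>x\<close> puts the bit of this round in front; if
  \<open>e < x\<close>, it is there already. The event then drops it, which leaves
  \<open>known col x (Suc e)\<close>.\<close>

lemma stream_events:
  assumes run: "\<And>e. mrun P (0, sweep_state e) (tr e) (0, sweep_state (Suc e))"
    and tr: "\<And>e. filter (\<lambda>l. l \<noteq> LTau) (tr e) =
      map (\<lambda>x. LMark x (if col x e then 1 else 0)) [0..<Suc e] @ [LEvent]"
  defines "c \<equiv> (0, sweep_state 0)"
  obtains ev where "\<And>e. mlab P c (ev e) = LEvent" "\<And>n. mlab P c n = LEvent \<Longrightarrow> \<exists>e. n = ev e"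
    "\<And>x e. stream P c x (known col x 0) (ev e) 0 = (if col x e then 1 else 0)"
    "\<And>n. fst (mcfg P c n) < length P"
proof -
  define pos where "pos e = (\<Sum>i<e. length (tr i))" for e
  have pos_Suc: "pos (Suc e) = pos e + length (tr e)" for e by (simp add: pos_def)
  \<comment> \<open>The trace of a round splits at its only event: all marks come before it, and
    only silent steps after it.\<close>
  have "\<exists>pre post. tr e = pre @ LEvent # post \<and> LEvent \<notin> set pre \<and> LEvent \<notin> set post \<and>
      filter (\<lambda>l. l \<noteq> LTau) pre = map (\<lambda>x. LMark x (if col x e then 1 else 0)) [0..<Suc e] \<and>
      filter (\<lambda>l. l \<noteq> LTau) post = []" for e
  proof -
    have "LEvent \<in> set (filter (\<lambda>l. l \<noteq> LTau) (tr e))" unfolding tr by simp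
    then have "LEvent \<in> set (tr e)" by simp
    then obtain pre post where split: "tr e = pre @ LEvent # post" "LEvent \<notin> set pre"
      using split_list_first by metis
    let ?ms = "map (\<lambda>x. LMark x (if col x e then 1 else 0)) [0..<Suc e]"
    have eq: "filter (\<lambda>l. l \<noteq> LTau) pre @ LEvent # filter (\<lambda>l. l \<noteq> LTau) post = ?ms @ LEvent # []"
      using tr[of e] split(1) by simp
    have "LEvent \<notin> set ?ms" by auto
    then have fl: "filter (\<lambda>l. l \<noteq> LTau) pre = ?ms" "filter (\<lambda>l. l \<noteq> LTau) post = []"
      using append_Cons_eq_iff[of LEvent ?ms "[]" "filter (\<lambda>l. l \<noteq> LTau) pre" "filter (\<lambda>l. l \<noteq> LTau) post"] eq
      by simp_all
    moreover from fl(2) have "LEvent \<notin> set post" by (auto simp: filter_empty_conv)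
    ultimately show ?thesis using split by blast
  qed
  then obtain pre post where pp: "\<And>e. tr e = pre e @ LEvent # post e" "\<And>e. LEvent \<notin> set (pre e)"
    "\<And>e. LEvent \<notin> set (post e)" "\<And>e. filter (\<lambda>l. l \<noteq> LTau) (post e) = []"
    "\<And>e. filter (\<lambda>l. l \<noteq> LTau) (pre e) = map (\<lambda>x. LMark x (if col x e then 1 else 0)) [0..<Suc e]"
    by metis
  have cfg: "mcfg P c (pos e) = (0, sweep_state e)" for e
  proof (induction e)
    case (Suc e)
    then show ?case using mrun_mcfg[OF run[of e]] by (simp add: pos_Suc mcfg_simps(4))
  qed (simp add: pos_def mcfg_simps c_def)
  have fold_pre: "fold (update x) (pre e) R = (if x \<le> e then R(0 := (if col x e then 1 else 0)) else R)" for x e R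
    by (subst fold_update_filter) (simp only: pp(5) fold_update_marks, simp)
  have block: "stream P (0, sweep_state e) x (known col x e) (length (pre e)) =
      (\<lambda>i. if i = 0 \<and> col x e then 1 else known col x e i)" for x e
    by (subst stream_eq_fold[OF run]) (auto simp: pp(1) fold_pre known_def fun_eq_iff)
  have str: "stream P c x (known col x 0) (pos e) = known col x e" for x e
  proof (induction e)
    case (Suc e)
    have "stream P c x (known col x 0) (pos (Suc e)) = fold (update x) (tr e) (known col x e)"
      unfolding pos_Suc stream_add cfg Suc by (subst stream_eq_fold[OF run]) simp_all
    also have "\<dots> = fold (update x) (post e) (\<lambda>i. known col x e (Suc i))"
      by (auto simp: pp(1) fold_pre fun_eq_iff)
    also have "\<dots> = (\<lambda>i. known col x e (Suc i))"
      by (subst fold_update_filter) (simp add: pp(4))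
    also have "\<dots> = known col x (Suc e)" by (simp add: known_def fun_eq_iff)
    finally show ?case .
  qed (simp add: pos_def stream_simps)
  have ex: "\<exists>e j. n = pos e + j \<and> j < length (tr e)" for n
  proof (induction n)
    case 0
    show ?case by (intro exI[of _ 0]) (simp add: pos_def pp(1))
  next
    case (Suc n)
    then obtain e j where ej: "n = pos e + j" "j < length (tr e)" by blast
    show ?case
    proof (cases "Suc j < length (tr e)")
      case True
      then show ?thesis using ej by (intro exI[of _ e] exI[of _ "Suc j"]) simp
    next
      case False
      then have "Suc n = pos (Suc e) + 0" using ej by (simp add: pos_Suc)
      then show ?thesis by (intro exI[of _ "Suc e"] exI[of _ 0]) (simp add: pp(1))
    qed
  qed
  have lab: "mlab P c (pos e + j) = tr e ! j" "fst (mcfg P c (pos e + j)) < length P"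
    if "j < length (tr e)" for e j
    using mrun_mcfg[OF run[of e]] that by (simp_all add: mlab_add mcfg_simps(4) cfg)
  show thesis
  proof (rule that[of "\<lambda>e. pos e + length (pre e)"])
    show "mlab P c (pos e + length (pre e)) = LEvent" for e
      by (subst lab) (simp_all add: pp(1))
    show "\<exists>e. n = pos e + length (pre e)" if "mlab P c n = LEvent" for n
    proof -
      obtain e j where ej: "n = pos e + j" "j < length (tr e)" using ex by blast
      have "tr e ! j = LEvent" using ej lab(1) that by simp
      have "\<not> j < length (pre e)"
        using \<open>tr e ! j = LEvent\<close> pp(1,2) nth_mem by (metis nth_append)
      moreover have "\<not> length (pre e) < j"
      proof
        assume "length (pre e) < j"
        then have "post e ! (j - Suc (length (pre e))) = LEvent" "j - Suc (length (pre e)) < length (post e)"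
          using \<open>tr e ! j = LEvent\<close> ej(2) by (auto simp: pp(1) nth_append nth_Cons')
        then show False using pp(3) nth_mem by metis
      qed
      ultimately have "j = length (pre e)" by simp
      then show ?thesis using ej by auto
    qed
    show "stream P c x (known col x 0) (pos e + length (pre e)) 0 = (if col x e then 1 else 0)" for x e
      unfolding stream_add cfg str block by (simp add: known_def)
    show "fst (mcfg P c n) < length P" for n using ex[of n] lab(2) by blast
  qed
qed

section \<open>Tapes as functions\<close>

definition entry :: "nat list \<Rightarrow> nat \<Rightarrow> nat" where
  "entry xs i = (if i < length xs then xs ! i else 0)"

text \<open>Positions are relative to the head, which is always at 0, and blanks continue the
  contents on both sides; a head movement becomes a translation.\<close>

definition cell :: "tape \<Rightarrow> int \<Rightarrow> nat" where
  "cell t p = (if p \<ge> 0 then entry (snd t) (nat p) else entry (fst t) (nat (- p - 1)))"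

lemma entry_simps: "entry [] i = 0" "entry (a # as) 0 = a" "entry (a # as) (Suc i) = entry as i"
  "entry (tl as) i = entry as (Suc i)" "scanned as = entry as 0"
  by (cases as; cases i; simp add: entry_def)+

lemma entry_Cons: "entry (a # as) i = (if i = 0 then a else entry as (i - 1))"
  by (cases i) (simp_all add: entry_simps)

lemma read_cell: "read t = cell t 0"
  by (cases t) (simp add: cell_def entry_simps)

fun offset :: "move \<Rightarrow> int" where
  "offset MoveLeft = -1" | "offset MoveRight = 1" | "offset Stay = 0"

definition act :: "nat \<times> move \<Rightarrow> tape \<Rightarrow> tape" where
  "act a t = shift (snd a) (put (fst a) t)"

lemma cell_put: "cell (put a t) = (cell t)(0 := a)"
  by (cases t) (auto simp: cell_def fun_eq_iff entry_simps entry_Cons Suc_nat_eq_nat_zadd1)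

lemma cell_int: "cell t (int n) = entry (snd t) n" "cell t (- int (Suc n)) = entry (fst t) n"
  by (simp_all add: cell_def)

lemma cell_shift: "cell (shift d t) p = cell t (p + offset d)"
proof -
  obtain ls rs where t: "t = (ls, rs)" by (cases t)
  consider n where "p = int (Suc n)" | "p = int 0" | "p = - int (Suc 0)" | n where "p = - int (Suc (Suc n))"
    by (metis int_cases nat.exhaust)
  then show ?thesis
  proof cases
    case (1 n)
    then have "p + 1 = int (Suc (Suc n))" "p - 1 = int n" by simp_all
    then show ?thesis using 1 t by (cases d) (simp_all only: cell_int shift.simps fst_conv snd_conv
        offset.simps entry_simps add_0_right diff_conv_add_uminus[symmetric])
  next
    case 2
    then have "p + 1 = int (Suc 0)" "p - 1 = - int (Suc 0)" by simp_all
    then show ?thesis using 2 t by (cases d) (simp_all only: cell_int shift.simps fst_conv snd_conv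
        offset.simps entry_simps add_0_right diff_conv_add_uminus[symmetric])
  next
    case 3
    then have "p + 1 = int 0" "p - 1 = - int (Suc (Suc 0))" by simp_all
    then show ?thesis using 3 t by (cases d) (simp_all only: cell_int shift.simps fst_conv snd_conv
        offset.simps entry_simps add_0_right diff_conv_add_uminus[symmetric])
  next
    case (4 n)
    then have "p + 1 = - int (Suc n)" "p - 1 = - int (Suc (Suc (Suc n)))" by simp_all
    then show ?thesis using 4 t by (cases d) (simp_all only: cell_int shift.simps fst_conv snd_conv
        offset.simps entry_simps add_0_right diff_conv_add_uminus[symmetric])
  qed
qed

lemma cell_act: "cell (act a t) p = (if p + offset (snd a) = 0 then fst a else cell t (p + offset (snd a)))"
  by (simp add: act_def cell_shift cell_put)

lemma takeWhile_cell:
  assumes "cell t 1 = 0"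
  shows "takeWhile (\<lambda>a. a \<in> {1..k}) (snd t) = (if cell t 0 \<in> {1..k} then [cell t 0] else [])"
proof (cases "snd t")
  case (Cons a as)
  then show ?thesis using assms by (cases as) (auto simp: cell_def entry_simps)
qed (simp add: cell_def entry_simps)

section \<open>Machines given by transition functions\<close>

type_synonym response = "(nat \<Rightarrow> nat \<times> move) \<times> nat"

text \<open>Instructions mention concrete symbols, so a transition function is tabulated over all
  vectors of symbols below \<open>k\<close>; it is followed faithfully only while the heads scan no
  larger ones.\<close>

definition table :: "nat \<Rightarrow> nat \<Rightarrow> nat \<Rightarrow> (nat list \<Rightarrow> response) \<Rightarrow> instr list" where
  "table n k q d = map (\<lambda>rd. (q, map (\<lambda>i. (entry rd i, fst (d rd) i)) [0..<n], snd (d rd))) (List.n_lists n [0..<k])"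

lemma mem_table:
  "i \<in> set (table n k q d) \<longleftrightarrow> (\<exists>rd. length rd = n \<and> set rd \<subseteq> {..<k} \<and>
     i = (q, map (\<lambda>i. (entry rd i, fst (d rd) i)) [0..<n], snd (d rd)))"
  by (simp add: table_def set_n_lists image_iff atLeast0LessThan)

lemma map_entry: "length rd = n \<Longrightarrow> map (entry rd) [0..<n] = rd"
  by (rule nth_equalityI) (auto simp: entry_def)

definition respond :: "(nat \<Rightarrow> nat \<times> move) \<Rightarrow> tape list \<Rightarrow> tape list" where
  "respond f ts = map (\<lambda>i. act (f i) (ts ! i)) [0..<length ts]"

lemma find_unique:
  assumes "x \<in> set xs" "P x" "\<And>y. y \<in> set xs \<Longrightarrow> P y \<Longrightarrow> y = x"
  shows "find P xs = Some x"
proof (cases "find P xs")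
  case None
  then show ?thesis using assms(1,2) by (simp add: find_None_iff)
next
  case (Some y)
  then have "y \<in> set xs" "P y" by (auto simp: find_Some_iff)
  then show ?thesis using Some assms(3) by simp
qed

text \<open>Distinct rows have distinct read vectors, so only one instruction applies and its place
  in the program is immaterial.\<close>

lemma step_table:
  assumes tab: "set (table (length ts) k q d) \<subseteq> set (snd M)"
    and uniq: "\<And>i. i \<in> set (snd M) \<Longrightarrow> fst i = q \<Longrightarrow> i \<in> set (table (length ts) k q d)"
    and reads: "\<And>t. t \<in> set ts \<Longrightarrow> read t < k"
  shows "step M (q, ts) = (snd (d (map read ts)), respond (fst (d (map read ts))) ts)"
proof -
  let ?rd = "map read ts" and ?n = "length ts"
  let ?i = "(q, map (\<lambda>i. (entry ?rd i, fst (d ?rd) i)) [0..<?n], snd (d ?rd))"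
  have fsts: "map fst (map (\<lambda>i. (entry rd i, fst (d rd) i)) [0..<?n]) = rd" if "length rd = ?n" for rd
    using map_entry[OF that] by (simp add: comp_def)
  have "?i \<in> set (table ?n k q d)" unfolding mem_table using reads by (intro exI[of _ ?rd]) auto
  then have i: "?i \<in> set (snd M)" using tab by blast
  have app: "applicable (q, ts) ?i" using fsts[of ?rd] by simp
  have "j = ?i" if j: "j \<in> set (snd M)" "applicable (q, ts) j" for j
  proof -
    have "fst j = q" "map fst (fst (snd j)) = ?rd" using j(2) by (cases j; simp)+
    moreover obtain rd where "length rd = ?n" "j = (q, map (\<lambda>i. (entry rd i, fst (d rd) i)) [0..<?n], snd (d rd))"
      using uniq[OF j(1)] \<open>fst j = q\<close> unfolding mem_table by blast
    ultimately show ?thesis using fsts[of rd] by simp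
  qed
  then have "find (applicable (q, ts)) (snd M) = Some ?i"
    using find_unique[of ?i "snd M" "applicable (q, ts)"] i app by blast
  then have "step M (q, ts) = exec ?i (q, ts)" by (simp add: step_def)
  also have "\<dots> = (snd (d ?rd), respond (fst (d ?rd)) ts)"
    by (auto simp: respond_def act_def case_prod_beta intro!: nth_equalityI)
  finally show ?thesis .
qed

section \<open>The clocked simulation\<close>

text \<open>Tape 0 holds the input, tape 1 the answer stream of \<open>x\<close>, and tape \<open>r + 2\<close> register \<open>r\<close>, whose
  value is the position of the head. The cell at position 0 of a register tape is marked by 1, and
  that at position \<open>x\<close> of the tape of register 0 additionally by 2, so that the machine notices when
  this register contains \<open>x\<close>.\<close>

definition template :: "(nat \<Rightarrow> nat \<Rightarrow> bool) \<Rightarrow> nat \<Rightarrow> nat \<Rightarrow> nat \<Rightarrow> nat" where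
  "template col x i p = (if i = 1 then known col x 0 p
     else (if p = 0 then 1 else 0) + (if i = 2 \<and> p = x then 2 else 0))"

text \<open>In a prologue of \<open>2 * x + 1\<close> steps all heads but that of the input move to cell \<open>x\<close> and back, and
  fill in the template.\<close>

definition head :: "nat \<Rightarrow> nat \<Rightarrow> nat" where
  "head x j = (if j \<le> x then j else 2 * x + 1 - j)"

definition initialize :: "(nat \<Rightarrow> nat \<Rightarrow> bool) \<Rightarrow> nat \<Rightarrow> nat \<Rightarrow> nat list \<Rightarrow> response" where
  "initialize col x j rd = (\<lambda>i. if i = 0 then (entry rd 0, Stay)
      else (template col x i (head x j), if j < x then MoveRight else if j = x then Stay else MoveLeft),
     Suc j)"

text \<open>Every step moves the input head to the right, which is the clock. When the input is exhausted
  the machine halts, with output 1 if it is at an event and the answer stream says so.\<close>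

fun simulate :: "minsky list \<Rightarrow> nat \<Rightarrow> nat list \<Rightarrow> response" where
  "simulate P p rd = (if entry rd 0 = 0
     then (\<lambda>i. (if i = 0 then (if P ! p = IEvent \<and> entry rd 1 = 1 then 1 else 0) else entry rd i, Stay), length P)
     else let keep = (\<lambda>i. (entry rd i, if i = 0 then MoveRight else Stay)) in
       case P ! p of
         IInc r \<Rightarrow> (keep(r + 2 := (entry rd (r + 2), MoveRight)), p + 1)
       | IDec r q \<Rightarrow> if odd (entry rd (r + 2)) then (keep, q)
           else (keep(r + 2 := (entry rd (r + 2), MoveLeft)), p + 1)
       | IJmp q \<Rightarrow> (keep, q)
       | IMark \<Rightarrow> (if entry rd 2 \<ge> 2 then keep(1 := (if odd (entry rd 3) then 0 else 1, Stay)) else keep, p + 1)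
       | IEvent \<Rightarrow> (keep(1 := (entry rd 1, MoveRight)), p + 1))"

declare simulate.simps [simp del]

definition prologue :: "(nat \<Rightarrow> nat \<Rightarrow> bool) \<Rightarrow> nat \<Rightarrow> nat \<Rightarrow> nat \<Rightarrow> instr list" where
  "prologue col n k x = concat (map (\<lambda>j. table n k j (initialize col x j)) [0..<2 * x + 1])"

definition core :: "minsky list \<Rightarrow> nat \<Rightarrow> nat \<Rightarrow> instr list" where
  "core P n k = concat (map (\<lambda>p. table n k p (simulate P p)) [0..<length P])"

text \<open>Moves the core behind the \<open>2 * x + 1\<close> states of the prologue; nothing else
  in it varies with \<open>x\<close>.\<close>

definition relocate :: "nat \<Rightarrow> instr \<Rightarrow> instr" where
  "relocate d i = (fst i + d, fst (snd i), snd (snd i) + d)"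

text \<open>Input and stream come with \<open>n\<close> register tapes; the first component of a
  machine is one less than the number of its tapes.\<close>

definition machine_for :: "(nat \<Rightarrow> nat \<Rightarrow> bool) \<Rightarrow> minsky list \<Rightarrow> nat \<Rightarrow> nat \<Rightarrow> nat \<Rightarrow> machine" where
  "machine_for col P n k x =
     (n + 1, prologue col (n + 2) k x @ map (relocate (2 * x + 1)) (core P (n + 2) k))"

section \<open>Single steps of the assembled machine\<close>

lemma mem_prologue: "i \<in> set (prologue col n k x) \<longleftrightarrow> (\<exists>j<2 * x + 1. i \<in> set (table n k j (initialize col x j)))"
  by (simp add: prologue_def Bex_def del: upt_Suc)

lemma mem_relocate_core:
  "i \<in> set (map (relocate d) (core P n k)) \<longleftrightarrow>
    (\<exists>p<length P. i \<in> set (table n k (p + d) (\<lambda>rd. (fst (simulate P p rd), snd (simulate P p rd) + d))))"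
proof -
  have "map (relocate d) (table n k p e) = table n k (p + d) (\<lambda>rd. (fst (e rd), snd (e rd) + d))" for p e
    by (simp add: table_def relocate_def)
  then show ?thesis by (simp add: core_def map_concat comp_def del: set_map upt_Suc) (simp add: Bex_def)
qed

lemma fst_table: "i \<in> set (table n k q d) \<Longrightarrow> fst i = q"
  by (auto simp: mem_table)

lemma machine_for_cases:
  assumes "i \<in> set (snd (machine_for col P n k x))"
  obtains "fst i < 2 * x + 1" "i \<in> set (table (n + 2) k (fst i) (initialize col x (fst i)))"
  | p where "p < length P" "fst i = p + (2 * x + 1)"
    "i \<in> set (table (n + 2) k (fst i) (\<lambda>rd. (fst (simulate P p rd), snd (simulate P p rd) + (2 * x + 1))))"
proof -
  have "i \<in> set (prologue col (n + 2) k x) \<or> i \<in> set (map (relocate (2 * x + 1)) (core P (n + 2) k))"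
    using assms unfolding machine_for_def by (simp only: snd_conv set_append Un_iff)
  then show thesis
  proof
    assume "i \<in> set (prologue col (n + 2) k x)"
    then obtain j where j: "j < 2 * x + 1" "i \<in> set (table (n + 2) k j (initialize col x j))"
      unfolding mem_prologue by blast
    from fst_table[OF j(2)] j show thesis by (intro that(1)) (simp_all only:)
  next
    assume "i \<in> set (map (relocate (2 * x + 1)) (core P (n + 2) k))"
    then obtain p where p: "p < length P" "i \<in> set (table (n + 2) k (p + (2 * x + 1))
        (\<lambda>rd. (fst (simulate P p rd), snd (simulate P p rd) + (2 * x + 1))))"
      unfolding mem_relocate_core by blast
    from fst_table[OF p(2)] p show thesis by (intro that(2)[of p]) (simp_all only:)
  qed
qed

lemma step_prologue:
  assumes "j < 2 * x + 1" "length ts = n + 2" "\<And>t. t \<in> set ts \<Longrightarrow> read t < k"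
  shows "step (machine_for col P n k x) (j, ts) = (Suc j, respond (fst (initialize col x j (map read ts))) ts)"
proof -
  have "set (table (length ts) k j (initialize col x j)) \<subseteq> set (snd (machine_for col P n k x))"
  proof
    fix i assume "i \<in> set (table (length ts) k j (initialize col x j))"
    then have "i \<in> set (prologue col (n + 2) k x)"
      unfolding mem_prologue assms(2) using assms(1) by blast
    then show "i \<in> set (snd (machine_for col P n k x))"
      unfolding machine_for_def snd_conv set_append by (rule UnI1)
  qed
  moreover have "i \<in> set (table (length ts) k j (initialize col x j))"
    if "i \<in> set (snd (machine_for col P n k x))" "fst i = j" for i
    using that(1) by (rule machine_for_cases) (use that(2) assms(1,2) in simp_all)
  ultimately show ?thesis
    using step_table[of ts k j "initialize col x j", OF _ _ assms(3)] by (simp add: initialize_def)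
qed

lemma step_simulate:
  assumes "p < length P" "length ts = n + 2" "\<And>t. t \<in> set ts \<Longrightarrow> read t < k"
  shows "step (machine_for col P n k x) (p + (2 * x + 1), ts) =
    (snd (simulate P p (map read ts)) + (2 * x + 1), respond (fst (simulate P p (map read ts))) ts)"
proof -
  let ?d = "\<lambda>rd. (fst (simulate P p rd), snd (simulate P p rd) + (2 * x + 1))"
  have "set (table (length ts) k (p + (2 * x + 1)) ?d) \<subseteq> set (snd (machine_for col P n k x))"
  proof
    fix i assume "i \<in> set (table (length ts) k (p + (2 * x + 1)) ?d)"
    then have "i \<in> set (map (relocate (2 * x + 1)) (core P (n + 2) k))"
      unfolding mem_relocate_core assms(2) using assms(1) by blast
    then show "i \<in> set (snd (machine_for col P n k x))"
      unfolding machine_for_def snd_conv set_append by (rule UnI2)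
  qed
  moreover have "i \<in> set (table (length ts) k (p + (2 * x + 1)) ?d)"
    if "i \<in> set (snd (machine_for col P n k x))" "fst i = p + (2 * x + 1)" for i
    using that(1) by (rule machine_for_cases) (use that(2) assms(1,2) in simp_all)
  ultimately show ?thesis
    using step_table[of ts k "p + (2 * x + 1)" ?d, OF _ _ assms(3)] by simp
qed

lemma halted_machine_for: "halted (machine_for col P n k x) (length P + (2 * x + 1), ts)"
proof -
  have "fst i \<noteq> length P + (2 * x + 1)" if "i \<in> set (snd (machine_for col P n k x))" for i
    using that by (rule machine_for_cases) simp_all
  then show ?thesis by (auto simp: halted_def)
qed

lemma cell_act_keep: "fst a = cell t 0 \<Longrightarrow> cell (act a t) p = cell t (p + offset (snd a))"
  by (simp add: cell_act)

lemma nth_respond: "i < length ts \<Longrightarrow> respond f ts ! i = act (f i) (ts ! i)"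
  by (simp add: respond_def)

lemma length_respond: "length (respond f ts) = length ts"
  by (simp add: respond_def)

lemma entry_reads: "i < length ts \<Longrightarrow> entry (map read ts) i = cell (ts ! i) 0"
  by (simp add: entry_def read_cell)

lemma run_Suc: "run M (Suc n) w = step M (run M n w)"
  by (simp add: run_def)

lemma cell_input: "cell ([], w) p = (if 0 \<le> p then entry w (nat p) else 0)"
  by (simp add: cell_def entry_simps)

lemma entry_mem: "w \<in> lists A \<Longrightarrow> i < length w \<Longrightarrow> entry w i \<in> A"
  by (auto simp: entry_def lists_eq_set dest: nth_mem)

lemma entry_less: "w \<in> lists {1..k} \<Longrightarrow> entry w i \<le> k"
  using entry_mem[of w "{1..k}" i] by (cases "i < length w") (auto simp: entry_def)

lemma entry_eq_0_iff: "w \<in> lists {1..k} \<Longrightarrow> entry w i = 0 \<longleftrightarrow> length w \<le> i"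
  using entry_mem[of w "{1..k}" i] by (cases "i < length w") (auto simp: entry_def)

text \<open>Explains the symbol bound \<open>k + 4\<close>: the input uses the symbols up to
  \<open>k\<close>, all other tapes at most 3.\<close>

lemma template_le: "template col x i p \<le> 3"
  by (simp add: template_def known_def)

text \<open>\<open>q < j\<close> is the relevant bound on the way out and \<open>q \<le> x\<close>
  on the way back, where each cell receives the symbol it already has. The one \<open>Stay\<close>
  at cell \<open>x\<close> makes the number of steps odd.\<close>

definition prologue_rep :: "(nat \<Rightarrow> nat \<Rightarrow> bool) \<Rightarrow> nat \<Rightarrow> nat \<Rightarrow> nat list \<Rightarrow> nat \<Rightarrow> tape list \<Rightarrow> bool" where
  "prologue_rep col n x w j ts \<longleftrightarrow> length ts = n + 2 \<and> cell (ts ! 0) = cell ([], w) \<and>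
     (\<forall>i. 1 \<le> i \<and> i < n + 2 \<longrightarrow> (\<forall>p. cell (ts ! i) p =
        (let q = p + int (head x j) in
           if 0 \<le> q \<and> q < int j \<and> q \<le> int x then template col x i (nat q) else 0)))"

lemma prologue_rep_start: "prologue_rep col n x w 0 (([], w) # replicate (n + 1) ([], []))"
  by (auto simp: prologue_rep_def nth_Cons' cell_def entry_simps head_def Let_def)

lemma prologue_rep_step:
  assumes rep: "prologue_rep col n x w j ts" and j: "j < 2 * x + 1"
  shows "prologue_rep col n x w (Suc j) (respond (fst (initialize col x j (map read ts))) ts)"
proof -
  let ?f = "fst (initialize col x j (map read ts))"
  have len: "length ts = n + 2" using rep by (simp add: prologue_rep_def)
  have "cell (respond ?f ts ! 0) p = cell ([], w) p" for p
    using rep len by (simp add: prologue_rep_def nth_respond initialize_def cell_act_keep entry_reads)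
  moreover have "cell (respond ?f ts ! i) p =
        (let q = p + int (head x (Suc j)) in
           if 0 \<le> q \<and> q < int (Suc j) \<and> q \<le> int x then template col x i (nat q) else 0)"
    if i: "1 \<le> i" "i < n + 2" for i p
  proof -
    define d where "d = (if j < x then MoveRight else if j = x then Stay else MoveLeft)"
    have head: "int (head x (Suc j)) = int (head x j) + offset d"
      using j by (auto simp: head_def d_def)
    have hd: "head x j \<le> x" "head x j \<le> j" "j \<le> x \<Longrightarrow> head x j = j" using j by (auto simp: head_def)
    have "?f i = (template col x i (head x j), d)" using i by (simp add: initialize_def d_def)
    then have "cell (respond ?f ts ! i) p = (if p + offset d = 0 then template col x i (head x j) else cell (ts ! i) (p + offset d))"
      using i len by (simp add: nth_respond cell_act)
    also have "cell (ts ! i) (p + offset d) = (let q = p + offset d + int (head x j) in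
           if 0 \<le> q \<and> q < int j \<and> q \<le> int x then template col x i (nat q) else 0)"
      using rep i by (simp add: prologue_rep_def)
    finally have cell: "cell (respond ?f ts ! i) p = (if p + offset d = 0 then template col x i (head x j)
        else let q = p + offset d + int (head x j) in
           if 0 \<le> q \<and> q < int j \<and> q \<le> int x then template col x i (nat q) else 0)" .
    show ?thesis
    proof (cases "p + offset d = 0")
      case True
      then have q: "p + (int (head x j) + offset d) = int (head x j)" by simp
      show ?thesis unfolding cell head Let_def q using True hd(1,2) by simp
    next
      case False
      then show ?thesis unfolding cell head Let_def using hd by (auto simp: algebra_simps)
    qed
  qed
  ultimately show ?thesis using len by (simp add: prologue_rep_def length_respond fun_eq_iff)
qed

lemma run_prologue:
  assumes w: "w \<in> lists {1..k}" and j: "j \<le> 2 * x + 1"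
  shows "\<exists>ts. run (machine_for col P n (k + 4) x) j w = (j, ts) \<and> prologue_rep col n x w j ts"
  using j
proof (induction j)
  case 0
  show ?case using prologue_rep_start by (simp add: run_def start_def machine_for_def)
next
  case (Suc j)
  then obtain ts where ts: "run (machine_for col P n (k + 4) x) j w = (j, ts)" "prologue_rep col n x w j ts"
    by auto
  have len: "length ts = n + 2" using ts(2) by (simp add: prologue_rep_def)
  have "cell (ts ! i) 0 < k + 4" if "i < n + 2" for i
  proof (cases "i = 0")
    case True
    then show ?thesis using ts(2) entry_less[OF w, of 0] by (simp add: prologue_rep_def cell_input)
  next
    case False
    then show ?thesis using ts(2) that template_le[of col x i "head x j"]
      by (simp add: prologue_rep_def Let_def)
  qed
  then have reads: "read t < k + 4" if "t \<in> set ts" for t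
    using that len unfolding read_cell in_set_conv_nth by auto
  have "run (machine_for col P n (k + 4) x) (Suc j) w
      = (Suc j, respond (fst (initialize col x j (map read ts))) ts)"
    unfolding run_Suc ts(1) by (rule step_prologue[OF _ len reads]) (use Suc.prems in auto)
  then show ?case using prologue_rep_step[OF ts(2)] Suc.prems by auto
qed

text \<open>After \<open>m\<close> simulated instructions the input head is on cell \<open>m\<close>
  and the head of tape \<open>r + 2\<close> on cell \<open>s r\<close>. Tape 1 is described only
  from its head to the right, since that head no longer turns back.\<close>

definition rep :: "(nat \<Rightarrow> nat \<Rightarrow> bool) \<Rightarrow> nat \<Rightarrow> nat \<Rightarrow> nat list \<Rightarrow> nat \<Rightarrow>
    (nat \<Rightarrow> nat) \<Rightarrow> (nat \<Rightarrow> nat) \<Rightarrow> tape list \<Rightarrow> bool" where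
  "rep col n x w m s R ts \<longleftrightarrow> length ts = n + 2 \<and>
     (\<forall>p. cell (ts ! 0) p = cell ([], w) (p + int m)) \<and>
     (\<forall>i. cell (ts ! 1) (int i) = R i) \<and>
     (\<forall>r<n. \<forall>p. cell (ts ! (r + 2)) p =
        (let q = p + int (s r) in if 0 \<le> q then template col x (r + 2) (nat q) else 0))"

lemma prologue_rep_imp_rep:
  "prologue_rep col n x w (2 * x + 1) ts \<Longrightarrow> rep col n x w 0 (\<lambda>_. 0) (known col x 0) ts"
proof -
  assume rep: "prologue_rep col n x w (2 * x + 1) ts"
  have cell: "cell (ts ! i) p = (if 0 \<le> p \<and> p \<le> int x then template col x i (nat p) else 0)"
    if "1 \<le> i" "i < n + 2" for i p
    using rep that by (auto simp: prologue_rep_def head_def Let_def)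
  show ?thesis unfolding rep_def
  proof (intro conjI allI impI)
    show "length ts = n + 2" "cell (ts ! 0) p = cell ([], w) (p + int 0)" for p
      using rep by (simp_all add: prologue_rep_def)
    show "cell (ts ! 1) (int i) = known col x 0 i" for i
      by (subst cell) (auto simp: template_def known_def)
    show "cell (ts ! (r + 2)) p = (let q = p + int 0 in if 0 \<le> q then template col x (r + 2) (nat q) else 0)"
      if "r < n" for r p
      using that by (subst cell) (auto simp: template_def Let_def)
  qed
qed

text \<open>The alternatives for tape 1 are the ways in which \<open>update\<close> acts: overwrite
  the front bit, or drop it. Leaving the stream alone is the first alternative, with
  \<open>b\<close> the bit already there.\<close>

lemma rep_respond:
  assumes rep: "rep col n x w m s R ts"
    and f0: "f 0 = (cell (ts ! 0) 0, MoveRight)"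
    and f1: "f 1 = (b, Stay) \<and> R' = R(0 := b) \<or> f 1 = (R 0, MoveRight) \<and> R' = (\<lambda>i. R (Suc i))"
    and f2: "\<And>r. r < n \<Longrightarrow> fst (f (r + 2)) = cell (ts ! (r + 2)) 0 \<and>
      int (s' r) = int (s r) + offset (snd (f (r + 2)))"
  shows "rep col n x w (Suc m) s' R' (respond f ts)"
  unfolding rep_def
proof (intro conjI allI impI)
  have len: "length ts = n + 2" using rep by (simp add: rep_def)
  then show "length (respond f ts) = n + 2" by (simp add: length_respond)
  show "cell (respond f ts ! 0) p = cell ([], w) (p + int (Suc m))" for p
    using rep f0 by (simp add: rep_def nth_respond cell_act_keep add.assoc)
  show "cell (respond f ts ! 1) (int i) = R' i" for i
  proof -
    have R: "cell (ts ! 1) (int j) = R j" for j using rep by (simp add: rep_def)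
    from f1 show ?thesis
    proof (elim disjE conjE)
      assume "f 1 = (b, Stay)" "R' = R(0 := b)"
      then show ?thesis using R[of i] len by (simp add: nth_respond cell_act)
    next
      assume "f 1 = (R 0, MoveRight)" "R' = (\<lambda>i. R (Suc i))"
      then show ?thesis using R[of 0] R[of "Suc i"] len
        by (simp add: nth_respond cell_act_keep add.commute)
    qed
  qed
  show "cell (respond f ts ! (r + 2)) p =
        (let q = p + int (s' r) in if 0 \<le> q then template col x (r + 2) (nat q) else 0)" if "r < n" for r p
  proof -
    have "cell (respond f ts ! (r + 2)) p = cell (ts ! (r + 2)) (p + offset (snd (f (r + 2))))"
      using f2[OF that] that len by (simp add: nth_respond cell_act_keep)
    then show ?thesis using rep that f2[OF that] by (simp add: rep_def algebra_simps)
  qed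
qed

fun uses_below :: "nat \<Rightarrow> minsky \<Rightarrow> bool" where
  "uses_below n (IInc r) \<longleftrightarrow> r < n"
| "uses_below n (IDec r q) \<longleftrightarrow> r < n"
| "uses_below n _ \<longleftrightarrow> True"

lemma uses_below_mono: "uses_below n i \<Longrightarrow> n \<le> m \<Longrightarrow> uses_below m i"
  by (cases i) auto

text \<open>The lower bound 2 guarantees tapes for registers 0 and 1, which are read at
  \<open>IMark\<close>.\<close>

lemma uses_below_exists: "\<exists>n\<ge>2. \<forall>i\<in>set P. uses_below n i"
proof (induction P)
  case (Cons i P)
  then obtain n where n: "n \<ge> 2" "\<forall>i\<in>set P. uses_below n i" by auto
  obtain m where m: "uses_below m i" by (cases i) (auto intro: lessI)
  have "\<forall>j\<in>set (i # P). uses_below (max m n) j"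
    using n(2) m uses_below_mono[of _ _ "max m n"] by auto
  moreover have "max m n \<ge> 2" using n(1) by simp
  ultimately show ?case by blast
qed auto

lemma rep_simulate:
  assumes rep: "rep col n x w m s R ts" and n: "n \<ge> 2" "uses_below n (P ! p)"
    and m: "entry w m \<noteq> 0"
  shows "snd (simulate P p (map read ts)) = fst (mnext (P ! p) (p, s))"
    and "rep col n x w (Suc m) (snd (mnext (P ! p) (p, s))) (update x (mlabel (P ! p) s) R)
      (respond (fst (simulate P p (map read ts))) ts)"
proof -
  have len: "length ts = n + 2" using rep by (simp add: rep_def)
  have c0: "cell (ts ! 0) 0 = entry w m" using rep by (simp add: rep_def cell_input)
  have c1: "cell (ts ! 1) 0 = R 0" using rep unfolding rep_def by (metis of_nat_0)
  \<comment> \<open>One symbol carries two bits: odd means that the register is zero, and at least 2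
    means that it is register 0 and contains \<open>x\<close>.\<close>
  have c2: "cell (ts ! (r + 2)) 0 = (if s r = 0 then 1 else 0) + (if r = 0 \<and> s r = x then 2 else 0)" if "r < n" for r
    using rep that by (simp add: rep_def template_def)
  have odd: "odd (entry (map read ts) (r + 2)) \<longleftrightarrow> s r = 0" if "r < n" for r
    using c2[OF that] that len by (simp add: entry_reads)
  have rd: "entry (map read ts) i = cell (ts ! i) 0" if "i < n + 2" for i
    using that len by (simp add: entry_reads)
  have keep: "R(0 := cell (ts ! 1) 0) = R" using c1 by auto
  have "snd (simulate P p (map read ts)) = fst (mnext (P ! p) (p, s)) \<and>
    rep col n x w (Suc m) (snd (mnext (P ! p) (p, s))) (update x (mlabel (P ! p) s) R)
      (respond (fst (simulate P p (map read ts))) ts)"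
  proof (cases "P ! p")
    case (IInc r)
    have "rep col n x w (Suc m) (s(r := Suc (s r))) R (respond (fst (simulate P p (map read ts))) ts)"
      by (rule rep_respond[OF rep, where b = "cell (ts ! 1) 0"])
         (use IInc c0 m n keep in \<open>auto simp: simulate.simps rd\<close>)
    then show ?thesis using IInc c0 m by (simp add: simulate.simps rd)
  next
    case (IDec r q)
    then have r: "r < n" using n by simp
    show ?thesis
    proof (cases "s r = 0")
      case True
      have "rep col n x w (Suc m) s R (respond (fst (simulate P p (map read ts))) ts)"
        by (rule rep_respond[OF rep, where b = "cell (ts ! 1) 0"])
           (use IDec True c0 m n keep odd[OF r] in \<open>auto simp: simulate.simps rd\<close>)
      then show ?thesis using IDec True c0 m odd[OF r] by (simp add: simulate.simps rd)
    next
      case False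
      have "rep col n x w (Suc m) (s(r := s r - 1)) R (respond (fst (simulate P p (map read ts))) ts)"
        by (rule rep_respond[OF rep, where b = "cell (ts ! 1) 0"])
           (use IDec False c0 m n keep odd[OF r] in \<open>auto simp: simulate.simps rd\<close>)
      then show ?thesis using IDec False c0 m odd[OF r] by (simp add: simulate.simps rd)
    qed
  next
    case (IJmp q)
    have "rep col n x w (Suc m) s R (respond (fst (simulate P p (map read ts))) ts)"
      by (rule rep_respond[OF rep, where b = "cell (ts ! 1) 0"])
         (use IJmp c0 m n keep in \<open>auto simp: simulate.simps rd\<close>)
    then show ?thesis using IJmp c0 m by (simp add: simulate.simps rd)
  next
    case IMark
    have hit: "entry (map read ts) 2 \<ge> 2 \<longleftrightarrow> s 0 = x" using c2[of 0] n rd[of 2] by (auto simp: numeral_2_eq_2)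
    have bit: "odd (entry (map read ts) 3) \<longleftrightarrow> s 1 = 0" using odd[of 1] n by (simp add: numeral_3_eq_3 numeral_2_eq_2)
    have "rep col n x w (Suc m) s (update x (LMark (s 0) (s 1)) R) (respond (fst (simulate P p (map read ts))) ts)"
      by (rule rep_respond[OF rep, where b = "if s 0 = x then (if s 1 = 0 then 0 else 1) else cell (ts ! 1) 0"])
         (use IMark c0 m n keep hit bit in \<open>auto simp: simulate.simps rd\<close>)
    then show ?thesis using IMark c0 m by (simp add: simulate.simps rd Let_def)
  next
    case IEvent
    have "rep col n x w (Suc m) s (\<lambda>i. R (Suc i)) (respond (fst (simulate P p (map read ts))) ts)"
      by (rule rep_respond[OF rep])
         (use IEvent c0 c1 m n keep in \<open>auto simp: simulate.simps rd\<close>)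
    then show ?thesis using IEvent c0 m by (simp add: simulate.simps rd)
  qed
  then show "snd (simulate P p (map read ts)) = fst (mnext (P ! p) (p, s))"
    "rep col n x w (Suc m) (snd (mnext (P ! p) (p, s))) (update x (mlabel (P ! p) s) R)
      (respond (fst (simulate P p (map read ts))) ts)" by blast+
qed

text \<open>Keeps the scanned symbol of tape 1 within the tabulated range.\<close>

lemma stream_le_1: "stream P c x (known col x 0) n i \<le> 1"
proof (induction n arbitrary: i)
  case (Suc n)
  show ?case unfolding stream_simps by (cases "mlab P c n") (use Suc in auto)
qed (simp add: stream_simps known_def)

lemma rep_reads:
  assumes w: "w \<in> lists {1..k}" and rep: "rep col n x w m s R ts" and R: "R 0 \<le> 1"
  shows "\<forall>t\<in>set ts. read t < k + 4"
proof
  fix t assume "t \<in> set ts"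
  moreover have "length ts = n + 2" using rep by (simp add: rep_def)
  ultimately obtain i where i: "t = ts ! i" "i < n + 2"
    by (metis in_set_conv_nth)
  consider "i = 0" | "i = 1" | r where "i = r + 2" "r < n"
    using i(2) by (metis One_nat_def Suc_eq_plus1 add_2_eq_Suc' add_less_cancel_right not0_implies_Suc)
  then have "cell t 0 < k + 4"
  proof cases
    case 1
    then show ?thesis using rep i entry_less[OF w, of m] by (simp add: rep_def cell_input)
  next
    case 2
    then have "cell t 0 = R 0" using rep i unfolding rep_def by (metis of_nat_0)
    then show ?thesis using R by linarith
  next
    case (3 r)
    then show ?thesis using rep i template_le[of col x "r + 2" "s r"] by (simp add: rep_def)
  qed
  then show "read t < k + 4" by (simp add: read_cell)
qed

text \<open>While input remains, one machine step performs one instruction. The bound on the scanned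
  symbols is carried along because the tables cover nothing beyond it.\<close>

lemma run_simulate:
  assumes w: "w \<in> lists {1..k}" and n: "n \<ge> 2" "\<forall>i\<in>set P. uses_below n i"
    and P: "\<And>m. fst (mcfg P (0, \<lambda>_. 0) m) < length P" and m: "m \<le> length w"
  shows "\<exists>ts. run (machine_for col P n (k + 4) x) (2 * x + 1 + m) w =
      (fst (mcfg P (0, \<lambda>_. 0) m) + (2 * x + 1), ts) \<and>
    rep col n x w m (snd (mcfg P (0, \<lambda>_. 0) m)) (stream P (0, \<lambda>_. 0) x (known col x 0) m) ts \<and>
    (\<forall>t\<in>set ts. read t < k + 4)"
  using m
proof (induction m)
  case 0
  obtain ts where ts: "run (machine_for col P n (k + 4) x) (2 * x + 1) w = (2 * x + 1, ts)"
    "prologue_rep col n x w (2 * x + 1) ts"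
    using run_prologue[OF w order_refl] by blast
  have rep: "rep col n x w 0 (\<lambda>_. 0) (stream P (0, \<lambda>_. 0) x (known col x 0) 0) ts"
    using prologue_rep_imp_rep[OF ts(2)] by (simp add: stream_simps)
  with rep_reads[OF w rep stream_le_1] ts(1) show ?case by (simp add: mcfg_simps)
next
  case (Suc m)
  let ?c = "(0, \<lambda>_. 0)"
  obtain p s where ps: "mcfg P ?c m = (p, s)" by fastforce
  obtain ts where ts: "run (machine_for col P n (k + 4) x) (2 * x + 1 + m) w = (p + (2 * x + 1), ts)"
    "rep col n x w m s (stream P ?c x (known col x 0) m) ts" "\<forall>t\<in>set ts. read t < k + 4"
    using Suc ps by auto
  have p: "p < length P" using P[of m] ps by simp
  have len: "length ts = n + 2" using ts(2) by (simp add: rep_def)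
  have "entry w m \<noteq> 0" using Suc.prems entry_eq_0_iff[OF w] by simp
  note sim = rep_simulate[OF ts(2) n(1) n(2)[rule_format, OF nth_mem[OF p]] this]
  let ?ts = "respond (fst (simulate P p (map read ts))) ts"
  have nxt: "mcfg P ?c (Suc m) = mnext (P ! p) (p, s)" by (simp add: mcfg_simps(3) ps)
  have "run (machine_for col P n (k + 4) x) (2 * x + 1 + Suc m) w
      = (fst (mcfg P ?c (Suc m)) + (2 * x + 1), ?ts)"
    unfolding add_Suc_right run_Suc ts(1) nxt sim(1)[symmetric]
    by (rule step_simulate[OF p len]) (use ts(3) in blast)
  moreover have rep: "rep col n x w (Suc m) (snd (mcfg P ?c (Suc m))) (stream P ?c x (known col x 0) (Suc m)) ?ts"
    using sim(2) by (simp add: nxt stream_simps mlab_def ps)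
  ultimately show ?case using rep_reads[OF w rep stream_le_1] by blast
qed

lemma mlabel_eq_LEvent: "mlabel i s = LEvent \<longleftrightarrow> i = IEvent"
  by (cases i) auto

text \<open>The time is made up of \<open>2 * x + 1\<close> steps of prologue, one step per input
  symbol, and a last step on the first blank, which writes the answer and enters the state behind
  the program.\<close>

lemma machine_for_computes:
  assumes k: "k \<ge> 1" and n: "n \<ge> 2" "\<forall>i\<in>set P. uses_below n i"
    and P: "\<And>m. fst (mcfg P (0, \<lambda>_. 0) m) < length P"
  shows "computes_in_time k (machine_for col P n (k + 4) x) (\<lambda>m. m + (2 * x + 2))
    (\<lambda>w\<in>lists {1..k}. if mlab P (0, \<lambda>_. 0) (length w) = LEvent \<and>
       stream P (0, \<lambda>_. 0) x (known col x 0) (length w) 0 = 1 then [1] else [])"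
proof -
  let ?M = "machine_for col P n (k + 4) x" and ?c = "(0, \<lambda>_. 0)"
  have "halted ?M (run ?M (length w + (2 * x + 2)) w) \<and>
      result k (run ?M (length w + (2 * x + 2)) w) = (if mlab P ?c (length w) = LEvent \<and>
       stream P ?c x (known col x 0) (length w) 0 = 1 then [1] else [])" if w: "w \<in> lists {1..k}" for w
  proof -
    let ?m = "length w"
    obtain p s where ps: "mcfg P ?c ?m = (p, s)" by fastforce
    let ?R = "stream P ?c x (known col x 0) ?m"
    obtain ts where ts: "run ?M (2 * x + 1 + ?m) w = (p + (2 * x + 1), ts)" "rep col n x w ?m s ?R ts"
      "\<forall>t\<in>set ts. read t < k + 4"
      using run_simulate[OF w n P order_refl, of col x] ps by auto
    have p: "p < length P" using P[of ?m] ps by simp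
    have len: "length ts = n + 2" using ts(2) by (simp add: rep_def)
    \<comment> \<open>The cell to the right of the head is blank too, so a 1 written now is the
      entire output.\<close>
    have c0: "cell (ts ! 0) 0 = 0" "cell (ts ! 0) 1 = 0"
      using ts(2) by (simp_all add: rep_def cell_input entry_eq_0_iff[OF w] le_nat_iff)
    have c1: "cell (ts ! 1) 0 = ?R 0" using ts(2) unfolding rep_def by (metis of_nat_0)
    let ?b = "if P ! p = IEvent \<and> ?R 0 = 1 then 1 else 0 :: nat"
    have sim: "fst (simulate P p (map read ts)) 0 = (?b, Stay)" "snd (simulate P p (map read ts)) = length P"
      using c0 c1 len by (simp_all add: simulate.simps entry_reads)
    let ?ts = "respond (fst (simulate P p (map read ts))) ts"
    have "run ?M (Suc (2 * x + 1 + ?m)) w = (length P + (2 * x + 1), ?ts)"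
      unfolding run_Suc ts(1) sim(2)[symmetric]
      by (rule step_simulate[OF p len]) (use ts(3) in blast)
    moreover have "?m + (2 * x + 2) = Suc (2 * x + 1 + ?m)" by simp
    ultimately have run: "run ?M (?m + (2 * x + 2)) w = (length P + (2 * x + 1), ?ts)" by presburger
    have "cell (?ts ! 0) 0 = ?b" "cell (?ts ! 0) 1 = 0"
      using len c0 sim(1) by (simp_all add: nth_respond cell_act)
    then have "result k (length P + (2 * x + 1), ?ts) = (if ?b \<in> {1..k} then [?b] else [])"
      using len takeWhile_cell[of "?ts ! 0" k]
      by (simp add: result_def hd_conv_nth length_respond flip: length_greater_0_conv)
    moreover have "mlab P ?c ?m = LEvent \<longleftrightarrow> P ! p = IEvent" by (simp add: mlab_def ps mlabel_eq_LEvent)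
    ultimately show ?thesis unfolding run using halted_machine_for k by auto
  qed
  then show ?thesis unfolding computes_in_time_def using k by auto
qed

section \<open>The reduction\<close>

lemma cmp_entry [cmp_intros]: "cmp f \<Longrightarrow> cmp i \<Longrightarrow> cmp (\<lambda>x. entry (f x) (i x))"
proof -
  assume *: "cmp f" "cmp i"
  have "scanned ((tl ^^ i) xs) = entry xs i" for xs i
    by (induction i arbitrary: xs) (simp_all add: funpow_Suc_right entry_simps del: funpow.simps(2))
  moreover have "cmp (\<lambda>x. scanned ((tl ^^ i x) (f x)))" by (intro cmp_intros *)
  ultimately show ?thesis by simp
qed

text \<open>\<open>core\<close> stays folded: it does not contain \<open>x\<close> and counts as a
  constant, so only the prologue and the relocation are computed from \<open>x\<close>.\<close>

lemma cmp_machine_for: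
  assumes "cmp (\<lambda>p. col (fst p) (snd p))"
  shows "cmp (machine_for col P n k)"
proof -
  have col: "cmp (\<lambda>z. col (f z) (g z))" if "cmp f" "cmp g" for f g :: "'z::enc \<Rightarrow> nat"
    using cmp_compose[OF assms, of "\<lambda>z. (f z, g z)"] that by (simp add: cmp_intros)
  have "cmp (\<lambda>x. machine_for col P n k x)"
    unfolding machine_for_def prologue_def table_def initialize_def fst_conv snd_conv template_def
      known_def head_def relocate_def
    by (intro cmp_intros col)
  then show ?thesis by simp
qed

lemma decode_machine_enc: "decode_machine (enc M) = M"
proof -
  have list: "map dec (list_decode (enc xs)) = xs" if "\<And>x. dec (enc x) = x"
    for dec and xs :: "'x::enc list"
    using that by (simp add: enc_list_def comp_def)
  have move: "decode_move (enc d) = d" for d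
    by (cases d) (simp_all add: decode_move_def enc_move_def)
  have act: "decode_act (enc a) = a" for a
    by (cases a) (simp add: decode_act_def enc_simps move)
  have instr: "decode_instr (enc i) = i" for i
    by (cases i) (simp add: decode_instr_def enc_simps list act)
  show ?thesis
    by (cases M) (simp add: decode_machine_def enc_simps list instr)
qed

lemma Pi01_equiv_machines:
  assumes k: "k \<ge> 1" and E: "Pi01_equiv E"
  obtains g M where "cmp (M :: nat \<Rightarrow> machine)"
    "\<And>x. computes_in_time k (M x) (\<lambda>m. m + (2 * x + 2)) (g x)"
    "\<And>x y. (x, y) \<in> E \<longleftrightarrow> g x = g y"
proof -
  obtain col :: "nat \<Rightarrow> nat \<Rightarrow> bool" where col: "cmp (\<lambda>p. col (fst p) (snd p))"
    "\<And>x y. (x, y) \<in> E \<longleftrightarrow> (\<forall>n. col x n = col y n)"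
    using Pi01_equiv_coloring[OF E] by blast
  obtain F where F: "computable F" "\<And>p. F (enc p) = enc (col (fst p) (snd p))"
    using col(1) unfolding cmp_def by blast
  have "computable2 (\<lambda>x e. F (prod_encode (x, e)))"
    by (intro computable2_compose1[OF F(1)] computable2_prod_encode)
  moreover have "F (prod_encode (x, e)) = (if col x e then 1 else 0)" for x e
    using F(2)[of "(x, e)"] by (simp add: enc_simps)
  ultimately obtain f where "\<And>x e. eval f [x, e] (if col x e then 1 else 0)"
    unfolding computable2_def by auto
  then obtain P tr where P: "\<And>e. mrun P (0, sweep_state e) (tr e) (0, sweep_state (Suc e))"
    "\<And>e. filter (\<lambda>l. l \<noteq> LTau) (tr e) = map (\<lambda>x. LMark x (if col x e then 1 else 0)) [0..<Suc e] @ [LEvent]"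
    using sweep_program[of f "\<lambda>x e. if col x e then 1 else 0"] by blast
  define c :: state where "c = (0, \<lambda>_. 0)"
  have c: "c = (0, sweep_state 0)" by (simp add: c_def sweep_state_def fun_eq_iff)
  obtain ev where ev: "\<And>e. mlab P c (ev e) = LEvent" "\<And>n. mlab P c n = LEvent \<Longrightarrow> \<exists>e. n = ev e"
    "\<And>x e. stream P c x (known col x 0) (ev e) 0 = (if col x e then 1 else 0)"
    "\<And>n. fst (mcfg P c n) < length P"
    unfolding c using stream_events[OF P] by blast
  obtain n where n: "n \<ge> 2" "\<forall>i\<in>set P. uses_below n i" using uses_below_exists by blast
  define g where "g x = (\<lambda>w\<in>lists {1..k}. if mlab P c (length w) = LEvent \<and>
       stream P c x (known col x 0) (length w) 0 = 1 then [1 :: nat] else [])" for x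
  have g_ev: "g x w = (if col x e then [1] else [])" if "w \<in> lists {1..k}" "length w = ev e" for x w e
    using that ev(1,3) by (simp add: g_def)
  show thesis
  proof (rule that)
    show "cmp (machine_for col P n (k + 4))" using col(1) by (rule cmp_machine_for)
    show "computes_in_time k (machine_for col P n (k + 4) x) (\<lambda>m. m + (2 * x + 2)) (g x)" for x
      unfolding g_def c_def by (rule machine_for_computes[OF k n ev(4)[unfolded c_def]])
    show "(x, y) \<in> E \<longleftrightarrow> g x = g y" for x y
      unfolding col(2)
    proof
      assume eq: "\<forall>e. col x e = col y e"
      \<comment> \<open>Off the events both functions return \<open>[]\<close>; at the
        \<open>e\<close>-th event the front bit is that of \<open>col x e\<close> or
        \<open>col y e\<close>.\<close>
      have "stream P c x (known col x 0) m 0 = stream P c y (known col y 0) m 0"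
        if "mlab P c m = LEvent" for m using ev(2)[OF that] ev(3) eq by auto
      then show "g x = g y" unfolding g_def by (auto simp: restrict_def fun_eq_iff)
    next
      assume eq: "g x = g y"
      show "\<forall>e. col x e = col y e"
      proof
        fix e
        \<comment> \<open>A nonempty alphabet has a string of length \<open>ev e\<close>, at which
          \<open>[1]\<close> or \<open>[]\<close> reveals the bit.\<close>
        have "replicate (ev e) 1 \<in> lists {1..k}" using k by (auto simp: lists_eq_set)
        from g_ev[OF this] eq show "col x e = col y e" by (metis length_replicate list.distinct(1))
      qed
    qed
  qed
qed

lemma bigo_square: "(\<lambda>n. real (n + c)) \<in> O(\<lambda>n. real n ^ 2)"
proof (rule bigoI)
  show "\<forall>\<^sub>F n in sequentially. norm (real (n + c)) \<le> (real c + 1) * norm (real n ^ 2)"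
    using eventually_ge_at_top[of 1]
  proof eventually_elim
    case (elim n)
    then have "n \<le> n ^ 2" "c * 1 \<le> c * n ^ 2"
      by (simp add: power2_eq_square, intro mult_le_mono2, simp)
    then have "n + c * 1 \<le> n ^ 2 + c * n ^ 2" by (rule add_mono)
    then have "n + c \<le> (c + 1) * n ^ 2" by (simp only: distrib_right mult_1 mult_1_right add.commute)
    then have "real (n + c) \<le> real ((c + 1) * n ^ 2)" by (rule of_nat_mono)
    then show ?case by (simp add: algebra_simps)
  qed
qed

lemma Pi01_equiv_indices:
  assumes k: "k \<ge> 1" and E: "Pi01_equiv E"
  obtains g p q where "computable p" "computable q"
    "\<And>x. quadratic_time k (g x)" "\<And>x. g x = ptime k (p x)" "\<And>x. g x = qtime k (q x)"
    "\<And>x y. (x, y) \<in> E \<longleftrightarrow> g x = g y"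
proof -
  obtain g and M :: "nat \<Rightarrow> machine" where M: "cmp M"
    "\<And>x. computes_in_time k (M x) (\<lambda>m. m + (2 * x + 2)) (g x)"
    "\<And>x y. (x, y) \<in> E \<longleftrightarrow> g x = g y"
    using Pi01_equiv_machines[OF k E] by metis
  \<comment> \<open>Indices need a clock of the shape \<open>c * n ^ 2 + c\<close>; the choice
    \<open>c = 2 * x + 2\<close> dominates the linear bound, also at length 0.\<close>
  have "m + (2 * x + 2) \<le> (2 * x + 2) * m ^ 2 + (2 * x + 2)" for m x :: nat
  proof -
    have "m \<le> m ^ 2" by (simp add: power2_nat_le_imp_le power2_eq_square)
    also have "\<dots> \<le> (2 * x + 2) * m ^ 2" by simp
    finally show ?thesis by simp
  qed
  then have clocked: "clocked k (M x) (\<lambda>m. (2 * x + 2) * m ^ 2 + (2 * x + 2)) = g x" for x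
    by (rule clocked_eq[OF M(2)])
  show thesis
  proof (rule that[of "\<lambda>x. enc (M x, 2 * x + 2, 2 :: nat)" "\<lambda>x. enc (M x, 2 * x + 2)" g])
    show "computable (\<lambda>x. enc (M x, 2 * x + 2, 2 :: nat))" "computable (\<lambda>x. enc (M x, 2 * x + 2))"
      by (intro computable_enc cmp_intros cmp_compose[OF M(1)])+
    show "quadratic_time k (g x)" for x
      unfolding quadratic_time_def time_degree_def by (intro exI conjI, rule bigo_square, rule M(2))
    show "g x = ptime k (enc (M x, 2 * x + 2, 2 :: nat))" "g x = qtime k (enc (M x, 2 * x + 2))" for x
      using clocked[of x] by (simp_all add: ptime_def qtime_def enc_simps decode_machine_enc)
  qed (rule M(3))
qed

theorem theorem5p2:
  fixes k :: nat
  assumes "k \<ge> 1"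
  shows "Pi01_complete {(i, j). ptime k i = ptime k j} \<and>
         Pi01_complete {(i, j). qtime k i = qtime k j} \<and>
         (\<forall>E. Pi01_equiv E \<longrightarrow>
            (\<exists>g p q. computable p \<and> computable q \<and>
               (\<forall>x. quadratic_time k (g x) \<and> g x = ptime k (p x) \<and> g x = qtime k (q x)) \<and>
               (\<forall>x y. (x, y) \<in> E \<longleftrightarrow> g x = g y)))"
proof -
  have ind: "\<exists>g p q. computable p \<and> computable q \<and>
               (\<forall>x. quadratic_time k (g x) \<and> g x = ptime k (p x) \<and> g x = qtime k (q x)) \<and>
               (\<forall>x y. (x, y) \<in> E \<longleftrightarrow> g x = g y)" if "Pi01_equiv E" for E
    by (rule Pi01_equiv_indices[OF assms that]) blast
  have "reducible E {(i, j). ptime k i = ptime k j}" "reducible E {(i, j). qtime k i = qtime k j}"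
    if E: "Pi01_equiv E" for E
  proof -
    obtain g p q where "computable p" "computable q"
      "\<And>x. g x = ptime k (p x)" "\<And>x. g x = qtime k (q x)" "\<And>x y. (x, y) \<in> E \<longleftrightarrow> g x = g y"
      using ind[OF E] by blast
    then show "reducible E {(i, j). ptime k i = ptime k j}" "reducible E {(i, j). qtime k i = qtime k j}"
      unfolding reducible_def mem_Collect_eq case_prod_conv by auto
  qed
  then show ?thesis
    using ind Pi01_equiv_ptime Pi01_equiv_qtime unfolding Pi01_complete_def by blast
qed

end
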